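(* Let $n \geq 2$. Suppose $f$ is a positive continuous function on $S^{n-1}$ and $\nu$ is an isotropic $f$-centered Borel measure on $S^{n-1}$. If $\mathrm{disp}\, W_{\nu,f}=0$, then \[V(W_{\nu,f}) \leq \frac{(n+1)^{(n+1)/2}}{n!}\,\| f\|^{n}_{L^2(\nu)}\] with equality if and only if $\mathrm{conv}\,\mathrm{supp}\,\nu$ is a regular simplex inscribed in $S^{n-1}$ and $f$ is constant on $\mathrm{supp}\,\nu$.
   Context: The setting is Euclidean space $\mathbb{R}^n$, $n\ge 2$, with unit sphere $S^{n-1}$; $V$ denotes volume ($n$-dimensional Lebesgue measure). All Borel measures are non-negative and finite. $\mathrm{supp}\,\nu$ is the support of $\nu$ and $\mathrm{conv}$ denotes convex hull. $\|f\|_{L^2(\nu)}=\left(\int_{S^{n-1}} f^2\,d\nu\right)^{1/2}$. A Borel measure $\nu$ on $S^{n-1}$ is called isotropic if $\int_{S^{n-1}} u\otimes u\,d\nu(u)=I_n$, where $u\otimes u$ is the orthogonal projection onto the line spanned by $u$ and $I_n$ is the identity map on $\mathbb{R}^n$. For a positive continuous function $f$ on $S^{n-1}$, $\nu$ is called $f$-centered if $\int_{S^{n-1}} f(u)\,u\,d\nu(u)=o$, where $o$ is the origin. The Wulff shape determined by $\nu$ and $f$ is \[W_{\nu,f}=\{x\in\mathbb{R}^n: x\cdot u\le f(u)\text{ for all }u\in\mathrm{supp}\,\nu\}.\] When $\nu$ is isotropic and $f$-centered, $W_{\nu,f}$ is a compact convex set containing the origin in its interior. Its displacement is the real number \[\mathrm{disp}\,W_{\nu,f}=\mathrm{cd}\,W_{\nu,f}\cdot\int_{S^{n-1}}\frac{u}{f(u)}\,d\nu(u),\]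 where $\mathrm{cd}\,W_{\nu,f}$ denotes the centroid of $W_{\nu,f}$ and $\cdot$ is the standard inner product. *)

theory Defs
  imports "HOL-Analysis.Analysis"
begin

definition sphere_borel_measure :: "(real^'n) measure \<Rightarrow> bool" where
  "sphere_borel_measure \<nu> \<longleftrightarrow>
     sets \<nu> = sets (restrict_space borel (sphere 0 1)) \<and> finite_measure \<nu>"

definition measure_support :: "'a::topological_space measure \<Rightarrow> 'a set" where
  "measure_support \<nu> =
     {u \<in> space \<nu>. \<forall>U. open U \<and> u \<in> U \<longrightarrow> emeasure \<nu> (U \<inter> space \<nu>) > 0}"

(* For a unit vector u, the matrix outer u u represents the orthogonal
   projection x |-> (x . u) u onto the line spanned by u. *)
definition outer :: "real^'n \<Rightarrow> real^'n \<Rightarrow> real^'n^'n" where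
  "outer u v = (\<chi> i j. u $ i * v $ j)"

definition isotropic :: "(real^'n) measure \<Rightarrow> bool" where
  "isotropic \<nu> \<longleftrightarrow> (LINT u|\<nu>. outer u u) = mat 1"

definition centered_wrt :: "(real^'n \<Rightarrow> real) \<Rightarrow> (real^'n) measure \<Rightarrow> bool" where
  "centered_wrt f \<nu> \<longleftrightarrow> (LINT u|\<nu>. f u *\<^sub>R u) = 0"

definition wulff_shape :: "(real^'n) measure \<Rightarrow> (real^'n \<Rightarrow> real) \<Rightarrow> (real^'n) set" where
  "wulff_shape \<nu> f = {x. \<forall>u \<in> measure_support \<nu>. x \<bullet> u \<le> f u}"

definition centroid :: "(real^'n) set \<Rightarrow> real^'n" where
  "centroid K = (1 / measure lebesgue K) *\<^sub>R (LINT x:K|lebesgue. x)"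

definition wulff_disp :: "(real^'n) measure \<Rightarrow> (real^'n \<Rightarrow> real) \<Rightarrow> real" where
  "wulff_disp \<nu> f = centroid (wulff_shape \<nu> f) \<bullet> (LINT u|\<nu>. (1 / f u) *\<^sub>R u)"

definition L2_norm_wrt :: "(real^'n) measure \<Rightarrow> (real^'n \<Rightarrow> real) \<Rightarrow> real" where
  "L2_norm_wrt \<nu> f = sqrt (LINT u|\<nu>. (f u)\<^sup>2)"

definition vertices :: "(real^'n) set \<Rightarrow> (real^'n) set" where
  "vertices P = {x. x extreme_point_of P}"

(* Full-dimensional simplex all of whose edges have the same length. *)
definition regular_simplex :: "(real^'n) set \<Rightarrow> bool" where
  "regular_simplex P \<longleftrightarrow>
     int CARD('n) simplex P \<and> (\<exists>d. pairwise (\<lambda>x y. dist x y = d) (vertices P))"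

definition inscribed_in_sphere :: "(real^'n) set \<Rightarrow> bool" where
  "inscribed_in_sphere P \<longleftrightarrow> vertices P \<subseteq> sphere 0 1"

end

theory Submission
  imports Defs "HOL-Probability.Probability"
begin

text \<open>Let \<open>n = CARD('n)\<close> and \<open>L = L2_norm_wrt \<nu> f\<close>, and lift a direction \<open>u\<close> to
\<open>w u = (-u, f u / L)\<close> in one dimension more. Isotropy of \<open>\<nu>\<close>, the centering condition and the
value of \<open>L\<close> are exactly the blocks of the single identity \<open>\<integral> w \<otimes> w d\<nu> = I\<close>
(\<open>isotropy_w\<close>). The open cone \<open>C = {y. y \<bullet> w u > 0 for all u in the support}\<close> has at height
\<open>t > 0\<close> the slice \<open>(t / L) W\<close>, up to boundary, where \<open>W\<close> is the Wulff shape, and no points at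
other heights (\<open>pos_cone_lift\<close>). So an
integral of \<open>exp (- y \<bullet> v)\<close> over \<open>C\<close> is a statement about the volume of \<open>W\<close>; the proof
estimates such an integral from both sides, for \<open>v = \<integral> (|w|^2 / f) w d\<nu>\<close>.

Upper bound (\<open>laplace_cone_le\<close>). Let \<open>T\<close> transport the exponential law to the Gaussian law on
the line, that is \<open>T' = sqrt (2 pi) exp (T^2 / 2 - s)\<close>. The map
\<open>y \<mapsto> \<integral> T (y \<bullet> w / f) |w| w d\<nu>\<close> is injective on \<open>C\<close>, since \<open>T\<close> is increasing, and its
derivative is a weighted frame operator \<open>\<integral> \<theta> w \<otimes> w d\<nu>\<close>. Two consequences of isotropy
compare its Jacobian with the Gaussian density at the image point: the determinant is at least
\<open>exp (\<integral> |w|^2 ln \<theta> d\<nu>)\<close> by concavity of the logarithm along an eigenbasis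
(\<open>det_frame_operator_ge\<close>), and the image has squared norm at most \<open>\<integral> T^2 |w|^2 d\<nu>\<close> by
Bessel's inequality (\<open>bessel_identity\<close>). In the product the terms with \<open>T^2\<close> cancel, and
integrating the Gaussian over the image of \<open>C\<close> gives
\<open>\<integral>_C exp (- y \<bullet> v) dy \<le> exp (- \<integral> |w|^2 ln (|w| / f) d\<nu>)\<close>.

Lower bound (\<open>laplace_ge_flat\<close>). Here \<open>v = (-a, (n + 1) / L)\<close> with \<open>a = \<integral> u / f d\<nu>\<close>.
Vanishing displacement says that \<open>z \<bullet> a\<close> has integral zero over \<open>W\<close>, so \<open>exp x \<ge> 1 + x\<close> shows that
dropping \<open>a\<close> can only decrease the integral over each slice. What remains is the volume of \<open>W\<close>
times a Gamma integral in \<open>t\<close>.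

With \<open>p = f^2 / L^2\<close>, which has integral 1 against a measure of mass \<open>n\<close>, the two bounds
combine to the theorem by Jensen's inequality for \<open>(1 + p) ln (1 + 1 / p)\<close>
(\<open>ratio_entropy_ge\<close>).

In the case of equality, Jensen's inequality forces \<open>f\<close> to be constant on the support, and Bessel's
inequality becomes an equality: on the support, \<open>T (y \<bullet> w / f) |w|\<close> is the restriction of a linear
functional of \<open>w\<close>, for every \<open>y\<close> in \<open>C\<close>. Differentiating in \<open>y\<close> shows that each \<open>w u\<close> is an
eigenvector of the derivative of the transport map, with an eigenvalue that separates different \<open>u\<close>
as \<open>y\<close> varies. Hence the vectors \<open>w u\<close> are pairwise orthogonal (\<open>rigid_orthogonal\<close>); since they
span, there are \<open>n + 1\<close> of them, and \<open>f\<close> being constant they project to the vertices of a regular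
simplex. Conversely, for \<open>n + 1\<close> support points isotropy makes the vectors \<open>w u\<close> an orthogonal
basis, \<open>C\<close> is an orthant, and the integral above can be evaluated exactly.\<close>

section \<open>From the exponential to the Gaussian law\<close>

text \<open>The fundamental theorem of calculus, read for the distribution function of the measure with Gaussian
density.\<close>

lemma std_normal_cdf_deriv:
  defines "G \<equiv> cdf (density lborel std_normal_density)"
  shows "(G has_real_derivative std_normal_density z) (at z)"
proof -
  define N where "N = density lborel (\<lambda>x. ennreal (std_normal_density x))"
  interpret N: prob_space N
    unfolding N_def by (rule prob_space_normal_density) simp
  interpret N: finite_borel_measure N
    by unfold_locales (simp add: N_def)
  have cont: "continuous_on S std_normal_density" for S
    unfolding std_normal_density_def by (intro continuous_intros) auto
  define a where "a = z - 1"
  define b where "b = z + 1"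
  have eq: "G a + integral {a..x} std_normal_density = G x" if x: "x \<in> {a..b}" for x
  proof (cases "x = a")
    case False
    then have "a < x" using x by auto
    have "G x - G a = measure N {a<..x}"
      unfolding G_def using N.cdf_diff_eq[OF \<open>a < x\<close>] by (simp add: N_def)
    also have "emeasure N {a<..x} = emeasure N {a..x}"
      unfolding N_def
      using AE_lborel_singleton[of a]
      by (subst (1 2) emeasure_density)
         (auto intro!: nn_integral_cong_AE elim!: eventually_mono split: split_indicator)
    then have "measure N {a<..x} = measure N {a..x}" by (simp add: measure_def)
    also have "measure N {a..x} = (LINT t:{a..x}|lborel. std_normal_density t)"
    proof -
      have int: "set_integrable lborel {a..x} std_normal_density"
        by (intro borel_integrable_atLeastAtMost' cont)
      have "emeasure N {a..x} = (\<integral>\<^sup>+t. ennreal (indicator {a..x} t *\<^sub>R std_normal_density t) \<partial>lborel)"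
        unfolding N_def
        by (subst emeasure_density) (auto intro!: nn_integral_cong split: split_indicator)
      also have "\<dots> = ennreal (LINT t:{a..x}|lborel. std_normal_density t)"
        using int unfolding set_lebesgue_integral_def set_integrable_def
        by (intro nn_integral_eq_integral) auto
      finally show ?thesis
        by (simp add: measure_def set_lebesgue_integral_def integral_nonneg_AE)
    qed
    also have "\<dots> = integral {a..x} std_normal_density"
      by (intro set_borel_integral_eq_integral(2) borel_integrable_atLeastAtMost' cont)
    finally show ?thesis by simp
  qed simp
  have "((\<lambda>x. G a + integral {a..x} std_normal_density) has_real_derivative std_normal_density z) (at z within {a..b})"
    by (auto intro!: derivative_eq_intros integral_has_real_derivative cont simp: a_def b_def)
  then have "(G has_real_derivative std_normal_density z) (at z within {a..b})"
  proof (rule has_field_derivative_transform_within[where d=1])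
    show "z \<in> {a..b}" by (simp add: a_def b_def)
  qed (use eq in auto)
  then show ?thesis
    using at_within_interior[of z "{a..b}"] by (simp add: a_def b_def)
qed

text \<open>If \<open>G\<close> is the standard normal distribution function, then \<open>T s = inv G (1 - exp (- s))\<close> maps the
exponential law to the normal law, and equating densities yields the differential equation. Later
arguments use nothing about \<open>T\<close> but this equation and its measurability.\<close>

lemma exponential_to_gaussian_transport:
  obtains T :: "real \<Rightarrow> real" where "T \<in> borel_measurable borel"
    and "\<And>s. 0 < s \<Longrightarrow> (T has_real_derivative sqrt (2 * pi) * exp ((T s)\<^sup>2 / 2 - s)) (at s)"
proof -
  define N where "N = density lborel (\<lambda>x. ennreal (std_normal_density x))"
  define G where "G = cdf N"
  interpret N: prob_space N
    unfolding N_def by (rule prob_space_normal_density) simp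
  interpret N: real_distribution N
    by unfold_locales (simp_all add: N_def)
  have dG: "(G has_real_derivative std_normal_density z) (at z)" for z
    using std_normal_cdf_deriv unfolding G_def N_def .
  have pos: "0 < std_normal_density z" for z by (simp add: normal_density_pos)
  have mono: "strict_mono G"
    using dG pos by (meson DERIV_pos_imp_increasing strict_mono_onI strict_monoI)
  have cont: "continuous_on S G" for S
    using dG by (meson DERIV_isCont continuous_at_imp_continuous_on)
  have ex: "\<exists>z. G z = p" if p: "0 < p" "p < 1" for p
  proof -
    have "\<forall>\<^sub>F z in at_bot. G z < p"
      using N.cdf_lim_at_bot p(1) unfolding G_def by (rule order_tendstoD)
    then obtain l where l: "G l < p" by (auto simp: eventually_at_bot_linorder)
    have "\<forall>\<^sub>F z in at_top. G z > p"
      using N.cdf_lim_at_top_prob p(2) unfolding G_def by (rule order_tendstoD)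
    then obtain u where u: "G u > p" by (auto simp: eventually_at_top_linorder)
    have "l \<le> u" using l u mono by (meson less_trans linorder_le_less_linear order_less_imp_not_less strict_monoD)
    with l u show ?thesis using IVT'[of G l p u] cont by (meson less_imp_le)
  qed
  define g where "g = inv G"
  have gG: "g (G z) = z" for z
    unfolding g_def using mono by (simp add: strict_mono_imp_inj_on)
  have Gg: "G (g p) = p" if "0 < p" "p < 1" for p
    using ex[OF that] gG by metis
  define T where "T s = indicator {0<..} s *\<^sub>R g (1 - exp (- s))" for s
  have dT: "(T has_real_derivative sqrt (2 * pi) * exp ((T s)\<^sup>2 / 2 - s)) (at s)" if s: "0 < s" for s
  proof -
    have p: "0 < 1 - exp (-s)" "1 - exp (-s) < 1" using s by auto
    have Ts: "T s = g (1 - exp (-s))" using s by (simp add: T_def)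
    have "isCont g (G (T s))"
      by (rule isCont_inverse_function[where d=1]) (use gG DERIV_isCont[OF dG] in auto)
    then have "isCont g (1 - exp (-s))" using Gg[OF p] Ts by simp
    then have "(g has_real_derivative inverse (std_normal_density (T s))) (at (1 - exp (-s)))"
      using dG[of "g (1 - exp (-s))"] pos[of "T s"] p Gg Ts
      by (intro DERIV_inverse_function[where f=G and a=0 and b=1]) auto
    then have "((\<lambda>s. g (1 - exp (-s))) has_real_derivative inverse (std_normal_density (T s)) * exp (-s)) (at s)"
      by (rule DERIV_chain2) (auto intro!: derivative_eq_intros)
    moreover have "\<forall>\<^sub>F x in nhds s. T x = g (1 - exp (-x))"
      using s by (intro eventually_nhds_in_open[of "{0<..}", THEN eventually_mono]) (auto simp: T_def)
    ultimately have "(T has_real_derivative inverse (std_normal_density (T s)) * exp (-s)) (at s)"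
      using DERIV_cong_ev[OF refl _ refl, of T "\<lambda>s. g (1 - exp (-s))" s] by simp
    moreover have "inverse (std_normal_density (T s)) * exp (-s) = sqrt (2 * pi) * exp ((T s)\<^sup>2 / 2 - s)"
    proof -
      have "exp ((T s)\<^sup>2 / 2 - s) = exp ((T s)\<^sup>2 / 2) * exp (- s)"
        using exp_add[of "(T s)\<^sup>2 / 2" "- s"] by simp
      then show ?thesis
        unfolding std_normal_density_def using exp_minus[of "(T s)\<^sup>2 / 2"] by (simp add: inverse_eq_divide)
    qed
    ultimately show ?thesis by simp
  qed
  have "continuous_on {0<..} T"
    using dT by (meson DERIV_isCont continuous_at_imp_continuous_on greaterThan_iff)
  then have "(\<lambda>x. indicator {0<..} x *\<^sub>R T x) \<in> borel_measurable borel"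
    by (intro borel_measurable_continuous_on_indicator) auto
  also have "(\<lambda>x. indicator {0<..} x *\<^sub>R T x) = T" by (auto simp: T_def indicator_def)
  finally show ?thesis using dT that by blast
qed

section \<open>Orthonormal eigenbases of symmetric matrices\<close>

text \<open>A maximiser \<open>v\<close> of the Rayleigh quotient on the unit sphere of an invariant subspace is an
eigenvector: the first variation of the quotient in the direction of the residual
\<open>r = f v - c v\<close>, which lies in the subspace, is a positive multiple of \<open>r \<bullet> r\<close>.\<close>

lemma self_adjoint_eigenvector_in_subspace:
  fixes f :: "'a::euclidean_space \<Rightarrow> 'a"
  assumes lin: "linear f" and sa: "\<And>x y. f x \<bullet> y = x \<bullet> f y"
    and S: "subspace S" "f ` S \<subseteq> S" "S \<noteq> {0}"
  obtains v c where "v \<in> S" "norm v = 1" "f v = c *\<^sub>R v"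
proof -
  define K where "K = S \<inter> sphere 0 1"
  have "compact K" unfolding K_def by (metis S(1) closed_Int_compact closed_subspace compact_sphere)
  obtain x where x: "x \<in> S" "x \<noteq> 0" using S subspace_0 by blast
  have "x /\<^sub>R norm x \<in> K" unfolding K_def using subspace_scale[OF S(1) x(1)] x(2) by simp
  then have "K \<noteq> {}" by auto
  have "continuous_on K (\<lambda>x. f x \<bullet> x)"
    by (intro continuous_on_inner continuous_on_id linear_continuous_on)
       (simp add: lin linear_linear)
  from continuous_attains_sup[OF \<open>compact K\<close> \<open>K \<noteq> {}\<close> this]
  obtain v where v: "v \<in> K" and max: "\<And>y. y \<in> K \<Longrightarrow> f y \<bullet> y \<le> f v \<bullet> v" by auto
  define c where "c = f v \<bullet> v"
  have nv: "norm v = 1" "v \<in> S" using v by (auto simp: K_def)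
  have le: "f y \<bullet> y \<le> c * (y \<bullet> y)" if "y \<in> S" for y
  proof (cases "y = 0")
    case True then show ?thesis by (simp add: lin linear_0)
  next
    case False
    then have "y /\<^sub>R norm y \<in> K" unfolding K_def using subspace_scale[OF S(1) that] by simp
    from max[OF this] show ?thesis using False
      by (simp add: lin linear_scale c_def field_simps power2_eq_square[symmetric] power2_norm_eq_inner)
  qed
  define r where "r = f v - c *\<^sub>R v"
  have rS: "r \<in> S" using nv(2) S by (auto simp: r_def intro!: subspace_diff subspace_scale)
  have "r \<bullet> r = 0"
  proof (rule ccontr)
    assume ne: "r \<bullet> r \<noteq> 0"
    \<comment> \<open>first variation: compare the quadratic form at \<open>v + t r\<close> with its maximum, for small \<open>t\<close>\<close>
    define M where "M = c * (r \<bullet> r) - f r \<bullet> r"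
    have ineq: "2 * t * (r \<bullet> r) \<le> t\<^sup>2 * M" for t
    proof -
      have "v + t *\<^sub>R r \<in> S" using nv rS S(1) by (auto intro!: subspace_add subspace_scale)
      from le[OF this] have "f v \<bullet> v + 2 * t * (f v \<bullet> r) + t\<^sup>2 * (f r \<bullet> r) \<le> c * (v \<bullet> v + 2 * t * (v \<bullet> r) + t\<^sup>2 * (r \<bullet> r))"
        using sa[of r v] by (simp add: lin linear_add linear_scale inner_add inner_commute algebra_simps power2_eq_square)
      moreover have "v \<bullet> v = 1" using nv by (simp add: norm_eq_1)
      moreover have "f v \<bullet> r = r \<bullet> r + c * (v \<bullet> r)" by (simp add: r_def algebra_simps)
      moreover have "f v \<bullet> v = c" by (simp add: c_def)
      ultimately show ?thesis unfolding M_def by (simp only:) (simp add: algebra_simps)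
    qed
    have rr: "r \<bullet> r > 0" using ne by (simp add: order_less_le)
    define t where "t = (r \<bullet> r) / (\<bar>M\<bar> + 1)"
    have t: "t > 0" using rr by (simp add: t_def)
    have "2 * (r \<bullet> r) \<le> t * M" using ineq[of t] t by (simp add: power2_eq_square)
    also have "\<dots> \<le> t * (\<bar>M\<bar> + 1)" using t by (intro mult_left_mono) auto
    also have "\<dots> = r \<bullet> r" by (simp add: t_def)
    finally show False using rr by simp
  qed
  then have "f v = c *\<^sub>R v" by (simp add: r_def)
  with nv that show ?thesis by blast
qed

text \<open>The orthogonal complement of an eigenvector in an invariant subspace is again invariant, so
eigenvectors can be split off one at a time.\<close>

lemma self_adjoint_orthonormal_eigenbasis:
  fixes f :: "'a::euclidean_space \<Rightarrow> 'a"
  assumes lin: "linear f" and sa: "\<And>x y. f x \<bullet> y = x \<bullet> f y"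
    and S: "subspace S" "f ` S \<subseteq> S"
  shows "\<exists>B. B \<subseteq> S \<and> pairwise orthogonal B \<and> (\<forall>b\<in>B. norm b = 1 \<and> (\<exists>c. f b = c *\<^sub>R b)) \<and> finite B \<and> card B = dim S"
  using S
proof (induction "dim S" arbitrary: S)
  case 0
  then show ?case by (intro exI[of _ "{}"]) auto
next
  case (Suc d)
  have "S \<noteq> {0}" using Suc(2) by (metis dim_singleton nat.distinct(1) dim_eq_0 order_refl)
  from self_adjoint_eigenvector_in_subspace[OF lin sa Suc.prems this]
  obtain v c where v: "v \<in> S" "norm v = 1" "f v = c *\<^sub>R v" .
  define U where "U = {x \<in> S. v \<bullet> x = 0}"
  have U: "subspace U" using Suc.prems(1) unfolding U_def subspace_def by (auto simp: inner_add)
  have fU: "f ` U \<subseteq> U" using Suc.prems(2) v sa by (auto simp: U_def) (metis inner_scaleR_left mult_zero_right)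
  have vv: "v \<bullet> v = 1" using v by (simp add: norm_eq_1)
  have ins: "S = span (insert v U)"
  proof
    show "span (insert v U) \<subseteq> S" using v Suc.prems(1) by (intro span_minimal) (auto simp: U_def)
    show "S \<subseteq> span (insert v U)"
    proof
      fix x assume x: "x \<in> S"
      have "x - (v \<bullet> x) *\<^sub>R v \<in> U" using x v vv Suc.prems(1)
        by (auto simp: U_def inner_diff_right intro!: subspace_diff subspace_scale)
      then show "x \<in> span (insert v U)"
        by (metis span_breakdown_eq span_base)
    qed
  qed
  have vU: "v \<notin> span U" using U vv by (auto simp: span_eq_iff[THEN iffD2] U_def)
  have dimU: "dim U = d" using Suc(2) ins vU dim_insert[of v U] by (simp)
  from Suc(1)[OF dimU[symmetric] U fU] obtain B where
    B: "B \<subseteq> U" "pairwise orthogonal B" "\<forall>b\<in>B. norm b = 1 \<and> (\<exists>c. f b = c *\<^sub>R b)" "finite B" "card B = dim U" by blast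
  have "v \<notin> B" using B(1) vv by (auto simp: U_def)
  moreover have "pairwise orthogonal (insert v B)"
    using B(1,2) by (auto simp: pairwise_insert U_def orthogonal_def inner_commute)
  moreover have "insert v B \<subseteq> S" using B(1) v by (auto simp: U_def)
  moreover have "\<forall>b\<in>insert v B. norm b = 1 \<and> (\<exists>c. f b = c *\<^sub>R b)"
    using B(3) v(2,3) by blast
  moreover have "card (insert v B) = dim S" using B(4,5) \<open>v \<notin> B\<close> dimU Suc(2) by simp
  ultimately show ?case using B(4) by (intro exI[of _ "insert v B"]) blast
qed

lemma orthonormal_rows:
  fixes e :: "'n::finite \<Rightarrow> real^'n"
  assumes orth: "\<And>i j. e i \<bullet> e j = (if i = j then 1 else 0)"
  shows "(\<chi> i j. e i $ j) ** transpose (\<chi> i j. e i $ j) = mat 1"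
  by (simp add: vec_eq_iff matrix_matrix_mult_def transpose_def mat_def orth[unfolded inner_vec_def, simplified])

lemma symmetric_matrix_eigenbasis:
  fixes A :: "real^'n^'n"
  assumes "transpose A = A"
  obtains e :: "'n \<Rightarrow> real^'n" and \<alpha> :: "'n \<Rightarrow> real"
  where "\<And>i j. e i \<bullet> e j = (if i = j then 1 else 0)" "\<And>k. A *v e k = \<alpha> k *\<^sub>R e k"
    "det A = (\<Prod>k\<in>UNIV. \<alpha> k)"
proof -
  have sa: "(A *v x) \<bullet> y = x \<bullet> (A *v y)" for x y
    using dot_lmul_matrix[of x A y] assms vector_transpose_matrix[of x A] by simp
  from self_adjoint_orthonormal_eigenbasis[of "\<lambda>x. A *v x" UNIV, OF _ sa]
  obtain B where B: "pairwise orthogonal B" "\<forall>b\<in>B. norm b = 1 \<and> (\<exists>c. A *v b = c *\<^sub>R b)" "finite B" "card B = CARD('n)"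
    by auto
  then obtain e where e: "bij_betw e (UNIV::'n set) B"
    using finite_same_card_bij[of "UNIV::'n set" B] by auto
  then have eB: "e i \<in> B" for i by (auto simp: bij_betw_def)
  have orth: "e i \<bullet> e j = (if i = j then 1 else 0)" for i j
  proof (cases "i = j")
    case True then show ?thesis using B(2) eB by (simp add: norm_eq_1)
  next
    case False
    then have "e i \<noteq> e j" using e by (auto simp: bij_betw_def inj_on_def)
    then show ?thesis using B(1) eB False by (auto simp: pairwise_def orthogonal_def)
  qed
  have "\<forall>k. \<exists>c. A *v e k = c *\<^sub>R e k" using B(2) eB by blast
  from choice[OF this] obtain \<alpha> where \<alpha>: "\<And>k. A *v e k = \<alpha> k *\<^sub>R e k" by blast
  define P :: "real^'n^'n" where "P = (\<chi> i j. e i $ j)"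
  have PP: "P ** transpose P = mat 1"
    unfolding P_def by (rule orthonormal_rows[OF orth])
  have *: "P ** (A ** transpose P) = (\<chi> i j. if i = j then \<alpha> i else 0)"
  proof -
    have "(P ** (A ** transpose P)) $ i $ j = e i \<bullet> (A *v e j)" for i j
      by (simp add: P_def matrix_matrix_mult_def transpose_def inner_vec_def matrix_vector_mult_def)
    then show ?thesis by (simp add: vec_eq_iff \<alpha> orth)
  qed
  have "det (P ** (A ** transpose P)) = (\<Prod>k\<in>UNIV. \<alpha> k)"
    unfolding * by (subst det_diagonal) auto
  then have "det P * (det A * det P) = (\<Prod>k\<in>UNIV. \<alpha> k)"
    by (simp add: det_mul)
  moreover have "det P * det P = 1" using PP by (metis det_I det_mul det_transpose)
  ultimately have "det A = (\<Prod>k\<in>UNIV. \<alpha> k)" by (simp add: mult.left_commute)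
  with orth \<alpha> that show ?thesis by blast
qed

section \<open>Isotropic frames and weighted frame operators\<close>

lemma norm_sq_eq_sum_orthonormal:
  fixes e :: "'m \<Rightarrow> real^'m"
  assumes orth: "\<And>i j. e i \<bullet> e j = (if i = j then 1 else 0)"
  shows "(norm x)\<^sup>2 = (\<Sum>k\<in>UNIV. (e k \<bullet> x)\<^sup>2)"
proof -
  define P :: "real^'m^'m" where "P = (\<chi> i j. e i $ j)"
  have PP: "P ** transpose P = mat 1"
    unfolding P_def by (rule orthonormal_rows[OF orth])
  then have "orthogonal_transformation (\<lambda>x. P *v x)"
    by (simp add: orthogonal_matrix_def matrix_left_right_inverse orthogonal_transformation_matrix)
  then have "norm (P *v x) = norm x" by (simp add: orthogonal_transformation)
  moreover have "(P *v x) $ k = e k \<bullet> x" for k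
    by (simp add: P_def matrix_vector_mult_def inner_vec_def)
  ultimately have "(norm x)\<^sup>2 = (norm (P *v x))\<^sup>2" by simp
  also have "\<dots> = (\<Sum>k\<in>UNIV. (P *v x) $ k * (P *v x) $ k)"
    by (simp add: power2_norm_eq_inner inner_vec_def)
  finally show ?thesis by (simp add: power2_eq_square \<open>\<And>k. (P *v x) $ k = e k \<bullet> x\<close>)
qed

text \<open>A measurable, bounded family of vectors with \<open>\<integral> w \<otimes> w dM = I\<close>: the continuous analogue of a tight
frame. The vectors need not have unit length.\<close>

locale isotropic_frame = finite_measure M for M :: "'a measure" +
  fixes w :: "'a \<Rightarrow> real^'m" and B :: real
  assumes w_measurable [measurable]: "w \<in> borel_measurable M"
    and w_bounded: "u \<in> space M \<Longrightarrow> norm (w u) \<le> B"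
    and isotropy: "(LINT u|M. (x \<bullet> w u) * (y \<bullet> w u)) = x \<bullet> y"
begin

lemma integrable_bounded:
  fixes g :: "'a \<Rightarrow> 'b::{banach, second_countable_topology}"
  assumes "g \<in> borel_measurable M" "AE u in M. norm (g u) \<le> K"
  shows "integrable M g"
  using integrable_const_bound[OF assms(2,1)] .

lemma abs_inner_w_le: "u \<in> space M \<Longrightarrow> \<bar>x \<bullet> w u\<bar> \<le> norm x * B"
  by (meson Cauchy_Schwarz_ineq2 mult_left_mono norm_ge_zero order_trans w_bounded)

lemma integrable_inner_mult:
  assumes [measurable]: "g \<in> borel_measurable M" and K: "AE u in M. \<bar>g u\<bar> \<le> K"
  shows "integrable M (\<lambda>u. g u * ((x \<bullet> w u) * (y \<bullet> w u)))"
proof (rule integrable_bounded)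
  show "AE u in M. norm (g u * ((x \<bullet> w u) * (y \<bullet> w u))) \<le> K * ((norm x * B) * (norm y * B))"
    using K AE_space
  proof eventually_elim
    case (elim u)
    have "\<bar>(x \<bullet> w u)\<bar> * \<bar>(y \<bullet> w u)\<bar> \<le> (norm x * B) * (norm y * B)"
      using abs_inner_w_le[OF elim(2), of x] abs_inner_w_le[OF elim(2), of y]
      by (intro mult_mono) (linarith | simp)+
    then have "\<bar>(x \<bullet> w u) * (y \<bullet> w u)\<bar> \<le> (norm x * B) * (norm y * B)" by (simp only: abs_mult)
    then show ?case unfolding real_norm_def abs_mult[of "g u"]
      by (intro mult_mono elim(1)) (use elim(1) in auto)
  qed
qed measurable

text \<open>The matrix of \<open>\<integral> \<theta> w \<otimes> w dM\<close>.\<close>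

definition frame_operator :: "('a \<Rightarrow> real) \<Rightarrow> real^'m^'m" where
  "frame_operator \<theta> = (\<chi> i j. LINT u|M. \<theta> u * (w u $ i * w u $ j))"

lemma frame_operator_inner:
  assumes [measurable]: "\<theta> \<in> borel_measurable M" and K: "AE u in M. \<bar>\<theta> u\<bar> \<le> K"
  shows "x \<bullet> (frame_operator \<theta> *v y) = (LINT u|M. \<theta> u * ((x \<bullet> w u) * (y \<bullet> w u)))"
proof -
  have int: "integrable M (\<lambda>u. \<theta> u * (w u $ i * w u $ j))" for i j
    using integrable_inner_mult[OF assms, of "axis i 1" "axis j 1"] by (simp add: inner_axis')
  have "(LINT u|M. \<theta> u * ((x \<bullet> w u) * (y \<bullet> w u))) =
        (LINT u|M. (\<Sum>i\<in>UNIV. \<Sum>j\<in>UNIV. x $ i * y $ j * (\<theta> u * (w u $ i * w u $ j))))"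
  proof (intro Bochner_Integration.integral_cong refl)
    fix u
    have "(x \<bullet> w u) * (y \<bullet> w u) = (\<Sum>i\<in>UNIV. \<Sum>j\<in>UNIV. (x $ i * w u $ i) * (y $ j * w u $ j))"
      by (simp only: inner_vec_def sum_product inner_real_def)
    then show "\<theta> u * ((x \<bullet> w u) * (y \<bullet> w u))
        = (\<Sum>i\<in>UNIV. \<Sum>j\<in>UNIV. x $ i * y $ j * (\<theta> u * (w u $ i * w u $ j)))"
      by (simp add: sum_distrib_left mult_ac)
  qed
  also have "\<dots> = (\<Sum>i\<in>UNIV. \<Sum>j\<in>UNIV. x $ i * y $ j * (LINT u|M. \<theta> u * (w u $ i * w u $ j)))"
    using int by simp
  also have "\<dots> = x \<bullet> (frame_operator \<theta> *v y)"
    by (simp add: inner_vec_def matrix_vector_mult_def frame_operator_def sum_distrib_left mult_ac)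
  finally show ?thesis by simp
qed

lemma frame_operator_symmetric: "transpose (frame_operator \<theta>) = frame_operator \<theta>"
  by (simp add: frame_operator_def transpose_def vec_eq_iff mult_ac)

text \<open>The continuous form of the determinant inequality of Ball and Barthe. In an orthonormal
eigenbasis \<open>e\<close>, the eigenvalue belonging to \<open>e k\<close> is the average of \<open>\<theta>\<close> with respect to the
density \<open>(e k \<bullet> w)^2\<close>, which is a probability density by isotropy. Jensen's inequality for the
logarithm bounds each eigenvalue from below, and the densities add up to \<open>|w|^2\<close> over the basis.\<close>

lemma det_frame_operator_ge:
  assumes [measurable]: "\<theta> \<in> borel_measurable M"
    and lo: "0 < lo" and bd: "AE u in M. lo \<le> \<theta> u \<and> \<theta> u \<le> K"
  shows "exp (LINT u|M. (norm (w u))\<^sup>2 * ln (\<theta> u)) \<le> det (frame_operator \<theta>)"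
proof -
  define A where "A = frame_operator \<theta>"
  have bd': "AE u in M. \<bar>\<theta> u\<bar> \<le> K" using bd by eventually_elim (use lo in linarith)
  have lnbd: "AE u in M. \<bar>ln (\<theta> u)\<bar> \<le> \<bar>ln lo\<bar> + \<bar>ln K\<bar>"
    using bd
  proof eventually_elim
    case (elim u)
    then have "ln lo \<le> ln (\<theta> u)" "ln (\<theta> u) \<le> ln K" using lo by auto
    then show ?case by linarith
  qed
  have one: "AE u in M. \<bar>1::real\<bar> \<le> 1" by simp
  obtain e :: "'m \<Rightarrow> real^'m" and \<alpha> :: "'m \<Rightarrow> real" where orth: "\<And>i j. e i \<bullet> e j = (if i = j then 1 else 0)"
    and eig: "\<And>k. A *v e k = \<alpha> k *\<^sub>R e k" and det: "det A = (\<Prod>k\<in>UNIV. \<alpha> k)"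
    using symmetric_matrix_eigenbasis[OF frame_operator_symmetric[of \<theta>]] unfolding A_def by blast
  have \<alpha>: "\<alpha> k = (LINT u|M. \<theta> u * ((e k \<bullet> w u) * (e k \<bullet> w u)))" for k
    using frame_operator_inner[OF assms(1) bd', of "e k" "e k"] eig[of k] orth[of k k] by (simp add: A_def)
  have q1: "(LINT u|M. (e k \<bullet> w u) * (e k \<bullet> w u)) = 1" for k
    using isotropy[of "e k" "e k"] orth[of k k] by simp
  have q: "integrable M (\<lambda>u. (e k \<bullet> w u) * (e k \<bullet> w u))" for k
    using integrable_inner_mult[of "\<lambda>_. 1", OF _ one] by simp
  have \<theta>q: "integrable M (\<lambda>u. \<theta> u * ((e k \<bullet> w u) * (e k \<bullet> w u)))" for k
    by (rule integrable_inner_mult[OF assms(1) bd'])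
  have lq: "integrable M (\<lambda>u. ln (\<theta> u) * ((e k \<bullet> w u) * (e k \<bullet> w u)))" for k
    by (rule integrable_inner_mult[OF _ lnbd]) measurable
  have \<alpha>pos: "\<alpha> k > 0" for k
  proof -
    have "lo * 1 = (LINT u|M. lo * ((e k \<bullet> w u) * (e k \<bullet> w u)))"
      using q1[of k] by simp
    also have "\<dots> \<le> \<alpha> k" unfolding \<alpha>
      using bd by (intro integral_mono_AE \<theta>q integrable_mult_right q) (auto elim!: eventually_mono intro!: mult_right_mono)
    finally show ?thesis using lo by simp
  qed
  \<comment> \<open>integrate the tangent of the logarithm at \<open>\<alpha> k\<close>\<close>
  have ln_le: "(LINT u|M. ln (\<theta> u) * ((e k \<bullet> w u) * (e k \<bullet> w u))) \<le> ln (\<alpha> k)" for k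
  proof -
    have "(LINT u|M. ln (\<theta> u) * ((e k \<bullet> w u) * (e k \<bullet> w u)))
        \<le> (LINT u|M. (ln (\<alpha> k) - 1) * ((e k \<bullet> w u) * (e k \<bullet> w u)) + (1 / \<alpha> k) * (\<theta> u * ((e k \<bullet> w u) * (e k \<bullet> w u))))"
    proof (intro integral_mono_AE lq Bochner_Integration.integrable_add integrable_mult_right q \<theta>q)
      show "AE u in M. ln (\<theta> u) * ((e k \<bullet> w u) * (e k \<bullet> w u)) \<le>
          (ln (\<alpha> k) - 1) * ((e k \<bullet> w u) * (e k \<bullet> w u)) + (1 / \<alpha> k) * (\<theta> u * ((e k \<bullet> w u) * (e k \<bullet> w u)))"
        using bd
      proof eventually_elim
        case (elim u)
        then have "ln (\<theta> u / \<alpha> k) \<le> \<theta> u / \<alpha> k - 1" using lo \<alpha>pos by (intro ln_le_minus_one) auto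
        then have "ln (\<theta> u) \<le> (ln (\<alpha> k) - 1) + (1 / \<alpha> k) * \<theta> u" using elim lo \<alpha>pos[of k] by (simp add: ln_div)
        then have "ln (\<theta> u) * ((e k \<bullet> w u) * (e k \<bullet> w u)) \<le> ((ln (\<alpha> k) - 1) + (1 / \<alpha> k) * \<theta> u) * ((e k \<bullet> w u) * (e k \<bullet> w u))"
          by (intro mult_right_mono) auto
        then show ?case by (simp add: algebra_simps)
      qed
    qed
    also have "\<dots> = (ln (\<alpha> k) - 1) * 1 + (1 / \<alpha> k) * \<alpha> k"
      using q[of k] \<theta>q[of k] q1[of k] by (simp add: \<alpha>[symmetric])
    finally show ?thesis using \<alpha>pos[of k] by simp
  qed
  have "(LINT u|M. (norm (w u))\<^sup>2 * ln (\<theta> u)) = (LINT u|M. (\<Sum>k\<in>UNIV. ln (\<theta> u) * ((e k \<bullet> w u) * (e k \<bullet> w u))))"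
    by (intro Bochner_Integration.integral_cong refl, subst norm_sq_eq_sum_orthonormal[OF orth])
       (simp add: sum_distrib_left power2_eq_square mult_ac)
  also have "\<dots> = (\<Sum>k\<in>UNIV. LINT u|M. ln (\<theta> u) * ((e k \<bullet> w u) * (e k \<bullet> w u)))"
    using lq by simp
  also have "\<dots> \<le> (\<Sum>k\<in>UNIV. ln (\<alpha> k))" by (intro sum_mono ln_le)
  finally have "exp (LINT u|M. (norm (w u))\<^sup>2 * ln (\<theta> u)) \<le> exp (\<Sum>k\<in>UNIV. ln (\<alpha> k))" by simp
  also have "\<dots> = (\<Prod>k\<in>UNIV. \<alpha> k)" using \<alpha>pos by (simp add: exp_sum)
  finally show ?thesis using det by (simp add: A_def)
qed

lemma integral_norm_sq: "(LINT u|M. (norm (w u))\<^sup>2) = real CARD('m)"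
proof -
  have one: "AE u in M. \<bar>1::real\<bar> \<le> 1" by simp
  have q: "integrable M (\<lambda>u. w u $ k * w u $ k)" for k
    using integrable_inner_mult[of "\<lambda>_. 1", OF _ one, of "axis k 1" "axis k 1"] by (simp add: inner_axis')
  have "(LINT u|M. (norm (w u))\<^sup>2) = (LINT u|M. (\<Sum>k\<in>UNIV. w u $ k * w u $ k))"
    by (simp add: power2_norm_eq_inner inner_vec_def)
  also have "\<dots> = (\<Sum>k\<in>(UNIV::'m set). LINT u|M. w u $ k * w u $ k)"
    using q by simp
  also have "\<dots> = (\<Sum>k\<in>(UNIV::'m set). 1)"
    using isotropy[of "axis k 1" "axis k 1" for k] by (simp add: inner_axis' inner_axis_axis)
  finally show ?thesis by simp
qed

lemma integrable_scaleR_w: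
  assumes [measurable]: "g \<in> borel_measurable M" and K: "AE u in M. \<bar>g u\<bar> \<le> K"
  shows "integrable M (\<lambda>u. g u *\<^sub>R w u)"
proof (rule integrable_bounded)
  show "AE u in M. norm (g u *\<^sub>R w u) \<le> K * B"
    using K AE_space
    by eventually_elim (auto intro!: mult_mono w_bounded)
qed measurable

lemma frame_operator_apply:
  assumes [measurable]: "\<theta> \<in> borel_measurable M" and K: "AE u in M. \<bar>\<theta> u\<bar> \<le> K"
  shows "frame_operator \<theta> *v h = (LINT u|M. (\<theta> u * (h \<bullet> w u)) *\<^sub>R w u)"
    and "integrable M (\<lambda>u. (\<theta> u * (h \<bullet> w u)) *\<^sub>R w u)"
proof -
  show int: "integrable M (\<lambda>u. (\<theta> u * (h \<bullet> w u)) *\<^sub>R w u)"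
  proof (rule integrable_scaleR_w)
    show "AE u in M. \<bar>\<theta> u * (h \<bullet> w u)\<bar> \<le> K * (norm h * B)"
      using K AE_space
    proof eventually_elim
      case (elim u)
      show ?case unfolding abs_mult
        by (intro mult_mono elim(1) abs_inner_w_le elim(2)) (use elim(1) in auto)
    qed
  qed measurable
  have "x \<bullet> (frame_operator \<theta> *v h) = x \<bullet> (LINT u|M. (\<theta> u * (h \<bullet> w u)) *\<^sub>R w u)" for x
    unfolding frame_operator_inner[OF assms] integral_inner_right[OF int, symmetric]
    by (simp add: mult_ac)
  then show "frame_operator \<theta> *v h = (LINT u|M. (\<theta> u * (h \<bullet> w u)) *\<^sub>R w u)"
    by (metis vector_eq_ldot)
qed

text \<open>By isotropy, \<open>z \<bullet> w\<close> is the orthogonal projection of \<open>g\<close> in L2 to the functions that are linear in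
\<open>w\<close>, and \<open>|z|\<close> is the L2 norm of that projection; this is Pythagoras' theorem.\<close>

lemma bessel_identity:
  assumes [measurable]: "g \<in> borel_measurable M" and K: "AE u in M. \<bar>g u\<bar> \<le> K"
  defines "z \<equiv> LINT u|M. g u *\<^sub>R w u"
  shows "(LINT u|M. (g u - z \<bullet> w u)\<^sup>2) = (LINT u|M. (g u)\<^sup>2) - (norm z)\<^sup>2"
    and "integrable M (\<lambda>u. (g u)\<^sup>2)" and "integrable M (\<lambda>u. (g u - z \<bullet> w u)\<^sup>2)"
proof -
  have one: "AE u in M. \<bar>1::real\<bar> \<le> 1" by simp
  have ig: "integrable M (\<lambda>u. g u *\<^sub>R w u)" by (rule integrable_scaleR_w[OF assms(1,2)])
  then have igz: "integrable M (\<lambda>u. g u * (z \<bullet> w u))"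
    using integrable_inner_right[OF ig, of z] by simp
  show ig2: "integrable M (\<lambda>u. (g u)\<^sup>2)"
  proof (rule integrable_bounded)
    show "AE u in M. norm ((g u)\<^sup>2) \<le> K\<^sup>2"
      using K by eventually_elim (simp add: abs_le_square_iff[symmetric])
  qed measurable
  have izz: "integrable M (\<lambda>u. (z \<bullet> w u)\<^sup>2)"
    using integrable_inner_mult[of "\<lambda>_. 1", OF _ one, of z z] by (simp add: power2_eq_square)
  have eq: "(g u - z \<bullet> w u)\<^sup>2 = (g u)\<^sup>2 - 2 * (g u * (z \<bullet> w u)) + (z \<bullet> w u)\<^sup>2" for u
    by (simp add: power2_eq_square algebra_simps)
  show "integrable M (\<lambda>u. (g u - z \<bullet> w u)\<^sup>2)"
    unfolding eq using ig2 izz igz by auto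
  have "(LINT u|M. g u * (z \<bullet> w u)) = z \<bullet> z"
    unfolding z_def integral_inner_right[OF ig, symmetric] by simp
  moreover have "(LINT u|M. (z \<bullet> w u)\<^sup>2) = z \<bullet> z"
    using isotropy[of z z] by (simp add: power2_eq_square)
  ultimately show "(LINT u|M. (g u - z \<bullet> w u)\<^sup>2) = (LINT u|M. (g u)\<^sup>2) - (norm z)\<^sup>2"
    unfolding eq using ig2 izz igz by (simp add: power2_norm_eq_inner)
qed

end

section \<open>Gaussian integrals and change of variables\<close>

text \<open>The change of variables theorem for real-valued integrands, obtained by regarding them as functions
with values in one-dimensional space.\<close>

lemma change_of_variables_scalar:
  fixes f :: "real^'m::{finite,wellorder} \<Rightarrow> real" and g :: "real^'m::_ \<Rightarrow> real^'m::_"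
  assumes S: "S \<in> sets lebesgue"
    and der_g: "\<And>x. x \<in> S \<Longrightarrow> (g has_derivative g' x) (at x within S)"
    and inj: "inj_on g S" and f: "f absolutely_integrable_on (g ` S)"
  shows "(\<lambda>x. \<bar>det (matrix (g' x))\<bar> * f (g x)) absolutely_integrable_on S"
    and "integral S (\<lambda>x. \<bar>det (matrix (g' x))\<bar> * f (g x)) = integral (g ` S) f"
proof -
  have "(\<lambda>x. vec (f x) :: real^1) absolutely_integrable_on (g ` S) \<and>
      integral (g ` S) (\<lambda>x. vec (f x) :: real^1) = vec (integral (g ` S) f)"
    using f by (simp add: absolutely_integrable_on_1_iff integral_on_1_eq)
  then have "(\<lambda>x. \<bar>det (matrix (g' x))\<bar> *\<^sub>R (vec (f (g x)) :: real^1)) absolutely_integrable_on S \<and>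
      integral S (\<lambda>x. \<bar>det (matrix (g' x))\<bar> *\<^sub>R (vec (f (g x)) :: real^1)) = vec (integral (g ` S) f)"
    using has_absolute_integral_change_of_variables[OF S der_g inj,
        of "\<lambda>x. vec (f x) :: real^1" "vec (integral (g ` S) f)"] by blast
  then show "(\<lambda>x. \<bar>det (matrix (g' x))\<bar> * f (g x)) absolutely_integrable_on S"
    and "integral S (\<lambda>x. \<bar>det (matrix (g' x))\<bar> * f (g x)) = integral (g ` S) f"
    by (simp_all add: absolutely_integrable_on_1_iff integral_on_1_eq vec_eq_iff)
qed

lemma nn_integral_gaussian:
  "(\<integral>\<^sup>+z. ennreal (exp (- (norm z)\<^sup>2 / 2)) \<partial>(lborel :: 'a::euclidean_space measure))
     = ennreal (sqrt (2 * pi) ^ DIM('a))"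
proof -
  have "has_bochner_integral lborel std_normal_density 1"
    using std_normal_moment_even[of 0] by simp
  then have "has_bochner_integral lborel (\<lambda>x. sqrt (2 * pi) * std_normal_density x) (sqrt (2 * pi) * 1)"
    by (intro has_bochner_integral_mult_right) auto
  then have "has_bochner_integral lborel (\<lambda>x::real. exp (- x\<^sup>2 / 2)) (sqrt (2 * pi))"
    by (simp add: std_normal_density_def)
  then have one: "(\<integral>\<^sup>+x. ennreal (exp (- x\<^sup>2 / 2)) \<partial>lborel) = ennreal (sqrt (2 * pi))"
    by (subst nn_integral_eq_integral) (auto simp: has_bochner_integral_iff)
  have "exp (- (norm z)\<^sup>2 / 2) = (\<Prod>b\<in>Basis. exp (- (z \<bullet> b)\<^sup>2 / 2))" for z :: 'a
  proof -
    have "(norm z)\<^sup>2 = (\<Sum>b\<in>Basis. (z \<bullet> b)\<^sup>2)"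
      unfolding power2_norm_eq_inner by (subst euclidean_inner) (simp add: power2_eq_square)
    then show ?thesis by (simp add: exp_sum[symmetric] sum_negf sum_divide_distrib)
  qed
  then have "(\<integral>\<^sup>+z. ennreal (exp (- (norm z)\<^sup>2 / 2)) \<partial>(lborel :: 'a measure))
      = (\<integral>\<^sup>+z. (\<Prod>b\<in>Basis. ennreal (exp (- (z \<bullet> b)\<^sup>2 / 2))) \<partial>(lborel :: 'a measure))"
    by (simp add: prod_ennreal)
  also have "\<dots> = (\<Prod>b\<in>(Basis::'a set). \<integral>\<^sup>+x. ennreal (exp (- x\<^sup>2 / 2)) \<partial>lborel)"
    by (rule nn_integral_lborel_prod) auto
  finally show ?thesis using one by (simp add: ennreal_power)
qed

lemma integral_gaussian_le:
  fixes S :: "'a::euclidean_space set"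
  assumes "S \<in> sets lebesgue"
  shows "(\<lambda>z. exp (- (norm z)\<^sup>2 / 2)) absolutely_integrable_on S"
    and "integral S (\<lambda>z. exp (- (norm z)\<^sup>2 / 2)) \<le> sqrt (2 * pi) ^ DIM('a)"
proof -
  let ?g = "\<lambda>z::'a. exp (- (norm z)\<^sup>2 / 2)"
  have "integrable lborel ?g"
    using nn_integral_gaussian[where 'a='a] by (intro integrableI_nonneg) auto
  then have g: "integrable lebesgue ?g" "?g absolutely_integrable_on UNIV"
    by (auto simp: integrable_completion set_integrable_def)
  then show S: "?g absolutely_integrable_on S"
    using assms by (metis set_integrable_subset subset_UNIV)
  have "integral S ?g \<le> integral UNIV ?g"
    using S g by (intro integral_subset_le set_lebesgue_integral_eq_integral(1)) auto
  also have "\<dots> = (LINT z|lebesgue. ?g z)"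
    using g by (simp add: set_lebesgue_integral_eq_integral(2)[symmetric] set_lebesgue_integral_def)
  also have "\<dots> = (LINT z|lborel. ?g z)" by (rule integral_completion) auto
  also have "\<dots> = sqrt (2 * pi) ^ DIM('a)"
    using nn_integral_gaussian[where 'a='a] by (subst integral_eq_nn_integral) auto
  finally show "integral S ?g \<le> sqrt (2 * pi) ^ DIM('a)" .
qed

section \<open>The transport map on the cone of positive functionals\<close>

text \<open>The data of the transport argument: a frame \<open>w\<close>, positive scales \<open>\<kappa>\<close> along its vectors, and the
transport \<open>T\<close> of the exponential law to the Gaussian law. All lengths and scales lie between the
positive constants \<open>b\<close> and \<open>B\<close>; this uniformity is what allows differentiation under the integral
sign.\<close>

locale cone_transport = isotropic_frame M w B
  for M :: "'a measure" and w :: "'a \<Rightarrow> real^'m::{finite,wellorder}" and B :: real +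
  fixes \<kappa> :: "'a \<Rightarrow> real" and T :: "real \<Rightarrow> real" and b :: real
  assumes b_pos: "0 < b"
    and \<kappa>_measurable [measurable]: "\<kappa> \<in> borel_measurable M"
    and \<kappa>_bounds: "u \<in> space M \<Longrightarrow> b \<le> \<kappa> u \<and> \<kappa> u \<le> B"
    and w_lower: "u \<in> space M \<Longrightarrow> b \<le> norm (w u)"
    and T_measurable [measurable]: "T \<in> borel_measurable borel"
    and T_ode: "0 < s \<Longrightarrow> (T has_real_derivative sqrt (2 * pi) * exp ((T s)\<^sup>2 / 2 - s)) (at s)"
begin

definition T' :: "real \<Rightarrow> real" where
  "T' s = sqrt (2 * pi) * exp ((T s)\<^sup>2 / 2 - s)"

text \<open>The functionals that are positive and bounded away from zero on almost all of the frame. Asking for a uniform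
bound makes the cone open without any topology on the index space.\<close>

definition pos_cone where
  "pos_cone = {y. \<exists>\<delta>>0. AE u in M. \<delta> \<le> y \<bullet> w u}"

text \<open>The value of the functional \<open>y\<close> at a frame vector in the scale at which it is transported.\<close>

definition level where
  "level y u = \<kappa> u * (y \<bullet> w u)"

text \<open>The vector field assembled from the one-dimensional transports along all frame vectors. The factor
\<open>norm (w u)\<close> corresponds to normalising the frame vectors and giving them weight \<open>(norm (w u))^2\<close>.\<close>

definition transport_map where
  "transport_map y = (LINT u|M. (T (level y u) * norm (w u)) *\<^sub>R w u)"

text \<open>The weight for which the derivative of the transport map at \<open>y\<close> is \<open>frame_operator (\<theta> y)\<close>.\<close>

definition \<theta> where
  "\<theta> y u = T' (level y u) * (\<kappa> u * norm (w u))"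

lemma transport_measurable [measurable]:
  "T' \<in> borel_measurable borel" "level y \<in> borel_measurable M" "\<theta> y \<in> borel_measurable M"
proof -
  have [measurable]: "T' \<in> borel_measurable borel" unfolding T'_def by measurable
  have [measurable]: "level y \<in> borel_measurable M" for y unfolding level_def by measurable
  show "T' \<in> borel_measurable borel" "level y \<in> borel_measurable M" by measurable
  show "\<theta> y \<in> borel_measurable M" unfolding \<theta>_def by measurable
qed

lemma T'_pos: "0 < T' s"
  by (simp add: T'_def)

lemma T_deriv: "0 < s \<Longrightarrow> (T has_real_derivative T' s) (at s)"
  using T_ode by (simp add: T'_def)

lemma T_continuous: "S \<subseteq> {0<..} \<Longrightarrow> continuous_on S T"
  using T_deriv by (meson DERIV_isCont continuous_at_imp_continuous_on greaterThan_iff subsetD)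

lemma T'_continuous: "S \<subseteq> {0<..} \<Longrightarrow> continuous_on S T'"
  unfolding T'_def by (intro continuous_intros T_continuous) auto

lemma T_strict_mono: "0 < s \<Longrightarrow> s < t \<Longrightarrow> T s < T t"
  using T_deriv T'_pos by (meson DERIV_pos_imp_increasing less_le_trans)

lemma B_pos: "u \<in> space M \<Longrightarrow> 0 < B"
  using b_pos w_lower w_bounded by (meson less_le_trans)

lemma open_cone: "open pos_cone"
  unfolding open_dist
proof (intro ballI)
  fix y assume "y \<in> pos_cone"
  then obtain \<delta> where \<delta>: "\<delta> > 0" "AE u in M. \<delta> \<le> y \<bullet> w u" by (auto simp: pos_cone_def)
  define X where "X = \<bar>B\<bar> + 1"
  have X: "X > 0" by (simp add: X_def)
  define e where "e = \<delta> / 2 / X"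
  have "e > 0" using \<delta> X by (simp add: e_def)
  moreover have "y' \<in> pos_cone" if y': "dist y' y < e" for y'
  proof -
    have "AE u in M. \<delta> / 2 \<le> y' \<bullet> w u"
      using \<delta>(2) AE_space
    proof eventually_elim
      case (elim u)
      have "\<bar>(y' - y) \<bullet> w u\<bar> \<le> norm (y' - y) * B" by (rule abs_inner_w_le[OF elim(2)])
      also have "\<dots> \<le> e * X"
        using y' B_pos[OF elim(2)] \<open>e > 0\<close> by (intro mult_mono) (auto simp: dist_norm X_def)
      also have "\<dots> = \<delta> / 2" using X by (simp add: e_def)
      finally show ?case using elim(1) unfolding inner_diff_left by linarith
    qed
    then show ?thesis using \<delta>(1) unfolding pos_cone_def by (intro CollectI exI[of _ "\<delta>/2"]) auto
  qed
  ultimately show "\<exists>e>0. \<forall>y'. dist y' y < e \<longrightarrow> y' \<in> pos_cone" by blast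
qed

lemma level_range:
  assumes "y \<in> pos_cone"
  obtains a c where "0 < a" "AE u in M. a \<le> level y u \<and> level y u \<le> c"
proof -
  obtain \<delta> where \<delta>: "\<delta> > 0" "AE u in M. \<delta> \<le> y \<bullet> w u" using assms by (auto simp: pos_cone_def)
  have "AE u in M. b * \<delta> \<le> level y u \<and> level y u \<le> B * (norm y * B)"
    using \<delta>(2) AE_space
  proof eventually_elim
    case (elim u)
    then show ?case unfolding level_def
      using \<kappa>_bounds[OF elim(2)] \<delta>(1) b_pos abs_inner_w_le[OF elim(2), of y] B_pos[OF elim(2)]
      by (intro conjI mult_mono) auto
  qed
  with that[of "b * \<delta>"] \<delta>(1) b_pos show ?thesis by auto
qed

lemma AE_level_pos: "y \<in> pos_cone \<Longrightarrow> AE u in M. 0 < level y u"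
  by (elim level_range) (auto elim!: eventually_mono)

lemma continuous_level_bound:
  assumes "y \<in> pos_cone" and "continuous_on {0<..} g"
  obtains K where "AE u in M. \<bar>g (level y u)\<bar> \<le> (K::real)"
proof -
  obtain a c where ac: "0 < a" "AE u in M. a \<le> level y u \<and> level y u \<le> c"
    using level_range[OF assms(1)] .
  have "continuous_on {a..c} g" using assms(2) by (rule continuous_on_subset) (use ac in auto)
  then have "bounded (g ` {a..c})" by (intro compact_imp_bounded compact_continuous_image) auto
  then obtain K where K: "\<forall>x\<in>g ` {a..c}. \<bar>x\<bar> \<le> K" unfolding bounded_real by blast
  have "AE u in M. \<bar>g (level y u)\<bar> \<le> K" using ac(2) by eventually_elim (use K in auto)
  with that show ?thesis by blast
qed

lemma T_norm_bound:
  assumes "y \<in> pos_cone"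
  obtains K where "AE u in M. \<bar>T (level y u) * norm (w u)\<bar> \<le> K"
proof -
  obtain K where K: "AE u in M. \<bar>T (level y u)\<bar> \<le> K"
    using continuous_level_bound[OF assms T_continuous[OF order_refl]] .
  have "AE u in M. \<bar>T (level y u) * norm (w u)\<bar> \<le> K * B"
    using K AE_space by eventually_elim (auto simp: abs_mult intro!: mult_mono w_bounded)
  with that show ?thesis by blast
qed

lemma \<theta>_bounds:
  assumes "y \<in> pos_cone"
  obtains lo K where "0 < lo" "AE u in M. lo \<le> \<theta> y u \<and> \<theta> y u \<le> K"
proof -
  obtain a c where ac: "0 < a" "AE u in M. a \<le> level y u \<and> level y u \<le> c"
    using level_range[OF assms(1)] .
  obtain K where K: "AE u in M. \<bar>T' (level y u)\<bar> \<le> K"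
    using continuous_level_bound[OF assms T'_continuous[OF order_refl]] .
  \<comment> \<open>\<open>T'\<close> is bounded below on the levels, since the square of \<open>T\<close> in the exponent only helps\<close>
  define lo where "lo = sqrt (2 * pi) * exp (- c)"
  have "AE u in M. lo * (b * b) \<le> \<theta> y u \<and> \<theta> y u \<le> K * (B * B)"
    using ac(2) K AE_space
  proof eventually_elim
    case (elim u)
    have "- c \<le> (T (level y u))\<^sup>2 / 2 - level y u" using elim(1) zero_le_power2[of "T (level y u)"] by linarith
    then have "lo \<le> T' (level y u)" unfolding lo_def T'_def by (intro mult_left_mono) auto
    moreover have "0 \<le> lo" by (simp add: lo_def)
    ultimately show ?case unfolding \<theta>_def
      using \<kappa>_bounds[OF elim(3)] w_lower[OF elim(3)] w_bounded[OF elim(3)] elim(2) b_pos B_pos[OF elim(3)] T'_pos[of "level y u"]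
      by (intro conjI mult_mono) auto
  qed
  moreover have "lo * (b * b) > 0" using b_pos by (simp add: lo_def)
  ultimately show ?thesis using that by blast
qed

lemma \<theta>_abs_bound:
  assumes "y \<in> pos_cone"
  obtains K where "AE u in M. \<bar>\<theta> y u\<bar> \<le> K"
proof -
  obtain lo K where "0 < lo" "AE u in M. lo \<le> \<theta> y u \<and> \<theta> y u \<le> K" by (rule \<theta>_bounds[OF assms])
  then have "AE u in M. \<bar>\<theta> y u\<bar> \<le> K" by (elim eventually_mono) auto
  with that show ?thesis by blast
qed

text \<open>Linearisation of \<open>T\<close> with an error that is uniform over a compact range of levels. It replaces
dominated convergence when the transport map is differentiated.\<close>

lemma T_uniformly_differentiable:
  assumes a: "0 < a" and e: "0 < e"
  obtains d where "0 < d" "\<And>s \<eta>. a \<le> s \<Longrightarrow> s \<le> c \<Longrightarrow> \<bar>\<eta>\<bar> < d \<Longrightarrow> \<bar>T (s + \<eta>) - T s - T' s * \<eta>\<bar> \<le> e * \<bar>\<eta>\<bar>"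
proof -
  have "uniformly_continuous_on {a/2..c+1} T'"
    by (intro compact_uniformly_continuous T'_continuous) (use a in auto)
  then obtain d0 where d0: "d0 > 0" "\<And>x y. x \<in> {a/2..c+1} \<Longrightarrow> y \<in> {a/2..c+1} \<Longrightarrow> dist y x < d0 \<Longrightarrow> dist (T' y) (T' x) < e"
    using e unfolding uniformly_continuous_on_def by meson
  define d where "d = min d0 (min (a/2) 1)"
  have dpos: "d > 0" using d0 a by (simp add: d_def)
  have "\<bar>T (s + \<eta>) - T s - T' s * \<eta>\<bar> \<le> e * \<bar>\<eta>\<bar>" if s: "a \<le> s" "s \<le> c" and \<eta>: "\<bar>\<eta>\<bar> < d" for s \<eta>
  proof -
    let ?S = "{s - \<bar>\<eta>\<bar>..s + \<bar>\<eta>\<bar>}"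
    have sub: "?S \<subseteq> {a/2..c+1}" using s \<eta> by (auto simp: d_def)
    have "norm ((T (s + \<eta>) - T' s * (s + \<eta>)) - (T s - T' s * s)) \<le> e * norm ((s + \<eta>) - s)"
    proof (rule field_differentiable_bound[of ?S])
      fix z assume z: "z \<in> ?S"
      then have "0 < z" using sub a by auto
      then show "((\<lambda>z. T z - T' s * z) has_field_derivative T' z - T' s) (at z within ?S)"
        by (auto intro!: derivative_eq_intros has_field_derivative_at_within[OF T_deriv])
      have "dist z s < d0" using z \<eta> by (auto simp: dist_real_def d_def)
      then show "norm (T' z - T' s) \<le> e"
        using d0(2)[of s z] sub z s a by (force simp: dist_real_def)
    qed auto
    then show ?thesis by (simp add: algebra_simps)
  qed
  with that dpos show ?thesis by blast
qed

lemma transport_map_integrable: "y \<in> pos_cone \<Longrightarrow> integrable M (\<lambda>u. (T (level y u) * norm (w u)) *\<^sub>R w u)"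
  by (erule T_norm_bound) (rule integrable_scaleR_w, measurable)

lemma level_diff: "level (y + h) u = level y u + \<kappa> u * (h \<bullet> w u)"
  by (simp add: level_def inner_add_left distrib_left)

text \<open>For \<open>y\<close> in the cone the levels stay in a compact subset of the positive reals, so the uniform
linearisation of \<open>T\<close> can be integrated over the frame.\<close>

lemma transport_map_has_derivative:
  assumes y: "y \<in> pos_cone"
  shows "(transport_map has_derivative (\<lambda>h. frame_operator (\<theta> y) *v h)) (at y)"
  unfolding has_derivative_at_alt
proof (intro conjI allI impI)
  show "bounded_linear (\<lambda>h. frame_operator (\<theta> y) *v h)"
    by (simp add: linear_linear[symmetric])
  fix e :: real assume e: "e > 0"
  obtain a c where ac: "0 < a" "AE u in M. a \<le> level y u \<and> level y u \<le> c"
    using level_range[OF y] .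
  obtain K where K: "AE u in M. \<bar>\<theta> y u\<bar> \<le> K" by (rule \<theta>_abs_bound[OF y])
  define B' where "B' = \<bar>B\<bar> + 1"
  have B': "B' > 0" "\<And>u. u \<in> space M \<Longrightarrow> B \<le> B'" by (auto simp: B'_def)
  \<comment> \<open>four factors of \<open>B\<close> bound \<open>\<kappa>\<close>, \<open>w\<close> in the level, the factor \<open>norm (w u)\<close> and \<open>w\<close> itself\<close>
  define e' where "e' = e / (B' ^ 4 * (measure M (space M) + 1))"
  have e': "e' > 0" using e B' by (simp add: e'_def add_nonneg_pos)
  obtain d where d: "0 < d" "\<And>s \<eta>. a \<le> s \<Longrightarrow> s \<le> c \<Longrightarrow> \<bar>\<eta>\<bar> < d \<Longrightarrow> \<bar>T (s + \<eta>) - T s - T' s * \<eta>\<bar> \<le> e' * \<bar>\<eta>\<bar>"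
    using T_uniformly_differentiable[OF ac(1) e'] by blast
  obtain r where r: "r > 0" "\<And>y'. dist y' y < r \<Longrightarrow> y' \<in> pos_cone"
    using open_cone y unfolding open_dist by blast
  show "\<exists>d>0. \<forall>y'. norm (y' - y) < d \<longrightarrow> norm (transport_map y' - transport_map y - frame_operator (\<theta> y) *v (y' - y)) \<le> e * norm (y' - y)"
  proof (intro exI[of _ "min r (d / (B' * B'))"] conjI allI impI)
    show "min r (d / (B' * B')) > 0" using r d B' by simp
    fix y' assume y': "norm (y' - y) < min r (d / (B' * B'))"
    define h where "h = y' - y"
    have lev: "level y' u = level y u + \<kappa> u * (h \<bullet> w u)" for u
      using level_diff[of y h u] by (simp add: h_def)
    have "y' \<in> pos_cone" using r(2) y' by (simp add: dist_norm)
    note int = transport_map_integrable[OF this] transport_map_integrable[OF y] frame_operator_apply(2)[OF _ K, of h]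
    define g where "g u = (T (level y u + \<kappa> u * (h \<bullet> w u)) - T (level y u) - T' (level y u) * (\<kappa> u * (h \<bullet> w u))) * norm (w u)" for u
    have "transport_map y' - transport_map y - frame_operator (\<theta> y) *v h = (LINT u|M. g u *\<^sub>R w u)"
    proof -
      have "transport_map y' - transport_map y - frame_operator (\<theta> y) *v h =
          (LINT u|M. (T (level y' u) * norm (w u)) *\<^sub>R w u - (T (level y u) * norm (w u)) *\<^sub>R w u - (\<theta> y u * (h \<bullet> w u)) *\<^sub>R w u)"
        using int by (simp add: transport_map_def frame_operator_apply(1)[OF _ K])
      also have "\<dots> = (LINT u|M. g u *\<^sub>R w u)"
        by (intro Bochner_Integration.integral_cong refl)
           (simp add: g_def lev \<theta>_def algebra_simps)
      finally show ?thesis .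
    qed
    also have "norm \<dots> \<le> (LINT u|M. norm (g u *\<^sub>R w u))" by (rule integral_norm_bound)
    also have "\<dots> \<le> (LINT u|M. e' * B' ^ 4 * norm h)"
    proof (rule integral_mono_AE)
      have ge: "AE u in M. norm (g u *\<^sub>R w u) \<le> e' * B' ^ 4 * norm h"
        using ac(2) AE_space
      proof eventually_elim
        case (elim u)
        let ?\<eta> = "\<kappa> u * (h \<bullet> w u)"
        have wB: "norm (w u) \<le> B'" and \<kappa>B: "0 \<le> \<kappa> u" "\<kappa> u \<le> B'"
          using w_bounded[OF elim(2)] \<kappa>_bounds[OF elim(2)] B'(2)[OF elim(2)] b_pos by auto
        have "\<bar>?\<eta>\<bar> \<le> B' * (norm h * B')"
        proof -
          have "\<bar>h \<bullet> w u\<bar> \<le> norm h * B'"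
            using abs_inner_w_le[OF elim(2), of h] mult_left_mono[OF B'(2)[OF elim(2)], of "norm h"] by simp
          then show ?thesis unfolding abs_mult using \<kappa>B B'(1) by (intro mult_mono) auto
        qed
        then have \<eta>: "\<bar>?\<eta>\<bar> \<le> norm h * (B' * B')" by (simp add: mult_ac)
        also have "\<dots> < d" using y' B'(1) by (simp add: h_def field_simps)
        finally have "\<bar>T (level y u + ?\<eta>) - T (level y u) - T' (level y u) * ?\<eta>\<bar> \<le> e' * \<bar>?\<eta>\<bar>"
          using elim(1) by (intro d(2)) auto
        also have "\<dots> \<le> e' * (norm h * (B' * B'))" using e' \<eta> by (intro mult_left_mono) auto
        finally have "\<bar>T (level y u + ?\<eta>) - T (level y u) - T' (level y u) * ?\<eta>\<bar> * norm (w u) * norm (w u)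
            \<le> (e' * (norm h * (B' * B'))) * B' * B'"
          using wB B'(1) e' by (intro mult_mono) auto
        then show ?case by (simp add: g_def abs_mult power4_eq_xxxx mult_ac)
      qed
      show "AE u in M. norm (g u *\<^sub>R w u) \<le> e' * B' ^ 4 * norm h" by (rule ge)
      have "integrable M (\<lambda>u. g u *\<^sub>R w u)"
        by (rule integrable_bounded[OF _ ge]) (simp add: g_def)
      then show "integrable M (\<lambda>u. norm (g u *\<^sub>R w u))" by (rule integrable_norm)
    qed auto
    also have "\<dots> = (e' * B' ^ 4 * measure M (space M)) * norm h" by simp
    also have "\<dots> \<le> e * norm h"
    proof (rule mult_right_mono)
      have "e' * B' ^ 4 * measure M (space M) \<le> e' * B' ^ 4 * (measure M (space M) + 1)"
        using e' B' by (intro mult_left_mono) auto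
      also have "\<dots> = e"
      proof -
        have "measure M (space M) + 1 \<noteq> 0" using measure_nonneg[of M "space M"] by linarith
        then show ?thesis using B'(1) by (simp add: e'_def)
      qed
      finally show "e' * B' ^ 4 * measure M (space M) \<le> e" .
    qed auto
    finally show "norm (transport_map y' - transport_map y - frame_operator (\<theta> y) *v (y' - y)) \<le> e * norm (y' - y)"
      by (simp add: h_def)
  qed
qed

text \<open>The transport map is monotone: pairing its increment with \<open>y - y'\<close> gives the integral of
\<open>(T s - T s') (s - s')\<close> up to positive factors, where \<open>s\<close> and \<open>s'\<close> are the levels. If it
vanishes, then \<open>y - y'\<close> is orthogonal to almost all frame vectors, hence zero by isotropy.\<close>

lemma transport_map_inj: "inj_on transport_map pos_cone"
proof (rule inj_onI)
  fix y y' assume y: "y \<in> pos_cone" "y' \<in> pos_cone" and eq: "transport_map y = transport_map y'"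
  let ?g = "\<lambda>u. (T (level y u) - T (level y' u)) * norm (w u) * ((y - y') \<bullet> w u)"
  note int = transport_map_integrable[OF y(1)] transport_map_integrable[OF y(2)]
  have sgn: "AE u in M. 0 \<le> ?g u \<and> (?g u = 0 \<longrightarrow> (y - y') \<bullet> w u = 0)"
    using AE_level_pos[OF y(1)] AE_level_pos[OF y(2)] AE_space
  proof eventually_elim
    case (elim u)
    have \<kappa>: "\<kappa> u > 0" and w: "norm (w u) > 0" using \<kappa>_bounds[OF elim(3)] w_lower[OF elim(3)] b_pos by auto
    consider "level y u < level y' u" | "level y u = level y' u" | "level y' u < level y u" by linarith
    then show ?case
    proof cases
      case 1
      then have "(y - y') \<bullet> w u < 0" using \<kappa> by (simp add: level_def inner_diff_left)
      then have "0 < ?g u" using T_strict_mono[OF elim(1) 1] w by (simp add: mult_neg_neg mult_neg_pos)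
      then show ?thesis by (metis less_imp_le less_irrefl)
    next
      case 2
      then show ?thesis using \<kappa> by (simp add: level_def inner_diff_left)
    next
      case 3
      then have "(y - y') \<bullet> w u > 0" using \<kappa> by (simp add: level_def inner_diff_left)
      then have "0 < ?g u" using T_strict_mono[OF elim(2) 3] w by simp
      then show ?thesis by (metis less_imp_le less_irrefl)
    qed
  qed
  have "0 = (y - y') \<bullet> (transport_map y - transport_map y')" using eq by simp
  also have "transport_map y - transport_map y' = (LINT u|M. (T (level y u) * norm (w u)) *\<^sub>R w u - (T (level y' u) * norm (w u)) *\<^sub>R w u)"
    using int by (simp add: transport_map_def)
  also have "(y - y') \<bullet> \<dots> = (LINT u|M. (y - y') \<bullet> ((T (level y u) * norm (w u)) *\<^sub>R w u - (T (level y' u) * norm (w u)) *\<^sub>R w u))"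
    using int by (intro integral_inner_right[symmetric]) auto
  also have "\<dots> = (LINT u|M. ?g u)"
    by (intro Bochner_Integration.integral_cong refl) (simp add: inner_diff_right left_diff_distrib)
  finally have "(LINT u|M. ?g u) = 0" by simp
  moreover have "integrable M ?g"
  proof -
    have "integrable M (\<lambda>u. (y - y') \<bullet> ((T (level y u) * norm (w u)) *\<^sub>R w u - (T (level y' u) * norm (w u)) *\<^sub>R w u))"
      using int by auto
    then show ?thesis by (simp add: inner_diff_right left_diff_distrib)
  qed
  ultimately have "AE u in M. ?g u = 0"
    using sgn by (subst integral_nonneg_eq_0_iff_AE[symmetric]) (auto elim!: eventually_mono)
  then have "AE u in M. ((y - y') \<bullet> w u) * ((y - y') \<bullet> w u) = 0"
    using sgn by eventually_elim auto
  then have "(LINT u|M. ((y - y') \<bullet> w u) * ((y - y') \<bullet> w u)) = 0"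
    by (rule integral_eq_zero_AE)
  then show "y = y'" by (simp add: isotropy)
qed

section \<open>The Laplace integral of the cone\<close>

definition drift where
  "drift = (LINT u|M. (\<kappa> u * (norm (w u))\<^sup>2) *\<^sub>R w u)"

text \<open>The bound on the Laplace integral will be \<open>exp (- log_bound)\<close>.\<close>

definition log_bound :: real where
  "log_bound = (LINT u|M. (norm (w u))\<^sup>2 * ln (\<kappa> u * norm (w u)))"

text \<open>The deficit in Bessel's inequality for the transport map. It measures how far the transported levels
are from being a linear functional of the frame vectors.\<close>

definition defect where
  "defect y = (LINT u|M. (T (level y u) * norm (w u) - transport_map y \<bullet> w u)\<^sup>2)"

text \<open>Insert the differential equation for \<open>T\<close> into the logarithm of the lower bound for the determinant.
The result contains half of \<open>\<integral> T^2 |w|^2 dM\<close>, which by Bessel's identity is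
\<open>defect y + |transport_map y|^2\<close>; the second term is absorbed by the Gaussian density. The mean of
the levels with weight \<open>|w|^2\<close> is \<open>y \<bullet> drift\<close>.\<close>

lemma jacobian_ge:
  assumes y: "y \<in> pos_cone"
  shows "sqrt (2 * pi) ^ CARD('m) * exp log_bound * exp (- (y \<bullet> drift)) * exp (defect y / 2)
    \<le> det (frame_operator (\<theta> y)) * exp (- (norm (transport_map y))\<^sup>2 / 2)"
proof -
  obtain K where K: "AE u in M. \<bar>T (level y u) * norm (w u)\<bar> \<le> K" by (rule T_norm_bound[OF y])
  have [measurable]: "(\<lambda>u. T (level y u) * norm (w u)) \<in> borel_measurable M" by measurable
  note bessel = bessel_identity[OF this K, folded transport_map_def]
  obtain lo K' where \<theta>: "0 < lo" "AE u in M. lo \<le> \<theta> y u \<and> \<theta> y u \<le> K'" by (rule \<theta>_bounds[OF y])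
  have n2: "integrable M (\<lambda>u. (norm (w u))\<^sup>2)"
  proof (rule integrable_bounded)
    show "AE u in M. norm ((norm (w u))\<^sup>2) \<le> B\<^sup>2"
      using AE_space by eventually_elim (auto intro!: power_mono w_bounded)
  qed measurable
  have d: "integrable M (\<lambda>u. (\<kappa> u * (norm (w u))\<^sup>2) *\<^sub>R w u)"
  proof (rule integrable_scaleR_w)
    show "AE u in M. \<bar>\<kappa> u * (norm (w u))\<^sup>2\<bar> \<le> B * B\<^sup>2"
      using AE_space
    proof eventually_elim
      case (elim u)
      then show ?case unfolding abs_mult using \<kappa>_bounds[OF elim] w_bounded[OF elim] b_pos
        by (intro mult_mono) (auto intro!: power_mono)
    qed
  qed measurable
  have l: "integrable M (\<lambda>u. (norm (w u))\<^sup>2 * ln (\<kappa> u * norm (w u)))"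
  proof (rule integrable_bounded)
    show "AE u in M. norm ((norm (w u))\<^sup>2 * ln (\<kappa> u * norm (w u))) \<le> B\<^sup>2 * (\<bar>ln (b * b)\<bar> + \<bar>ln (B * B)\<bar>)"
      using AE_space
    proof eventually_elim
      case (elim u)
      have "b * b \<le> \<kappa> u * norm (w u)" "\<kappa> u * norm (w u) \<le> B * B" "0 < b * b"
        using \<kappa>_bounds[OF elim] w_bounded[OF elim] w_lower[OF elim] b_pos by (auto intro!: mult_mono)
      then have "ln (b * b) \<le> ln (\<kappa> u * norm (w u))" "ln (\<kappa> u * norm (w u)) \<le> ln (B * B)" by auto
      then have "\<bar>ln (\<kappa> u * norm (w u))\<bar> \<le> \<bar>ln (b * b)\<bar> + \<bar>ln (B * B)\<bar>" by linarith
      then show ?case unfolding real_norm_def abs_mult using w_bounded[OF elim]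
        by (intro mult_mono) (auto intro!: power_mono)
    qed
  qed measurable
  define q where "q u = y \<bullet> ((\<kappa> u * (norm (w u))\<^sup>2) *\<^sub>R w u)" for u
  have q: "integrable M q" "(LINT u|M. q u) = y \<bullet> drift"
    unfolding q_def drift_def by (rule integrable_inner_right integral_inner_right, rule d)+
  have eq: "(norm (w u))\<^sup>2 * ln (\<theta> y u) = ln (sqrt (2 * pi)) * (norm (w u))\<^sup>2 + (1/2) * (T (level y u) * norm (w u))\<^sup>2
      - q u + (norm (w u))\<^sup>2 * ln (\<kappa> u * norm (w u))" if u: "u \<in> space M" for u
  proof -
    have p: "\<kappa> u * norm (w u) > 0"
      using \<kappa>_bounds[OF u] w_lower[OF u] b_pos by (intro mult_pos_pos) linarith+
    have "ln (\<theta> y u) = ln (T' (level y u)) + ln (\<kappa> u * norm (w u))"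
      unfolding \<theta>_def using p T'_pos by (intro ln_mult_pos) auto
    also have "ln (T' (level y u)) = ln (sqrt (2 * pi)) + ((T (level y u))\<^sup>2 / 2 - level y u)"
      unfolding T'_def by (subst ln_mult_pos) auto
    finally have ln\<theta>: "ln (\<theta> y u) = ln (sqrt (2 * pi)) + ((T (level y u))\<^sup>2 / 2 - level y u) + ln (\<kappa> u * norm (w u))" .
    show ?thesis unfolding ln\<theta> by (simp add: level_def q_def algebra_simps power2_eq_square)
  qed
  have "(LINT u|M. (norm (w u))\<^sup>2 * ln (\<theta> y u)) = (LINT u|M. ln (sqrt (2 * pi)) * (norm (w u))\<^sup>2 + (1/2) * (T (level y u) * norm (w u))\<^sup>2
      - q u + (norm (w u))\<^sup>2 * ln (\<kappa> u * norm (w u)))"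
    by (intro Bochner_Integration.integral_cong refl eq)
  also have "\<dots> = ln (sqrt (2 * pi)) * CARD('m) + (1/2) * (LINT u|M. (T (level y u) * norm (w u))\<^sup>2) - y \<bullet> drift + log_bound"
    using n2 q l bessel(2) by (simp add: integral_norm_sq log_bound_def)
  also have "\<dots> = ln (sqrt (2 * pi)) * CARD('m) + (1/2) * (defect y + (norm (transport_map y))\<^sup>2) - y \<bullet> drift + log_bound"
    using bessel(1) by (simp add: defect_def)
  finally have "exp (ln (sqrt (2 * pi)) * CARD('m) + (1/2) * (defect y + (norm (transport_map y))\<^sup>2) - y \<bullet> drift + log_bound)
      \<le> det (frame_operator (\<theta> y))"
    using det_frame_operator_ge[OF _ \<theta>] by simp
  moreover have "exp (ln (sqrt (2 * pi)) * CARD('m) + (1/2) * (defect y + (norm (transport_map y))\<^sup>2) - y \<bullet> drift + log_bound)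
     = sqrt (2 * pi) ^ CARD('m) * exp log_bound * exp (- (y \<bullet> drift)) * exp (defect y / 2) * exp ((norm (transport_map y))\<^sup>2 / 2)"
  proof -
    have "exp (ln (sqrt (2 * pi)) * CARD('m)) = sqrt (2 * pi) ^ CARD('m)"
      by (subst mult.commute, subst exp_of_nat_mult) simp
    then show ?thesis
      unfolding \<open>exp (ln (sqrt (2 * pi)) * CARD('m)) = _\<close>[symmetric] exp_add[symmetric]
      by (intro arg_cong[where f=exp]) (simp only: field_simps, simp)
  qed
  ultimately have "sqrt (2 * pi) ^ CARD('m) * exp log_bound * exp (- (y \<bullet> drift)) * exp (defect y / 2) * exp ((norm (transport_map y))\<^sup>2 / 2)
     \<le> det (frame_operator (\<theta> y))" by simp
  then have "sqrt (2 * pi) ^ CARD('m) * exp log_bound * exp (- (y \<bullet> drift)) * exp (defect y / 2) * exp ((norm (transport_map y))\<^sup>2 / 2) * exp (- ((norm (transport_map y))\<^sup>2 / 2))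
     \<le> det (frame_operator (\<theta> y)) * exp (- ((norm (transport_map y))\<^sup>2 / 2))"
    by (rule mult_right_mono) simp
  moreover have "exp ((norm (transport_map y))\<^sup>2 / 2) * exp (- ((norm (transport_map y))\<^sup>2 / 2)) = 1"
    using exp_minus_inverse by blast
  ultimately show ?thesis by (simp only: mult.assoc) simp
qed

lemma defect_nonneg: "0 \<le> defect y"
  by (simp add: defect_def)

lemma defect_zero_imp:
  assumes y: "y \<in> pos_cone" and "defect y = 0"
  shows "AE u in M. T (level y u) * norm (w u) = transport_map y \<bullet> w u"
proof -
  obtain K where K: "AE u in M. \<bar>T (level y u) * norm (w u)\<bar> \<le> K" by (rule T_norm_bound[OF y])
  have [measurable]: "(\<lambda>u. T (level y u) * norm (w u)) \<in> borel_measurable M" by measurable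
  note bessel = bessel_identity[OF this K, folded transport_map_def]
  have "AE u in M. (T (level y u) * norm (w u) - transport_map y \<bullet> w u)\<^sup>2 = 0"
    using assms(2) bessel(3) unfolding defect_def
    by (subst (asm) integral_nonneg_eq_0_iff_AE) auto
  then show ?thesis by eventually_elim simp
qed

text \<open>The unnormalised Gaussian density pulled back along the transport map. The absolute value of the
determinant can be omitted because it is positive on the cone.\<close>

definition pulled_gauss where
  "pulled_gauss y = det (frame_operator (\<theta> y)) * exp (- (norm (transport_map y))\<^sup>2 / 2)"

lemma nn_integral_pulled_gauss:
  "(\<lambda>y. ennreal (indicator pos_cone y * pulled_gauss y)) \<in> borel_measurable lebesgue"
  "(\<integral>\<^sup>+y. ennreal (indicator pos_cone y * pulled_gauss y) \<partial>lebesgue) \<le> ennreal (sqrt (2 * pi) ^ CARD('m))"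
proof -
  have C: "pos_cone \<in> sets lebesgue" by (simp add: borel_open open_cone sets_completionI_sets)
  have der: "(transport_map has_derivative (\<lambda>h. frame_operator (\<theta> y) *v h)) (at y within pos_cone)" if "y \<in> pos_cone" for y
    using transport_map_has_derivative[OF that] by (rule has_derivative_at_withinI)
  have "continuous_on pos_cone transport_map"
    using der by (meson continuous_on_eq_continuous_within has_derivative_continuous)
  then have "open (transport_map ` pos_cone)" by (intro invariance_of_domain open_cone transport_map_inj)
  then have FC: "transport_map ` pos_cone \<in> sets lebesgue" by (simp add: borel_open sets_completionI_sets)
  note cv = change_of_variables_scalar[OF C der transport_map_inj integral_gaussian_le(1)[OF FC]]
  have det: "\<bar>det (matrix (\<lambda>h. frame_operator (\<theta> y) *v h))\<bar> * exp (- (norm (transport_map y))\<^sup>2 / 2) = pulled_gauss y"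
    if y: "y \<in> pos_cone" for y
  proof -
    have "0 < sqrt (2 * pi) ^ CARD('m) * exp log_bound * exp (- (y \<bullet> drift)) * exp (defect y / 2)"
      by (simp add: zero_less_mult_iff)
    from less_le_trans[OF this jacobian_ge[OF y]] have "0 < det (frame_operator (\<theta> y))"
      by (simp add: zero_less_mult_iff)
    then show ?thesis by (simp add: pulled_gauss_def matrix_of_matrix_vector_mul)
  qed
  have abs: "pulled_gauss absolutely_integrable_on pos_cone"
    by (rule iffD1[OF set_integrable_cong[OF refl refl det] cv(1)])
  then show "(\<lambda>y. ennreal (indicator pos_cone y * pulled_gauss y)) \<in> borel_measurable lebesgue"
    unfolding set_integrable_def by (intro measurable_compose[OF borel_measurable_integrable measurable_ennreal]) auto
  have "(\<integral>\<^sup>+y. ennreal (indicator pos_cone y * pulled_gauss y) \<partial>lebesgue) = ennreal (LINT y|lebesgue. indicator pos_cone y * pulled_gauss y)"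
    using abs unfolding set_integrable_def
    by (intro nn_integral_eq_integral) (auto simp: det[symmetric] indicator_def)
  also have "(LINT y|lebesgue. indicator pos_cone y * pulled_gauss y) = integral pos_cone pulled_gauss"
    using set_lebesgue_integral_eq_integral(2)[OF abs] by (simp add: set_lebesgue_integral_def)
  also have "\<dots> = integral (transport_map ` pos_cone) (\<lambda>z. exp (- (norm z)\<^sup>2 / 2))"
    using integral_cong[of pos_cone, OF det] cv(2) by simp
  also have "\<dots> \<le> sqrt (2 * pi) ^ CARD('m)" using integral_gaussian_le(2)[OF FC] by simp
  finally show "(\<integral>\<^sup>+y. ennreal (indicator pos_cone y * pulled_gauss y) \<partial>lebesgue) \<le> ennreal (sqrt (2 * pi) ^ CARD('m))"
    by (simp add: ennreal_leI)
qed

text \<open>The integrand of the Laplace integral, scaled so that it lies below \<open>pulled_gauss\<close>.\<close>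

definition weight where
  "weight y = sqrt (2 * pi) ^ CARD('m) * exp log_bound * exp (- (y \<bullet> drift))"

lemma weight_measurable [measurable]: "(\<lambda>y. ennreal (indicator pos_cone y * weight y)) \<in> borel_measurable borel"
proof -
  have [measurable]: "pos_cone \<in> sets borel" using open_cone by simp
  have [measurable]: "weight \<in> borel_measurable borel"
    unfolding weight_def by (intro borel_measurable_continuous_onI continuous_intros)
  show ?thesis by measurable
qed

lemma weight_le: "y \<in> pos_cone \<Longrightarrow> weight y * exp (defect y / 2) \<le> pulled_gauss y"
  using jacobian_ge by (simp add: weight_def pulled_gauss_def)

lemma weight_pos: "0 < weight y"
  by (simp add: weight_def)

lemma weight_le': "ennreal (indicator pos_cone y * weight y) \<le> ennreal (indicator pos_cone y * pulled_gauss y)"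
proof (cases "y \<in> pos_cone")
  case True
  have "weight y * 1 \<le> weight y * exp (defect y / 2)"
    using defect_nonneg weight_pos[of y] by (intro mult_left_mono) auto
  then show ?thesis using weight_le[OF True] True by (intro ennreal_leI) auto
qed simp

lemma nn_integral_weight:
  "(\<integral>\<^sup>+y. ennreal (indicator pos_cone y * weight y) \<partial>lebesgue)
    = ennreal (sqrt (2 * pi) ^ CARD('m) * exp log_bound) * (\<integral>\<^sup>+y. ennreal (indicator pos_cone y * exp (- (y \<bullet> drift))) \<partial>lborel)"
proof -
  have [measurable]: "pos_cone \<in> sets borel" using open_cone by simp
  have "(\<integral>\<^sup>+y. ennreal (indicator pos_cone y * weight y) \<partial>lebesgue) = (\<integral>\<^sup>+y. ennreal (indicator pos_cone y * weight y) \<partial>lborel)"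
    by (rule nn_integral_completion)
  also have "\<dots> = (\<integral>\<^sup>+y. ennreal (sqrt (2 * pi) ^ CARD('m) * exp log_bound) * ennreal (indicator pos_cone y * exp (- (y \<bullet> drift))) \<partial>lborel)"
    by (intro nn_integral_cong) (simp add: weight_def ennreal_mult'[symmetric] mult_ac)
  also have "\<dots> = ennreal (sqrt (2 * pi) ^ CARD('m) * exp log_bound) * (\<integral>\<^sup>+y. ennreal (indicator pos_cone y * exp (- (y \<bullet> drift))) \<partial>lborel)"
    by (rule nn_integral_cmult) measurable
  finally show ?thesis .
qed

text \<open>The Laplace integrand is dominated by the pulled-back Gaussian, whose integral over the cone is the
Gaussian integral over the image of the cone. That is at most the total Gaussian mass
\<open>sqrt (2 * pi) ^ CARD('m)\<close>, which cancels against the same factor in \<open>weight\<close>.\<close>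

theorem laplace_cone_le:
  "(\<integral>\<^sup>+y. ennreal (indicator pos_cone y * exp (- (y \<bullet> drift))) \<partial>lborel) \<le> ennreal (exp (- log_bound))" (is "?X \<le> _")
proof -
  define c where "c = sqrt (2 * pi) ^ CARD('m) * exp log_bound"
  have c: "c > 0" by (simp add: c_def)
  have "ennreal c * ?X \<le> ennreal (sqrt (2 * pi) ^ CARD('m))"
    unfolding c_def nn_integral_weight[symmetric]
    using order_trans[OF nn_integral_mono[OF weight_le'] nn_integral_pulled_gauss(2)] .
  then have "ennreal (1 / c) * (ennreal c * ?X) \<le> ennreal (1 / c) * ennreal (sqrt (2 * pi) ^ CARD('m))"
    by (rule mult_left_mono) simp
  then show ?thesis using c
    by (simp add: mult.assoc[symmetric] ennreal_mult'[symmetric] c_def exp_minus field_simps)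
qed

text \<open>If nothing is lost, then the pointwise domination is an equality almost everywhere, and the gap
\<open>exp (defect y / 2)\<close> left in \<open>weight_le\<close> forces the defect to vanish.\<close>

theorem laplace_cone_eq_imp:
  assumes "ennreal (exp (- log_bound)) \<le> (\<integral>\<^sup>+y. ennreal (indicator pos_cone y * exp (- (y \<bullet> drift))) \<partial>lborel)"
  shows "AE y in lborel. y \<in> pos_cone \<longrightarrow> (AE u in M. T (level y u) * norm (w u) = transport_map y \<bullet> w u)"
proof -
  let ?E = "\<lambda>y. ennreal (indicator pos_cone y * weight y)"
  let ?J = "\<lambda>y. ennreal (indicator pos_cone y * pulled_gauss y)"
  have E: "?E \<in> borel_measurable lebesgue" by (rule measurable_completion) simp
  note J = nn_integral_pulled_gauss
  have "ennreal (sqrt (2 * pi) ^ CARD('m)) = ennreal (sqrt (2 * pi) ^ CARD('m) * exp log_bound) * ennreal (exp (- log_bound))"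
    by (simp add: ennreal_mult'[symmetric] exp_minus)
  also have "\<dots> \<le> (\<integral>\<^sup>+y. ?E y \<partial>lebesgue)"
    unfolding nn_integral_weight by (intro mult_left_mono assms) simp
  finally have ge: "(\<integral>\<^sup>+y. ?J y \<partial>lebesgue) \<le> (\<integral>\<^sup>+y. ?E y \<partial>lebesgue)" using J(2) by (rule order_trans[rotated])
  have "(\<integral>\<^sup>+y. ?E y \<partial>lebesgue) \<le> (\<integral>\<^sup>+y. ?J y \<partial>lebesgue)" by (intro nn_integral_mono weight_le')
  also have "\<dots> \<le> ennreal (sqrt (2 * pi) ^ CARD('m))" by (rule J(2))
  finally have fin: "(\<integral>\<^sup>+y. ?E y \<partial>lebesgue) \<noteq> \<infinity>" by (auto simp: top_unique)
  have "(\<integral>\<^sup>+y. ?J y - ?E y \<partial>lebesgue) = (\<integral>\<^sup>+y. ?J y \<partial>lebesgue) - (\<integral>\<^sup>+y. ?E y \<partial>lebesgue)"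
    by (intro nn_integral_diff J(1) E fin AE_I2 weight_le')
  also have "\<dots> = 0" by (rule diff_eq_0_ennreal[OF _ ge]) (use ge fin in \<open>auto simp: less_top[symmetric] top_unique\<close>)
  finally have "AE y in lebesgue. ?J y - ?E y = 0"
    using J(1) E by (subst (asm) nn_integral_0_iff_AE) auto
  then have "AE y in lborel. ?J y - ?E y = 0" by (simp only: AE_completion_iff)
  then show ?thesis
  proof eventually_elim
    case (elim y)
    show ?case
    proof
      assume y: "y \<in> pos_cone"
      have "?J y \<le> ?E y" using elim by (simp add: ennreal_minus_eq_0)
      then have "pulled_gauss y \<le> weight y" using y weight_pos[of y] by (simp add: ennreal_le_iff)
      then have "weight y * exp (defect y / 2) \<le> weight y * 1" using weight_le[OF y] by simp
      then have "exp (defect y / 2) \<le> 1" using weight_pos[of y] by (simp only: mult_le_cancel_left_pos)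
      then have "defect y = 0" using defect_nonneg[of y] by simp
      then show "AE u in M. T (level y u) * norm (w u) = transport_map y \<bullet> w u" by (rule defect_zero_imp[OF y])
    qed
  qed
qed

text \<open>If \<open>T'\<close> were constant on an interval, then by the differential equation so would be \<open>T^2 / 2 - s\<close>;
its derivative \<open>T T' - 1\<close> would vanish, making \<open>T\<close> constant although \<open>T'\<close> is positive.\<close>

lemma T'_not_locally_constant:
  assumes "0 < s" "0 < d"
  obtains t where "\<bar>t - s\<bar> < d" "0 < t" "T' t \<noteq> T' s"
proof (rule ccontr)
  assume "\<not> thesis"
  then have const: "\<bar>t - s\<bar> < d \<Longrightarrow> 0 < t \<Longrightarrow> T' t = T' s" for t using that by blast
  define S where "S = {max 0 (s - d)<..<s + d}"
  have S: "open S" "s \<in> S" using assms by (auto simp: S_def)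
  have c: "T' t = T' s" if "t \<in> S" for t using that by (intro const) (auto simp: S_def)
  have one: "T t * T' s = 1" if t: "t \<in> S" for t
  proof -
    have t0: "0 < t" using t by (simp add: S_def)
    have "((\<lambda>x. (T x)\<^sup>2 / 2 - x) has_real_derivative T t * T' t - 1) (at t)"
      using T_deriv[OF t0] by (auto intro!: derivative_eq_intros)
    moreover have "((\<lambda>x. (T x)\<^sup>2 / 2 - x) has_real_derivative 0) (at t)"
    proof (rule has_field_derivative_transform_within_open[OF _ S(1) t])
      show "((\<lambda>x. (T s)\<^sup>2 / 2 - s) has_real_derivative 0) (at t)" by simp
      show "(T s)\<^sup>2 / 2 - s = (T x)\<^sup>2 / 2 - x" if "x \<in> S" for x
        using c[OF that] by (simp add: T'_def)
    qed
    ultimately show ?thesis using DERIV_unique c[OF t] by fastforce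
  qed
  have "(T has_real_derivative 0) (at s)"
  proof (rule has_field_derivative_transform_within_open[OF _ S])
    show "((\<lambda>x. 1 / T' s) has_real_derivative 0) (at s)" by simp
    show "1 / T' s = T x" if "x \<in> S" for x using one[OF that] T'_pos[of s] by (simp add: field_simps)
  qed
  then show False using T_deriv[OF assms(1)] DERIV_unique T'_pos[of s] by fastforce
qed

text \<open>Differentiate the hypothesis \<open>T (level y u) * norm (w u) = transport_map y \<bullet> w u\<close> in \<open>y\<close> and use
that the derivative of the transport map is symmetric.\<close>

lemma frame_operator_eigenvector:
  assumes u: "\<And>y. y \<in> pos_cone \<Longrightarrow> 0 < level y u \<and> T (level y u) * norm (w u) = transport_map y \<bullet> w u"
    and y: "y \<in> pos_cone"
  shows "frame_operator (\<theta> y) *v w u = \<theta> y u *\<^sub>R w u"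
proof -
  have "(\<theta> y u *\<^sub>R w u) \<bullet> h = (frame_operator (\<theta> y) *v w u) \<bullet> h" for h
  proof -
    have "((\<lambda>x. level x u) has_derivative (\<lambda>h. \<kappa> u * (h \<bullet> w u))) (at y)"
      unfolding level_def by (auto intro!: derivative_eq_intros)
    moreover have "(T has_derivative (*) (T' (level y u))) (at (level y u))"
      using T_deriv u[OF y] by (auto simp: has_field_derivative_def)
    ultimately have "((\<lambda>x. T (level x u)) has_derivative (\<lambda>h. T' (level y u) * (\<kappa> u * (h \<bullet> w u)))) (at y)"
      by (rule has_derivative_compose)
    then have d1: "((\<lambda>x. T (level x u) * norm (w u)) has_derivative (\<lambda>h. T' (level y u) * (\<kappa> u * (h \<bullet> w u)) * norm (w u))) (at y)"
      by (rule has_derivative_mult_left)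
    have d2: "((\<lambda>x. transport_map x \<bullet> w u) has_derivative (\<lambda>h. (frame_operator (\<theta> y) *v h) \<bullet> w u)) (at y)"
      using transport_map_has_derivative[OF y] by (rule has_derivative_inner_left)
    have "((\<lambda>x. T (level x u) * norm (w u)) has_derivative (\<lambda>h. (frame_operator (\<theta> y) *v h) \<bullet> w u)) (at y)"
      using d2 by (rule has_derivative_transform_within_open[OF _ open_cone y]) (use u in auto)
    then have "(\<lambda>h. (frame_operator (\<theta> y) *v h) \<bullet> w u) = (\<lambda>h. T' (level y u) * (\<kappa> u * (h \<bullet> w u)) * norm (w u))"
      using d1 by (rule has_derivative_unique)
    then have "(frame_operator (\<theta> y) *v h) \<bullet> w u = T' (level y u) * (\<kappa> u * (h \<bullet> w u)) * norm (w u)"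
      by (rule fun_cong)
    moreover have "(frame_operator (\<theta> y) *v h) \<bullet> w u = (frame_operator (\<theta> y) *v w u) \<bullet> h"
      using dot_lmul_matrix[of h "frame_operator (\<theta> y)" "w u"] frame_operator_symmetric[of "\<theta> y"]
        vector_transpose_matrix[of h "frame_operator (\<theta> y)"] by (simp add: inner_commute)
    ultimately show ?thesis by (simp add: \<theta>_def inner_commute mult_ac)
  qed
  then show ?thesis by (metis vector_eq_rdot)
qed

text \<open>Eigenvectors of a symmetric matrix with different eigenvalues are orthogonal. If \<open>w u1\<close> and \<open>w u2\<close>
were not orthogonal, then their eigenvalues would agree at every point of the cone. Moving \<open>y\<close> in a
direction orthogonal to \<open>w u1\<close> but not to \<open>w u2\<close> keeps the first eigenvalue fixed, so \<open>T'\<close> would be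
locally constant.\<close>

theorem rigid_orthogonal:
  assumes u1: "\<And>y. y \<in> pos_cone \<Longrightarrow> 0 < level y u1 \<and> T (level y u1) * norm (w u1) = transport_map y \<bullet> w u1"
    and u2: "\<And>y. y \<in> pos_cone \<Longrightarrow> 0 < level y u2 \<and> T (level y u2) * norm (w u2) = transport_map y \<bullet> w u2"
    and u: "u1 \<in> space M" "u2 \<in> space M"
    and ne: "pos_cone \<noteq> {}" and npar: "\<And>t. w u2 \<noteq> t *\<^sub>R w u1"
  shows "w u1 \<bullet> w u2 = 0"
proof (rule ccontr)
  assume nz: "w u1 \<bullet> w u2 \<noteq> 0"
  have eig: "\<theta> y u1 = \<theta> y u2" if y: "y \<in> pos_cone" for y
  proof -
    have "\<theta> y u1 * (w u1 \<bullet> w u2) = (frame_operator (\<theta> y) *v w u1) \<bullet> w u2"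
      by (simp add: frame_operator_eigenvector[OF u1 y])
    also have "\<dots> = w u1 \<bullet> (frame_operator (\<theta> y) *v w u2)"
      using dot_lmul_matrix[of "w u1" "frame_operator (\<theta> y)" "w u2"] frame_operator_symmetric[of "\<theta> y"]
        vector_transpose_matrix[of "w u1" "frame_operator (\<theta> y)"] by simp
    also have "\<dots> = \<theta> y u2 * (w u1 \<bullet> w u2)"
      by (simp add: frame_operator_eigenvector[OF u2 y])
    finally show ?thesis using nz by simp
  qed
  obtain y where y: "y \<in> pos_cone" using ne by blast
  define t where "t = (w u1 \<bullet> w u2) / (w u1 \<bullet> w u1)"
  \<comment> \<open>the component of \<open>w u2\<close> orthogonal to \<open>w u1\<close>\<close>
  define h where "h = w u2 - t *\<^sub>R w u1"
  have w1: "w u1 \<bullet> w u1 \<noteq> 0" using nz by auto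
  have h1: "h \<bullet> w u1 = 0" using w1 by (simp add: h_def t_def inner_diff_left inner_commute[of "w u2" "w u1"])
  have "h \<noteq> 0" using npar[of t] by (simp add: h_def)
  moreover have "h \<bullet> w u2 = h \<bullet> h" using h1 by (simp add: h_def inner_diff_right)
  ultimately have h2: "h \<bullet> w u2 \<noteq> 0" by simp
  obtain r where r: "r > 0" "\<And>y'. dist y' y < r \<Longrightarrow> y' \<in> pos_cone"
    using open_cone y unfolding open_dist by blast
  have \<kappa>: "\<kappa> u2 > 0" using \<kappa>_bounds[OF u(2)] b_pos by linarith
  define q where "q = \<kappa> u2 * (h \<bullet> w u2)"
  have q: "q \<noteq> 0" using \<kappa> h2 by (simp add: q_def)
  define d where "d = r * \<bar>q\<bar> / norm h"
  have "d > 0" using r q \<open>h \<noteq> 0\<close> by (simp add: d_def)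
  then obtain s where s: "\<bar>s - level y u2\<bar> < d" "T' s \<noteq> T' (level y u2)"
    using T'_not_locally_constant[of "level y u2" d] u2[OF y] by blast
  define x where "x = (s - level y u2) / q"
  have "\<bar>x\<bar> * norm h < r" using s(1) q \<open>h \<noteq> 0\<close> by (simp add: x_def d_def field_simps abs_divide)
  then have yx: "y + x *\<^sub>R h \<in> pos_cone" by (intro r(2)) (simp add: dist_norm)
  have "level (y + x *\<^sub>R h) u1 = level y u1" by (simp add: level_diff h1)
  then have "\<theta> (y + x *\<^sub>R h) u1 = \<theta> y u1" by (simp add: \<theta>_def)
  moreover have "level (y + x *\<^sub>R h) u2 = s" using q by (simp add: level_diff x_def q_def)
  then have "\<theta> (y + x *\<^sub>R h) u2 = T' s * (\<kappa> u2 * norm (w u2))" by (simp add: \<theta>_def)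
  ultimately have "T' s * (\<kappa> u2 * norm (w u2)) = \<theta> y u2"
    using eig[OF y] eig[OF yx] by metis
  then have "T' s * (\<kappa> u2 * norm (w u2)) = T' (level y u2) * (\<kappa> u2 * norm (w u2))"
    by (simp only: \<theta>_def)
  moreover have "\<kappa> u2 * norm (w u2) \<noteq> 0" using \<kappa> w_lower[OF u(2)] b_pos by auto
  ultimately show False using s(2) by simp
qed

end

section \<open>Vectors with one additional coordinate\<close>

text \<open>An index type with one more element. The change of variables theorem requires the index type of the
coordinates to be well-ordered; any order will do, and the one induced by an injection to the natural
numbers exists on every finite type.\<close>

datatype 'a lift = Height | Coord 'a

lemma UNIV_lift: "(UNIV :: 'a lift set) = insert Height (range Coord)"
  by (auto intro: lift.exhaust)

instance lift :: (finite) finite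
  by standard (simp add: UNIV_lift)

instantiation lift :: (finite) wellorder
begin

definition less_eq_lift :: "'a lift \<Rightarrow> 'a lift \<Rightarrow> bool" where
  "less_eq_lift x y \<longleftrightarrow> to_nat x \<le> to_nat y"

definition less_lift :: "'a lift \<Rightarrow> 'a lift \<Rightarrow> bool" where
  "less_lift x y \<longleftrightarrow> to_nat x < to_nat y"

instance
proof
  fix P :: "'a lift \<Rightarrow> bool" and a :: "'a lift"
  assume step: "\<And>x. (\<And>y. y < x \<Longrightarrow> P y) \<Longrightarrow> P x"
  show "P a"
    by (induction a rule: measure_induct_rule[of to_nat]) (rule step, simp add: less_lift_def)
qed (auto simp: less_eq_lift_def less_lift_def)

end

lemma CARD_lift: "CARD('a::finite lift) = Suc (CARD('a))"
  unfolding UNIV_lift by (subst card_insert_disjoint) (auto simp: card_image inj_on_def)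

lemma all_lift: "(\<forall>i. Q i) \<longleftrightarrow> Q Height \<and> (\<forall>j. Q (Coord j))"
  by (metis lift.exhaust)

lemma sum_lift: "(\<Sum>i\<in>(UNIV :: 'a::finite lift set). g i) = g Height + (\<Sum>j\<in>UNIV. g (Coord j))"
  unfolding UNIV_lift by (subst sum.insert) (auto simp: sum.reindex inj_on_def)

lemma prod_lift: "(\<Prod>i\<in>(UNIV :: 'a::finite lift set). g i) = g Height * (\<Prod>j\<in>UNIV. g (Coord j))"
  unfolding UNIV_lift by (subst prod.insert) (auto simp: prod.reindex inj_on_def)

definition lift_vec :: "real^'n \<Rightarrow> real \<Rightarrow> real^('n lift)" where
  "lift_vec x t = (\<chi> i. case i of Height \<Rightarrow> t | Coord j \<Rightarrow> x $ j)"

lemma lift_vec_nth [simp]: "lift_vec x t $ Height = t" "lift_vec x t $ Coord j = x $ j"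
  by (simp_all add: lift_vec_def)

lemma inner_lift_vec: "lift_vec x t \<bullet> lift_vec y s = x \<bullet> y + t * s"
  by (simp add: inner_vec_def sum_lift)

lemma lift_vec_eta: "lift_vec (\<chi> j. y $ Coord j) (y $ Height) = y"
  by (simp add: vec_eq_iff lift_vec_def split: lift.split)

lemma lift_vec_cases: obtains x t where "y = lift_vec x t"
  by (metis lift_vec_eta)

lemma lift_vec_eq_iff: "lift_vec x t = lift_vec y s \<longleftrightarrow> x = y \<and> t = s"
  by (metis lift_vec_nth vec_eq_iff)

lemma scaleR_lift_vec: "c *\<^sub>R lift_vec x t = lift_vec (c *\<^sub>R x) (c * t)"
  by (simp add: vec_eq_iff lift_vec_def split: lift.split)

lemma norm_lift_vec_sq: "(norm (lift_vec x t))\<^sup>2 = (norm x)\<^sup>2 + t\<^sup>2"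
  unfolding power2_norm_eq_inner inner_lift_vec by (simp add: power2_eq_square)

lemma continuous_on_lift_vec [continuous_intros]:
  assumes "continuous_on S f" "continuous_on S g"
  shows "continuous_on S (\<lambda>x. lift_vec (f x) (g x))"
  unfolding lift_vec_def
proof (rule continuous_on_vec_lambda)
  show "continuous_on S (\<lambda>x. case i of Height \<Rightarrow> g x | Coord j \<Rightarrow> f x $ j)" for i
    using assms by (cases i) (auto intro!: continuous_intros)
qed

lemma borel_measurable_lift_vec [measurable (raw)]:
  assumes [measurable]: "f \<in> borel_measurable M" "g \<in> borel_measurable M"
  shows "(\<lambda>x. lift_vec (f x) (g x)) \<in> borel_measurable M"
proof -
  have c: "continuous_on UNIV (\<lambda>p. lift_vec (fst p :: real^'n) (snd p))"
    by (intro continuous_intros)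
  have "(\<lambda>x. lift_vec (fst (f x, g x)) (snd (f x, g x))) \<in> borel_measurable M"
    by (rule measurable_compose[OF _ borel_measurable_continuous_onI[OF c]]) measurable
  then show ?thesis by simp
qed

lemma prod_Basis_cart: "(\<Prod>b\<in>(Basis :: (real^'n) set). g b) = (\<Prod>i\<in>UNIV. g (axis i 1))"
proof -
  have Basis: "(Basis :: (real^'n) set) = (\<lambda>i. axis i 1) ` UNIV"
    by (auto simp: Basis_vec_def)
  have "inj (\<lambda>i. axis i 1 :: real^'n)" by (simp add: inj_on_def axis_eq_axis)
  from prod.reindex[OF this, of g] show ?thesis unfolding Basis by (simp add: comp_def)
qed

text \<open>Both measures agree on boxes, and a box splits as the product of its horizontal part and an
interval of heights.\<close>

lemma lborel_lift: "lborel = distr (lborel \<Otimes>\<^sub>M lborel) borel (\<lambda>p. lift_vec (fst p :: real^'n) (snd p))"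
proof (rule lborel_eqI)
  fix l u :: "real^'n lift"
  assume le: "\<And>b. b \<in> Basis \<Longrightarrow> l \<bullet> b \<le> u \<bullet> b"
  have le': "l $ i \<le> u $ i" for i using le[of "axis i 1"] by (simp add: inner_axis)
  let ?r = "\<lambda>y. \<chi> j. (y :: real^'n lift) $ Coord j"
  have "emeasure (distr (lborel \<Otimes>\<^sub>M lborel) borel (\<lambda>p. lift_vec (fst p :: real^'n) (snd p))) (box l u)
      = emeasure (lborel \<Otimes>\<^sub>M lborel) (box (?r l) (?r u) \<times> box (l $ Height) (u $ Height))"
  proof -
    have "lift_vec x t \<in> box l u \<longleftrightarrow> x \<in> box (?r l) (?r u) \<and> t \<in> box (l $ Height) (u $ Height)" for x t
      unfolding mem_box_cart(1) mem_box_real(1) by (auto simp: all_lift)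
    then have "(\<lambda>p. lift_vec (fst p :: real^'n) (snd p)) -` box l u \<inter> space (lborel \<Otimes>\<^sub>M lborel)
        = box (?r l) (?r u) \<times> box (l $ Height) (u $ Height)"
      by (auto simp: space_pair_measure)
    then show ?thesis by (subst emeasure_distr) auto
  qed
  also have "\<dots> = emeasure lborel (box (?r l) (?r u)) * emeasure lborel (box (l $ Height) (u $ Height))"
    by (rule lborel.emeasure_pair_measure_Times) auto
  also have "\<dots> = ennreal (\<Prod>j\<in>UNIV. u $ Coord j - l $ Coord j) * ennreal (u $ Height - l $ Height)"
  proof -
    have "?r l \<bullet> b \<le> ?r u \<bullet> b" if "b \<in> Basis" for b
      using that le' by (auto simp: Basis_vec_def inner_axis)
    then show ?thesis
      using le' by (simp add: emeasure_lborel_box prod_Basis_cart inner_axis)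
  qed
  also have "\<dots> = ennreal (\<Prod>b\<in>Basis. (u - l) \<bullet> b)"
    using le' by (simp add: prod_Basis_cart inner_axis prod_lift ennreal_mult'[symmetric] mult.commute)
  finally show "emeasure (distr (lborel \<Otimes>\<^sub>M lborel) borel (\<lambda>p. lift_vec (fst p :: real^'n) (snd p))) (box l u)
      = ennreal (\<Prod>b\<in>Basis. (u - l) \<bullet> b)" .
qed simp

lemma nn_integral_lift:
  fixes f :: "real^'n::finite lift \<Rightarrow> ennreal"
  assumes [measurable]: "f \<in> borel_measurable borel"
  shows "(\<integral>\<^sup>+y. f y \<partial>lborel) = (\<integral>\<^sup>+t. (\<integral>\<^sup>+x. f (lift_vec x t) \<partial>lborel) \<partial>lborel)"
proof -
  have "(\<integral>\<^sup>+y. f y \<partial>lborel) = (\<integral>\<^sup>+p. f (lift_vec (fst p) (snd p)) \<partial>(lborel \<Otimes>\<^sub>M lborel))"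
    by (subst lborel_lift) (rule nn_integral_distr; measurable)
  also have "\<dots> = (\<integral>\<^sup>+t. (\<integral>\<^sup>+x. f (lift_vec (fst (x, t)) (snd (x, t))) \<partial>lborel) \<partial>lborel)"
    by (rule lborel_pair.nn_integral_snd[symmetric]) measurable
  finally show ?thesis by simp
qed

lemma nn_integral_lborel_scale:
  fixes g :: "'a::euclidean_space \<Rightarrow> ennreal"
  assumes [measurable]: "g \<in> borel_measurable borel" and c: "0 < c"
  shows "(\<integral>\<^sup>+x. g x \<partial>lborel) = ennreal (c ^ DIM('a)) * (\<integral>\<^sup>+x. g (c *\<^sub>R x) \<partial>lborel)"
  using c by (subst lborel_affine[of c 0]) (simp_all add: nn_integral_density nn_integral_distr nn_integral_cmult)

text \<open>The Gamma integral, read off from the normalisation of the Erlang density.\<close>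

lemma nn_integral_power_exp:
  assumes b: "0 < b"
  shows "(\<integral>\<^sup>+t. ennreal (indicator {0<..} t * (t ^ n * exp (- (t * b)))) \<partial>lborel) = ennreal (fact n / b ^ Suc n)"
proof -
  have ae: "AE t in lborel. t \<noteq> (0::real)" by (rule AE_lborel_singleton)
  interpret prob_space "density lborel (erlang_density n b)" using b by (rule prob_space_erlang_density)
  have one: "(\<integral>\<^sup>+t. ennreal (erlang_density n b t) \<partial>lborel) = 1"
    using emeasure_space_1 by (simp add: emeasure_density)
  have "(\<integral>\<^sup>+t. ennreal (indicator {0<..} t * (t ^ n * exp (- (t * b)))) \<partial>lborel)
      = (\<integral>\<^sup>+t. ennreal (fact n / b ^ Suc n) * ennreal (erlang_density n b t) \<partial>lborel)"
    using ae b
    by (intro nn_integral_cong_AE)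
       (auto elim!: eventually_mono simp: erlang_density_def indicator_def ennreal_mult'[symmetric] mult_ac)
  also have "\<dots> = ennreal (fact n / b ^ Suc n)"
    by (subst nn_integral_cmult) (auto simp: one)
  finally show ?thesis .
qed

lemma lborel_orthogonal:
  fixes P :: "real^'m::{finite,wellorder} \<Rightarrow> real^'m::_"
  assumes P: "orthogonal_transformation P"
  shows "lborel = distr lborel borel P"
proof (rule lborel_eqI)
  fix l u :: "(real,'m) vec" assume le: "\<And>b. b \<in> Basis \<Longrightarrow> l \<bullet> b \<le> u \<bullet> b"
  have [measurable]: "P \<in> borel_measurable borel"
    using P by (intro borel_measurable_continuous_onI linear_continuous_on)
      (simp add: orthogonal_transformation_linear linear_linear)
  have bij: "bij P" using P by (rule orthogonal_transformation_bij)
  have Q: "orthogonal_transformation (inv P)" using P by (rule orthogonal_transformation_inv)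
  have pre: "P -` box l u = inv P ` box l u" using bij by (simp add: bij_vimage_eq_inv_image)
  have "emeasure (distr lborel borel P) (box l u) = emeasure lborel (P -` box l u)"
    by (subst emeasure_distr) auto
  also have "\<dots> = emeasure lebesgue (inv P ` box l u)"
    unfolding pre[symmetric] using measurable_sets_borel[of P borel "box l u"]
    by (simp add: emeasure_completion)
  also have "\<dots> = ennreal (measure lebesgue (inv P ` box l u))"
    by (intro emeasure_eq_measure2 measurable_orthogonal_image[OF Q]) auto
  also have "\<dots> = ennreal (measure lebesgue (box l u))"
    by (subst measure_orthogonal_image[OF Q]) auto
  also have "\<dots> = ennreal (\<Prod>b\<in>Basis. (u - l) \<bullet> b)"
    using le by (simp add: measure_lborel_box)
  finally show "emeasure (distr lborel borel P) (box l u) = ennreal (\<Prod>b\<in>Basis. (u - l) \<bullet> b)" .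
qed simp

text \<open>After rotating the orthonormal system to the coordinate axes, the integral factorises into
one-dimensional exponential integrals.\<close>

lemma nn_integral_orthant:
  fixes E :: "'m::{finite,wellorder} \<Rightarrow> real^'m::_"
  assumes orth: "\<And>i j. E i \<bullet> E j = (if i = j then 1 else 0)" and l: "0 < l"
  shows "(\<integral>\<^sup>+y. ennreal (indicator {y. \<forall>i. 0 < y \<bullet> E i} y * exp (- (\<Sum>i\<in>UNIV. l * (y \<bullet> E i)))) \<partial>lborel)
     = ennreal ((1 / l) ^ CARD('m))"
proof -
  define A :: "((real,'m) vec,'m) vec" where "A = (\<chi> i j. E i $ j)"
  have AA: "A ** transpose A = mat 1"
    unfolding A_def by (rule orthonormal_rows[OF orth])
  have P: "orthogonal_transformation (\<lambda>x. A *v x)"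
    using AA by (simp add: orthogonal_matrix_def matrix_left_right_inverse orthogonal_transformation_matrix)
  have nth: "(A *v y) $ i = y \<bullet> E i" for y i
    by (simp add: A_def matrix_vector_mult_def inner_vec_def mult.commute)
  define g where "g z = (\<Prod>b\<in>Basis. ennreal (indicator {0<..} (z \<bullet> b) * exp (- (l * (z \<bullet> b)))))" for z :: "(real,'m) vec"
  have [measurable]: "g \<in> borel_measurable borel" unfolding g_def by measurable
  have [measurable]: "(\<lambda>x. A *v x) \<in> borel_measurable borel"
    by (intro borel_measurable_continuous_onI continuous_intros)
  have g: "ennreal (indicator {y. \<forall>i. 0 < y \<bullet> E i} y * exp (- (\<Sum>i\<in>UNIV. l * (y \<bullet> E i)))) = g (A *v y)" for y
  proof -
    have "indicator {y. \<forall>i. 0 < y \<bullet> E i} y * exp (- (\<Sum>i\<in>UNIV. l * (y \<bullet> E i)))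
        = (\<Prod>i\<in>UNIV. indicator {0<..} (y \<bullet> E i) * exp (- (l * (y \<bullet> E i))))"
      by (auto simp: prod.distrib exp_sum[symmetric] sum_negf indicator_def)
    then show ?thesis
      by (simp add: g_def prod_Basis_cart inner_axis nth prod_ennreal)
  qed
  have one: "(\<integral>\<^sup>+x. ennreal (indicator {0<..} x * exp (- (l * x))) \<partial>lborel) = ennreal (1 / l)"
    using nn_integral_power_exp[OF l, of 0] by (simp add: mult.commute)
  have "(\<integral>\<^sup>+y. ennreal (indicator {y. \<forall>i. 0 < y \<bullet> E i} y * exp (- (\<Sum>i\<in>UNIV. l * (y \<bullet> E i)))) \<partial>lborel)
     = (\<integral>\<^sup>+y. g (A *v y) \<partial>lborel)" by (simp add: g)
  also have "\<dots> = (\<integral>\<^sup>+z. g z \<partial>lborel)"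
    by (subst (2) lborel_orthogonal[OF P]) (subst nn_integral_distr; simp)
  also have "\<dots> = (\<Prod>b\<in>(Basis :: (real,'m) vec set). \<integral>\<^sup>+x. ennreal (indicator {0<..} x * exp (- (l * x))) \<partial>lborel)"
    unfolding g_def by (rule nn_integral_lborel_prod) auto
  also have "\<dots> = ennreal ((1 / l) ^ CARD('m))"
    using l by (simp add: one ennreal_power)
  finally show ?thesis .
qed

section \<open>Isotropic measures on the sphere and their lift\<close>

locale wulff_data =
  fixes f :: "real^'n \<Rightarrow> real" and \<nu> :: "(real^'n) measure"
  assumes f_cont: "continuous_on (sphere 0 1) f"
    and f_pos: "u \<in> sphere 0 1 \<Longrightarrow> f u > 0"
    and sphere_measure: "sphere_borel_measure \<nu>"
    and iso: "isotropic \<nu>"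
    and centered: "centered_wrt f \<nu>"
begin

abbreviation supp where "supp \<equiv> measure_support \<nu>"

lemma sets_\<nu>: "sets \<nu> = sets (restrict_space borel (sphere 0 1))"
  using sphere_measure by (simp add: sphere_borel_measure_def)

lemma space_\<nu>: "space \<nu> = sphere 0 1"
  using sets_eq_imp_space_eq[OF sets_\<nu>] by (simp add: space_restrict_space)

sublocale finite_measure \<nu>
  using sphere_measure by (simp add: sphere_borel_measure_def)

lemma measurable_continuous: "continuous_on (sphere 0 1) g \<Longrightarrow> g \<in> borel_measurable \<nu>"
  using borel_measurable_continuous_on_restrict measurable_cong_sets[OF sets_\<nu> refl] by blast

lemma integrable_continuous:
  fixes g :: "real^'n \<Rightarrow> 'b::{banach, second_countable_topology}"
  assumes g: "continuous_on (sphere 0 1) g"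
  shows "integrable \<nu> g"
proof -
  have "bounded (g ` sphere 0 1)"
    using g by (intro compact_imp_bounded compact_continuous_image) auto
  then obtain K where "\<forall>x\<in>g ` sphere 0 1. norm x \<le> K" unfolding bounded_iff by blast
  then have "AE u in \<nu>. norm (g u) \<le> K"
    by (intro AE_I2) (simp add: space_\<nu>)
  then show ?thesis using measurable_continuous[OF g] by (rule integrable_const_bound)
qed

lemma isotropy_inner: "(LINT u|\<nu>. (x \<bullet> u) * (y \<bullet> u)) = x \<bullet> y"
proof -
  have bl: "bounded_linear (\<lambda>A :: real^'n^'n. x \<bullet> (A *v y))"
    unfolding linear_conv_bounded_linear[symmetric]
    by (intro linearI) (simp_all add: matrix_vector_mult_add_rdistrib inner_add_right scaleR_matrix_vector_assoc[symmetric])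
  have o: "integrable \<nu> (\<lambda>u. outer u u)"
    unfolding outer_def by (intro integrable_continuous continuous_on_vec_lambda continuous_intros)
  have "x \<bullet> (outer u u *v y) = (x \<bullet> u) * (y \<bullet> u)" for u
  proof -
    have "outer u u *v y = (y \<bullet> u) *\<^sub>R u"
      by (simp add: vec_eq_iff outer_def matrix_vector_mult_def inner_vec_def sum_distrib_left sum_distrib_right mult_ac)
    then show ?thesis by simp
  qed
  then have "(LINT u|\<nu>. (x \<bullet> u) * (y \<bullet> u)) = (LINT u|\<nu>. x \<bullet> (outer u u *v y))" by simp
  also have "\<dots> = x \<bullet> ((LINT u|\<nu>. outer u u) *v y)"
    by (rule integral_bounded_linear[OF bl o])
  also have "\<dots> = x \<bullet> y" using iso by (simp add: isotropic_def)
  finally show ?thesis .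
qed

lemma centered_inner: "(LINT u|\<nu>. f u * (x \<bullet> u)) = 0"
proof -
  have "integrable \<nu> (\<lambda>u. f u *\<^sub>R u)" by (intro integrable_continuous continuous_intros f_cont)
  then have "(LINT u|\<nu>. x \<bullet> (f u *\<^sub>R u)) = x \<bullet> (LINT u|\<nu>. f u *\<^sub>R u)" by (rule integral_inner_right)
  then show ?thesis using centered by (simp add: centered_wrt_def)
qed

lemma total_mass: "measure \<nu> (space \<nu>) = real CARD('n)"
proof -
  interpret id_frame: isotropic_frame \<nu> "\<lambda>u. u" 1
  proof
    show "(\<lambda>u. u) \<in> borel_measurable \<nu>" by (intro measurable_continuous continuous_intros)
  qed (auto simp: space_\<nu> isotropy_inner)
  have "real CARD('n) = (LINT u|\<nu>. (norm u)\<^sup>2)" by (rule id_frame.integral_norm_sq[symmetric])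
  also have "\<dots> = (LINT u|\<nu>. 1)" by (intro Bochner_Integration.integral_cong) (auto simp: space_\<nu>)
  finally show ?thesis by simp
qed

lemma supp_subset: "supp \<subseteq> sphere 0 1"
  by (auto simp: measure_support_def space_\<nu>)

lemma open_sets_\<nu>: "open U \<Longrightarrow> U \<inter> sphere 0 1 \<in> sets \<nu>"
  unfolding sets_\<nu> sets_restrict_space by auto

text \<open>Points outside the support have open null neighbourhoods, and by the Lindeloef property countably
many of these cover the complement of the support.\<close>

lemma AE_supp: "AE u in \<nu>. u \<in> supp"
proof -
  define \<U> where "\<U> = {U :: (real^'n) set. open U \<and> emeasure \<nu> (U \<inter> space \<nu>) = 0}"
  have "\<And>S. S \<in> \<U> \<Longrightarrow> open S" by (simp add: \<U>_def)
  then obtain \<V> where \<V>: "\<V> \<subseteq> \<U>" "countable \<V>" "\<Union>\<V> = \<Union>\<U>" by (metis Lindelof)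
  have "(\<Union>U\<in>\<V>. U \<inter> space \<nu>) \<in> null_sets \<nu>"
    using \<V> open_sets_\<nu> by (intro null_sets_UN') (auto simp: \<U>_def null_sets_def space_\<nu>)
  moreover have "{u \<in> space \<nu>. u \<notin> supp} \<subseteq> (\<Union>U\<in>\<V>. U \<inter> space \<nu>)"
  proof
    fix u assume "u \<in> {u \<in> space \<nu>. u \<notin> supp}"
    then obtain U where "u \<in> space \<nu>" "open U" "u \<in> U" "emeasure \<nu> (U \<inter> space \<nu>) = 0"
      by (auto simp: measure_support_def)
    then have "u \<in> \<Union>\<V>" "u \<in> space \<nu>" unfolding \<V>(3) by (auto simp: \<U>_def)
    then show "u \<in> (\<Union>U\<in>\<V>. U \<inter> space \<nu>)" by auto
  qed
  ultimately show ?thesis by (rule AE_I')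
qed

lemma AE_not_in_open_imp_supp:
  assumes U: "open U" and ae: "AE u in \<nu>. u \<notin> U" and u: "u \<in> supp"
  shows "u \<notin> U"
proof
  assume "u \<in> U"
  have "emeasure \<nu> (U \<inter> space \<nu>) = 0"
    using ae open_sets_\<nu>[OF U] by (subst (asm) AE_iff_measurable[of "U \<inter> space \<nu>"]) (auto simp: space_\<nu>)
  moreover have "emeasure \<nu> (U \<inter> space \<nu>) > 0"
    using u U \<open>u \<in> U\<close> unfolding measure_support_def by blast
  ultimately show False by simp
qed

text \<open>Continuous functions that agree almost everywhere agree on the whole support, since a relatively open
subset of the support is either empty or of positive measure.\<close>

lemma AE_continuous_on_supp_eq:
  fixes g h :: "real^'n \<Rightarrow> real"
  assumes "AE u in \<nu>. g u = h u" "continuous_on supp g" "continuous_on supp h" "u \<in> supp"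
  shows "g u = h u"
proof -
  have "openin (top_of_set supp) (supp \<inter> (\<lambda>u. g u - h u) -` (- {0}))"
    using assms(2,3) by (intro continuous_openin_preimage_gen continuous_intros) auto
  then obtain U where U: "open U" "supp \<inter> (\<lambda>u. g u - h u) -` (- {0}) = supp \<inter> U"
    by (auto simp: openin_open)
  have iff: "v \<in> U \<longleftrightarrow> g v \<noteq> h v" if "v \<in> supp" for v
  proof -
    have "v \<in> supp \<inter> (\<lambda>u. g u - h u) -` (- {0}) \<longleftrightarrow> v \<in> supp \<inter> U" by (simp only: U(2))
    then show ?thesis using that by auto
  qed
  have "AE v in \<nu>. v \<notin> U" using assms(1) AE_supp by eventually_elim (use iff in auto)
  then have "u \<notin> U" by (rule AE_not_in_open_imp_supp[OF U(1) _ assms(4)])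
  then show ?thesis using iff[OF assms(4)] by simp
qed

lemma AE_continuous_eq_imp_supp:
  fixes g h :: "real^'n \<Rightarrow> real"
  assumes "AE u in \<nu>. g u = h u" "continuous_on (sphere 0 1) g" "continuous_on (sphere 0 1) h" "u \<in> supp"
  shows "g u = h u"
  using assms(2,3)[THEN continuous_on_subset, OF supp_subset]
  by (rule AE_continuous_on_supp_eq[OF assms(1) _ _ assms(4)])

lemma closed_supp: "closed supp"
proof -
  have "openin (top_of_set (sphere 0 1)) (sphere 0 1 - supp)"
    unfolding openin_open
  proof (intro exI conjI)
    let ?W = "\<Union>{U :: (real^'n) set. open U \<and> emeasure \<nu> (U \<inter> space \<nu>) = 0}"
    show "open ?W" by auto
    show "sphere 0 1 - supp = sphere 0 1 \<inter> ?W"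
      by (auto simp: measure_support_def space_\<nu>)
  qed
  then have "closedin (top_of_set (sphere 0 1)) supp"
    using supp_subset by (simp add: closedin_def)
  then show ?thesis by (rule closedin_closed_trans) simp
qed

lemma compact_supp: "compact supp"
  using closed_supp supp_subset bounded_subset[OF bounded_sphere] by (auto simp: compact_eq_bounded_closed)

lemma supp_nonempty: "supp \<noteq> {}"
proof
  assume "supp = {}"
  then have "AE u in \<nu>. False" using AE_supp by simp
  then have "(LINT u|\<nu>. 1) = (LINT u|\<nu>. (0::real))" by (intro integral_cong_AE) (auto elim: eventually_mono)
  then show False using total_mass by simp
qed

definition L :: real where "L = L2_norm_wrt \<nu> f"

lemma f_sq_integrable: "integrable \<nu> (\<lambda>u. (f u)\<^sup>2)"
  by (intro integrable_continuous continuous_intros f_cont)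

lemma L_sq: "L\<^sup>2 = (LINT u|\<nu>. (f u)\<^sup>2)"
  unfolding L_def L2_norm_wrt_def by (simp add: integral_nonneg_AE)

lemma f_bounds: obtains lo hi where "0 < lo" "\<And>u. u \<in> sphere 0 1 \<Longrightarrow> lo \<le> f u \<and> f u \<le> hi"
proof -
  have ne: "sphere (0::real^'n) 1 \<noteq> {}" using supp_nonempty supp_subset by blast
  obtain a where a: "a \<in> sphere 0 1" "\<And>u. u \<in> sphere 0 1 \<Longrightarrow> f a \<le> f u"
    using continuous_attains_inf[OF _ ne f_cont] by auto
  obtain c where "\<forall>u\<in>sphere 0 1. f u \<le> f c"
    using continuous_attains_sup[OF compact_sphere ne f_cont] by blast
  then have c: "\<And>u. u \<in> sphere 0 1 \<Longrightarrow> f u \<le> f c" by blast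
  show ?thesis using that[of "f a" "f c"] a c f_pos by blast
qed

lemma L_pos: "0 < L"
proof -
  obtain lo hi where lo: "0 < lo" "\<And>u. u \<in> sphere 0 1 \<Longrightarrow> lo \<le> f u \<and> f u \<le> hi" by (rule f_bounds) blast
  have "0 < lo\<^sup>2 * real CARD('n)" using lo(1) by simp
  also have "\<dots> = (LINT u|\<nu>. lo\<^sup>2)" using total_mass by simp
  also have "\<dots> \<le> (LINT u|\<nu>. (f u)\<^sup>2)"
    using lo by (intro integral_mono f_sq_integrable) (auto simp: space_\<nu> intro!: power_mono)
  finally have "0 < L\<^sup>2" by (simp add: L_sq)
  moreover have "0 \<le> L" unfolding L_def L2_norm_wrt_def by (simp add: integral_nonneg_AE)
  ultimately show ?thesis by (cases "L = 0") auto
qed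

lemma one_over_f_cont [continuous_intros]: "continuous_on (sphere 0 1) (\<lambda>u. 1 / f u)"
proof (rule continuous_on_divide)
  show "\<forall>u\<in>sphere 0 1. f u \<noteq> 0" using f_pos less_irrefl by fastforce
qed (rule continuous_on_const f_cont)+

text \<open>The horizontal part carries a minus sign so that \<open>lift_vec x t\<close> is positive on \<open>w u\<close> exactly if
\<open>x \<bullet> u\<close> is less than \<open>t * (f u / L)\<close>.\<close>

definition w where "w u = lift_vec (- u) (f u / L)"

lemma w_cont [continuous_intros]: "continuous_on (sphere 0 1) w"
  unfolding w_def by (intro continuous_intros f_cont) (use L_pos in auto)

lemma inner_w: "lift_vec x t \<bullet> w u = t * (f u / L) - x \<bullet> u"
  by (simp add: w_def inner_lift_vec)

lemma norm_w_sq: "u \<in> sphere 0 1 \<Longrightarrow> (norm (w u))\<^sup>2 = 1 + (f u)\<^sup>2 / L\<^sup>2"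
  by (simp add: w_def norm_lift_vec_sq power_divide)

lemma norm_w_ge: "u \<in> sphere 0 1 \<Longrightarrow> 1 \<le> norm (w u)"
  by (rule power2_le_imp_le) (simp_all add: norm_w_sq)

text \<open>Expanding the product gives one term for each block of the identity matrix: isotropy of \<open>\<nu>\<close> for the
horizontal block, centering for the mixed terms, and the choice of \<open>L\<close> for the vertical entry.\<close>

lemma isotropy_w: "(LINT u|\<nu>. (x \<bullet> w u) * (y \<bullet> w u)) = x \<bullet> y"
proof -
  obtain p s q t where x: "x = lift_vec p s" and y: "y = lift_vec q t" by (metis lift_vec_cases)
  have eq: "(x \<bullet> w u) * (y \<bullet> w u) = (p \<bullet> u) * (q \<bullet> u) - (t / L) * (f u * (p \<bullet> u)) - (s / L) * (f u * (q \<bullet> u))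
      + (s * t / L\<^sup>2) * (f u)\<^sup>2" for u
    by (simp add: x y inner_w algebra_simps power2_eq_square)
  have i: "integrable \<nu> (\<lambda>u. (p \<bullet> u) * (q \<bullet> u))" "integrable \<nu> (\<lambda>u. f u * (p \<bullet> u))" "integrable \<nu> (\<lambda>u. f u * (q \<bullet> u))"
    by (intro integrable_continuous continuous_intros f_cont)+
  have "(LINT u|\<nu>. (x \<bullet> w u) * (y \<bullet> w u)) = p \<bullet> q + (s * t / L\<^sup>2) * L\<^sup>2"
    unfolding eq using i f_sq_integrable by (simp add: isotropy_inner centered_inner L_sq)
  then show ?thesis using L_pos by (simp add: x y inner_lift_vec)
qed

lemma exists_cone_transport:
  obtains B T b where "cone_transport \<nu> w B (\<lambda>u. 1 / f u) T b"
proof -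
  obtain lo hi where lo: "0 < lo" "\<And>u. u \<in> sphere 0 1 \<Longrightarrow> lo \<le> f u \<and> f u \<le> hi" by (rule f_bounds) blast
  obtain u0 where u0: "u0 \<in> sphere (0::real^'n) 1" using supp_nonempty supp_subset by blast
  have hi: "0 < hi" using lo(1) lo(2)[OF u0] by linarith
  have "bounded (w ` sphere 0 1)" by (intro compact_imp_bounded compact_continuous_image w_cont) auto
  then obtain K where K: "\<forall>x\<in>w ` sphere 0 1. norm x \<le> K" unfolding bounded_iff by blast
  obtain T :: "real \<Rightarrow> real" where T: "T \<in> borel_measurable borel"
    "\<And>s. 0 < s \<Longrightarrow> (T has_real_derivative sqrt (2 * pi) * exp ((T s)\<^sup>2 / 2 - s)) (at s)"
    by (rule exponential_to_gaussian_transport) blast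
  have "cone_transport \<nu> w (max K (1 / lo)) (\<lambda>u. 1 / f u) T (min 1 (1 / hi))"
  proof
    show "w \<in> borel_measurable \<nu>" by (intro measurable_continuous w_cont)
    show "(\<lambda>u. 1 / f u) \<in> borel_measurable \<nu>" by (intro measurable_continuous one_over_f_cont)
    show "norm (w u) \<le> max K (1 / lo)" if "u \<in> space \<nu>" for u using that K by (auto simp: space_\<nu> le_max_iff_disj)
    show "min 1 (1 / hi) \<le> 1 / f u \<and> 1 / f u \<le> max K (1 / lo)" if "u \<in> space \<nu>" for u
      using lo(2)[of u] lo(1) hi that by (auto simp: space_\<nu> le_max_iff_disj min_le_iff_disj frac_le)
    show "min 1 (1 / hi) \<le> norm (w u)" if "u \<in> space \<nu>" for u using norm_w_ge[of u] that by (simp add: space_\<nu> min_le_iff_disj)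
    show "0 < min 1 (1 / hi)" using hi by simp
  qed (use T isotropy_w in auto)
  then show ?thesis by (rule that)
qed

section \<open>The Wulff shape and its volume\<close>

text \<open>The equality \<open>max g h = h\<close> reduces this to the case of equal functions.\<close>

lemma AE_continuous_le_imp_supp:
  fixes g h :: "real^'n \<Rightarrow> real"
  assumes "AE u in \<nu>. g u \<le> h u" "continuous_on (sphere 0 1) g" "continuous_on (sphere 0 1) h" "u \<in> supp"
  shows "g u \<le> h u"
proof -
  have "max (g u) (h u) = h u"
  proof (rule AE_continuous_eq_imp_supp[OF _ _ assms(3,4)])
    show "AE u in \<nu>. max (g u) (h u) = h u" using assms(1) by eventually_elim auto
    show "continuous_on (sphere 0 1) (\<lambda>u. max (g u) (h u))" using assms(2,3) by (intro continuous_intros)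
  qed
  then show ?thesis by linarith
qed

abbreviation W where "W \<equiv> wulff_shape \<nu> f"

text \<open>The Wulff shape with strict inequalities; its dilates are the slices of the cone.\<close>

definition W_open where "W_open = {z. \<forall>u\<in>supp. z \<bullet> u < f u}"

lemma W_eq_Inter: "W = (\<Inter>u\<in>supp. {x. u \<bullet> x \<le> f u})"
  by (auto simp: wulff_shape_def inner_commute)

lemma closed_W: "closed W"
  unfolding W_eq_Inter by (intro closed_INT ballI closed_halfspace_le)

lemma convex_W: "convex W"
  unfolding W_eq_Inter by (intro convex_INT convex_halfspace_le)

text \<open>For \<open>x\<close> in \<open>W\<close> the function \<open>x \<bullet> u\<close> is bounded above by \<open>f\<close> and has mean zero with weight \<open>f\<close>,
so its negative part is controlled as well: \<open>f |x \<bullet> u| \<le> 2 f^2 - f (x \<bullet> u)\<close>. Integrating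
\<open>(x \<bullet> u)^2 \<le> |x| |x \<bullet> u|\<close> and using isotropy gives a bound on \<open>|x|\<close>.\<close>

lemma bounded_W: "bounded W"
proof -
  obtain lo hi where lo: "0 < lo" "\<And>u. u \<in> sphere 0 1 \<Longrightarrow> lo \<le> f u \<and> f u \<le> hi" by (rule f_bounds) blast
  have "norm x \<le> 2 * L\<^sup>2 / lo" if x: "x \<in> W" for x
  proof (cases "x = 0")
    case False
    have AEx: "AE u in \<nu>. x \<bullet> u \<le> f u"
      using AE_supp by eventually_elim (use x in \<open>auto simp: wulff_shape_def\<close>)
    have i: "integrable \<nu> (\<lambda>u. (x \<bullet> u) * (x \<bullet> u))" "integrable \<nu> (\<lambda>u. f u * (x \<bullet> u))" "integrable \<nu> (\<lambda>u. (f u)\<^sup>2)"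
      by (intro integrable_continuous continuous_intros f_cont)+
    have "(LINT u|\<nu>. lo * ((x \<bullet> u) * (x \<bullet> u))) \<le> (LINT u|\<nu>. norm x * (2 * (f u)\<^sup>2 - f u * (x \<bullet> u)))"
    proof (rule integral_mono_AE)
      show "AE u in \<nu>. lo * ((x \<bullet> u) * (x \<bullet> u)) \<le> norm x * (2 * (f u)\<^sup>2 - f u * (x \<bullet> u))"
        using AEx AE_space
      proof eventually_elim
        case (elim u)
        have u: "norm u = 1" and fu: "lo \<le> f u" using elim(2) lo(2)[of u] by (auto simp: space_\<nu>)
        have abs: "\<bar>x \<bullet> u\<bar> \<le> norm x" using Cauchy_Schwarz_ineq2[of x u] u by simp
        have le: "f u * \<bar>x \<bullet> u\<bar> \<le> 2 * (f u)\<^sup>2 - f u * (x \<bullet> u)"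
        proof (cases "x \<bullet> u \<ge> 0")
          case True
          then have "f u * (x \<bullet> u) \<le> f u * f u" using elim(1) fu lo(1) by (intro mult_left_mono) auto
          then show ?thesis using True by (simp add: power2_eq_square)
        qed simp
        have "lo * ((x \<bullet> u) * (x \<bullet> u)) = \<bar>x \<bullet> u\<bar> * (lo * \<bar>x \<bullet> u\<bar>)" by (simp add: abs_mult_self_eq mult.left_commute)
        also have "\<dots> \<le> norm x * (f u * \<bar>x \<bullet> u\<bar>)"
          using abs fu lo(1) by (intro mult_mono mult_right_mono) auto
        also have "\<dots> \<le> norm x * (2 * (f u)\<^sup>2 - f u * (x \<bullet> u))" using le by (intro mult_left_mono) auto
        finally show ?case .
      qed
    qed (use i in auto)
    moreover have "(LINT u|\<nu>. lo * ((x \<bullet> u) * (x \<bullet> u))) = lo * (norm x * norm x)"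
      using i isotropy_inner[of x x] by (simp add: dot_square_norm power2_eq_square)
    moreover have "(LINT u|\<nu>. norm x * (2 * (f u)\<^sup>2 - f u * (x \<bullet> u))) = norm x * (2 * L\<^sup>2)"
      using i centered_inner[of x] by (simp add: L_sq)
    ultimately have "lo * (norm x * norm x) \<le> norm x * (2 * L\<^sup>2)" by linarith
    then have "lo * norm x \<le> 2 * L\<^sup>2" using False by (simp add: mult.left_commute)
    then show ?thesis using lo(1) by (simp add: field_simps)
  qed (use lo(1) in simp)
  then show ?thesis unfolding bounded_iff by blast
qed

lemma compact_W: "compact W"
  using closed_W bounded_W by (simp add: compact_eq_bounded_closed)

lemma W_borel [measurable]: "W \<in> sets borel"
  using closed_W by simp

lemma W_pos: "0 < measure lebesgue W"
proof -
  obtain lo hi where lo: "0 < lo" "\<And>u. u \<in> sphere 0 1 \<Longrightarrow> lo \<le> f u \<and> f u \<le> hi" by (rule f_bounds) blast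
  have "ball 0 lo \<subseteq> W"
  proof
    fix x :: "real^'n" assume x: "x \<in> ball 0 lo"
    have "x \<bullet> u \<le> f u" if u: "u \<in> supp" for u
    proof -
      have "norm u = 1" using u supp_subset by auto
      then have "x \<bullet> u \<le> norm x" using norm_cauchy_schwarz[of x u] by simp
      then show ?thesis using x lo(2)[of u] u supp_subset by auto
    qed
    then show "x \<in> W" by (simp add: wulff_shape_def)
  qed
  then have "measure lebesgue (ball (0::real^'n) lo) \<le> measure lebesgue W"
    by (intro measure_mono_fmeasurable) (use compact_W lmeasurable_compact in auto)
  moreover have "0 < measure lebesgue (ball (0::real^'n) lo)"
    using content_ball_pos[OF lo(1)] by simp
  ultimately show ?thesis by linarith
qed

text \<open>The two sets differ by boundary points of the convex set \<open>W\<close>, and the boundary of a convex set is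
negligible. An interior point satisfies all inequalities strictly because it can be moved a little
in each direction \<open>u\<close>.\<close>

lemma AE_W_open: "AE z in lborel. z \<in> W_open \<longleftrightarrow> z \<in> W"
proof -
  have "W_open \<subseteq> W" by (auto simp: W_open_def wulff_shape_def less_imp_le)
  have int: "interior W \<subseteq> W_open"
  proof
    fix z assume "z \<in> interior W"
    then obtain e where e: "e > 0" "cball z e \<subseteq> W" by (auto simp: mem_interior_cball)
    have "z \<bullet> u < f u" if u: "u \<in> supp" for u
    proof -
      have nu: "norm u = 1" using u supp_subset by auto
      then have "z + e *\<^sub>R u \<in> W" using e by (intro subsetD[OF e(2)]) (simp add: dist_norm)
      then have "(z + e *\<^sub>R u) \<bullet> u \<le> f u" using u by (auto simp: wulff_shape_def)
      moreover have "u \<bullet> u = 1" using nu by (simp add: norm_eq_1)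
      ultimately show ?thesis using e(1) by (simp add: inner_add_left)
    qed
    then show "z \<in> W_open" by (simp add: W_open_def)
  qed
  have "frontier W \<in> null_sets lebesgue"
    using negligible_convex_frontier[OF convex_W] negligible_iff_null_sets by blast
  then have "AE z in lebesgue. z \<notin> frontier W" by (rule AE_not_in)
  then have "AE z in lborel. z \<notin> frontier W" by (simp only: AE_completion_iff)
  then show ?thesis
    by eventually_elim (use int \<open>W_open \<subseteq> W\<close> closed_W in \<open>auto simp: frontier_def\<close>)
qed

text \<open>The vector that is paired with the centroid in the definition of the displacement.\<close>

definition polar_mean where "polar_mean = (LINT u|\<nu>. (1 / f u) *\<^sub>R u)"

lemma polar_mean_inner: "(LINT u|\<nu>. (1 / f u) * (x \<bullet> u)) = x \<bullet> polar_mean"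
proof -
  have "integrable \<nu> (\<lambda>u. (1 / f u) *\<^sub>R u)" by (intro integrable_continuous continuous_intros)
  then have "(LINT u|\<nu>. x \<bullet> ((1 / f u) *\<^sub>R u)) = x \<bullet> polar_mean"
    unfolding polar_mean_def by (rule integral_inner_right)
  then show ?thesis by simp
qed

definition exp_moment :: "real \<Rightarrow> ennreal" where
  "exp_moment r = (\<integral>\<^sup>+z. ennreal (indicator W_open z * exp (r * (z \<bullet> polar_mean))) \<partial>lborel)"

lemma exp_moment_W: "exp_moment r = (\<integral>\<^sup>+z. ennreal (indicator W z * exp (r * (z \<bullet> polar_mean))) \<partial>lborel)"
  unfolding exp_moment_def
  by (intro nn_integral_cong_AE eventually_mono[OF AE_W_open]) (auto simp: indicator_def)

lemma emeasure_W: "emeasure lborel W = ennreal (measure lebesgue W)"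
  using emeasure_eq_measure2[OF lmeasurable_compact[OF compact_W]] by (simp add: emeasure_completion)

lemma exp_moment_flat: "polar_mean = 0 \<Longrightarrow> exp_moment r = ennreal (measure lebesgue W)"
  unfolding exp_moment_W by (simp add: ennreal_indicator emeasure_W del: measure_completion)

text \<open>Integrate \<open>exp x \<ge> 1 + x\<close>. The linear term drops out because the displacement is the inner product
of the centroid with \<open>polar_mean\<close>.\<close>

lemma exp_moment_ge:
  assumes "wulff_disp \<nu> f = 0"
  shows "ennreal (measure lebesgue W) \<le> exp_moment r"
proof -
  define I where "I = (LINT x:W|lebesgue. x)"
  have I: "I \<bullet> polar_mean = 0"
    using assms W_pos by (simp add: wulff_disp_def centroid_def I_def polar_mean_def)
  have si: "set_integrable lborel W g" if "continuous_on W g" for g :: "real^'n \<Rightarrow> 'b::euclidean_space"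
    unfolding set_integrable_def using compact_W that by (rule borel_integrable_compact)
  have ce: "continuous_on W (\<lambda>z. exp (r * (z \<bullet> polar_mean)))" by (intro continuous_intros)
  have Ieq: "I = (LINT x:W|lborel. x)"
    unfolding I_def set_lebesgue_integral_def by (rule integral_completion) measurable
  have ii: "integrable lborel (\<lambda>z. indicator W z *\<^sub>R z)" "integrable lborel (\<lambda>z. indicator W z *\<^sub>R (1::real))"
    "integrable lborel (\<lambda>z. indicator W z *\<^sub>R exp (r * (z \<bullet> polar_mean)))"
    using si[of "\<lambda>z. z"] si[of "\<lambda>z. 1::real"] si[OF ce]
    by (auto simp: set_integrable_def intro!: continuous_intros)
  have V: "measure lebesgue W = (LINT z|lborel. indicator W z *\<^sub>R (1::real))"
    by (simp add: measure_completion)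
  have "measure lebesgue W = (LINT z|lborel. indicator W z *\<^sub>R (1::real)) + r * (I \<bullet> polar_mean)"
    using V by (simp add: I)
  also have "I \<bullet> polar_mean = (LINT z|lborel. (indicator W z *\<^sub>R z) \<bullet> polar_mean)"
    unfolding Ieq set_lebesgue_integral_def using ii(1) by (intro integral_inner_left[symmetric])
  also have "(LINT z|lborel. indicator W z *\<^sub>R (1::real)) + r * (LINT z|lborel. (indicator W z *\<^sub>R z) \<bullet> polar_mean)
     = (LINT z|lborel. indicator W z *\<^sub>R (1::real) + r * ((indicator W z *\<^sub>R z) \<bullet> polar_mean))"
    using ii(2) integrable_inner_left[OF ii(1), of polar_mean] by simp
  also have "\<dots> \<le> (LINT z|lborel. indicator W z *\<^sub>R exp (r * (z \<bullet> polar_mean)))"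
  proof (rule integral_mono)
    show "integrable lborel (\<lambda>z. indicator W z *\<^sub>R (1::real) + r * ((indicator W z *\<^sub>R z) \<bullet> polar_mean))"
      using ii(2) integrable_inner_left[OF ii(1), of polar_mean] by (intro Bochner_Integration.integrable_add integrable_mult_right)
    show "indicator W z *\<^sub>R (1::real) + r * ((indicator W z *\<^sub>R z) \<bullet> polar_mean) \<le> indicator W z *\<^sub>R exp (r * (z \<bullet> polar_mean))" for z
      using exp_ge_add_one_self[of "r * (z \<bullet> polar_mean)"] by (simp add: indicator_def)
  qed (rule ii(3))
  finally have "ennreal (measure lebesgue W) \<le> ennreal (LINT z|lborel. indicator W z *\<^sub>R exp (r * (z \<bullet> polar_mean)))"
    by (rule ennreal_leI)
  also have "\<dots> = exp_moment r"
    unfolding exp_moment_W using ii(3) by (subst nn_integral_eq_integral) auto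
  finally show ?thesis .
qed

definition ratio where "ratio u = (f u)\<^sup>2 / L\<^sup>2"

lemma ratio_cont [continuous_intros]: "continuous_on (sphere 0 1) ratio"
  unfolding ratio_def by (intro continuous_intros f_cont) (use L_pos in auto)

lemma ratio_pos: "u \<in> sphere 0 1 \<Longrightarrow> 0 < ratio u"
  unfolding ratio_def by (intro divide_pos_pos zero_less_power f_pos L_pos)

lemma integral_ratio: "(LINT u|\<nu>. ratio u) = 1"
  using L_pos by (simp add: ratio_def L_sq[symmetric])

text \<open>The left-hand side is the tangent at \<open>p = 1 / n\<close> of the convex function on the right. With
\<open>x = p (1 + n) / (1 + p)\<close> the claim is \<open>ln x \<le> x - 1\<close>, where equality holds only for \<open>x = 1\<close>.\<close>

lemma one_plus_ratio_ln_ge: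
  fixes p n :: real
  assumes "0 < p" "0 < n"
  shows "(1 + p) * ln (1 + n) + (1 - n * p) \<le> (1 + p) * ln (1 + 1 / p)"
    and "(1 + p) * ln (1 + n) + (1 - n * p) = (1 + p) * ln (1 + 1 / p) \<Longrightarrow> p = 1 / n"
proof -
  define x where "x = p * (1 + n) / (1 + p)"
  have x: "0 < x" using assms by (simp add: x_def)
  have "1 + n \<noteq> 0" using assms by linarith
  then have "(1 + n) / x = (1 + p) / p" by (simp add: x_def)
  also have "\<dots> = 1 + 1 / p" using assms by (simp add: field_simps)
  finally have "1 + 1 / p = (1 + n) / x" by simp
  then have ln: "ln (1 + 1 / p) = ln (1 + n) - ln x" using x assms by (simp add: ln_div)
  have x1: "(1 + p) * (1 - x) = 1 - n * p" using assms by (simp add: x_def field_simps)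
  have "(1 + p) * ln x \<le> (1 + p) * (x - 1)" using x assms by (intro mult_left_mono ln_le_minus_one) auto
  then show "(1 + p) * ln (1 + n) + (1 - n * p) \<le> (1 + p) * ln (1 + 1 / p)"
    unfolding ln x1[symmetric] by (simp add: algebra_simps)
  assume "(1 + p) * ln (1 + n) + (1 - n * p) = (1 + p) * ln (1 + 1 / p)"
  then have "(1 + p) * ln x = (1 + p) * (x - 1)" unfolding ln x1[symmetric] by (simp add: algebra_simps)
  then have "ln x = x - 1" using assms by simp
  then have "x = 1" using x ln_eq_minus_one by blast
  then show "p = 1 / n" using assms by (simp add: x_def field_simps)
qed

text \<open>Up to a factor 2, \<open>log_bound\<close> without its logarithm of \<open>L\<close>; it depends on \<open>f\<close> only through
\<open>f^2 / L^2\<close>.\<close>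

definition ratio_entropy where "ratio_entropy = (LINT u|\<nu>. (1 + ratio u) * ln (1 + 1 / ratio u))"

lemma ratio_entropy_integrable: "integrable \<nu> (\<lambda>u. (1 + ratio u) * ln (1 + 1 / ratio u))"
proof (intro integrable_continuous continuous_intros)
  show "\<forall>u\<in>sphere 0 1. ratio u \<noteq> 0" using ratio_pos less_irrefl by fastforce
  show "\<forall>u\<in>sphere 0 1. 1 + 1 / ratio u \<noteq> 0"
  proof
    fix u :: "real^'n" assume "u \<in> sphere 0 1"
    then have "0 < 1 / ratio u" using ratio_pos by simp
    then show "1 + 1 / ratio u \<noteq> 0" by linarith
  qed
qed

text \<open>The tangent integrates to a value independent of \<open>f\<close>, because \<open>ratio\<close> has integral 1 and \<open>\<nu>\<close> has
total mass \<open>n\<close>.\<close>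

lemma ratio_entropy_lower:
  "integrable \<nu> (\<lambda>u. (1 + ratio u) * ln (1 + CARD('n)) + (1 - CARD('n) * ratio u))"
  "(LINT u|\<nu>. (1 + ratio u) * ln (1 + CARD('n)) + (1 - CARD('n) * ratio u)) = (CARD('n) + 1) * ln (1 + CARD('n))"
proof -
  have r: "integrable \<nu> ratio" by (intro integrable_continuous continuous_intros)
  then show "integrable \<nu> (\<lambda>u. (1 + ratio u) * ln (1 + CARD('n)) + (1 - CARD('n) * ratio u))"
    by auto
  show "(LINT u|\<nu>. (1 + ratio u) * ln (1 + CARD('n)) + (1 - CARD('n) * ratio u)) = (CARD('n) + 1) * ln (1 + CARD('n))"
    using r by (simp add: integral_ratio total_mass)
qed

lemma ratio_entropy_ge: "(CARD('n) + 1) * ln (1 + CARD('n)) \<le> ratio_entropy"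
  unfolding ratio_entropy_lower(2)[symmetric] ratio_entropy_def
proof (intro integral_mono ratio_entropy_lower ratio_entropy_integrable)
  fix u assume "u \<in> space \<nu>"
  then show "(1 + ratio u) * ln (1 + CARD('n)) + (1 - CARD('n) * ratio u) \<le> (1 + ratio u) * ln (1 + 1 / ratio u)"
    using one_plus_ratio_ln_ge(1)[OF ratio_pos, of u "real CARD('n)"] by (simp add: space_\<nu>)
qed

lemma ratio_entropy_eq_imp:
  assumes "ratio_entropy = (CARD('n) + 1) * ln (1 + CARD('n))" and u: "u \<in> supp"
  shows "f u = L / sqrt CARD('n)"
proof -
  let ?g = "\<lambda>u. (1 + ratio u) * ln (1 + 1 / ratio u) - ((1 + ratio u) * ln (1 + CARD('n)) + (1 - CARD('n) * ratio u))"
  have "(LINT u|\<nu>. ?g u) = 0"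
    using assms(1) ratio_entropy_lower ratio_entropy_integrable by (simp add: ratio_entropy_def)
  moreover have "AE u in \<nu>. 0 \<le> ?g u"
    using one_plus_ratio_ln_ge(1)[OF ratio_pos, of _ "CARD('n)"] by (intro AE_I2) (simp add: space_\<nu>)
  moreover have "integrable \<nu> ?g" using ratio_entropy_lower ratio_entropy_integrable by auto
  ultimately have "AE u in \<nu>. ?g u = 0" by (subst integral_nonneg_eq_0_iff_AE[symmetric])
  then have "AE u in \<nu>. ratio u = 1 / CARD('n)"
    using AE_space
  proof eventually_elim
    case (elim u)
    then show ?case using one_plus_ratio_ln_ge(2)[OF ratio_pos, of u "CARD('n)"] by (simp add: space_\<nu>)
  qed
  then have "ratio u = 1 / CARD('n)"
    by (rule AE_continuous_eq_imp_supp) (intro continuous_intros u)+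
  then have "(f u)\<^sup>2 = (L / sqrt CARD('n))\<^sup>2" using L_pos by (simp add: ratio_def power_divide field_simps)
  moreover have "0 \<le> f u" "0 \<le> L / sqrt CARD('n)" using L_pos f_pos[of u] u supp_subset by (auto simp: less_imp_le)
  ultimately show ?thesis by (metis power2_eq_iff_nonneg)
qed

end

text \<open>The transport argument applied to the lifted measure with scales \<open>\<kappa> = 1 / f\<close>. This choice makes the
horizontal part of the drift equal to \<open>- polar_mean\<close>, the vector in the displacement, while its
vertical part does not depend on \<open>f\<close> except through \<open>L\<close>.\<close>

locale wulff_transport = wulff_data f \<nu> + ct: cone_transport \<nu> "wulff_data.w f \<nu>" B "\<lambda>u. 1 / f u" T b
  for f :: "real^'n \<Rightarrow> real" and \<nu> B T b
begin

lemma log_bound_eq: "ct.log_bound = ratio_entropy / 2 - (CARD('n) + 1) * ln L"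
proof -
  have r: "integrable \<nu> ratio" by (intro integrable_continuous continuous_intros)
  have "ct.log_bound = (LINT u|\<nu>. (1/2) * ((1 + ratio u) * ln (1 + 1 / ratio u)) - (1 + ratio u) * ln L)"
    unfolding ct.log_bound_def
  proof (intro Bochner_Integration.integral_cong refl)
    fix u assume "u \<in> space \<nu>"
    then have u: "u \<in> sphere 0 1" by (simp add: space_\<nu>)
    note p = ratio_pos[OF u]
    have n2: "(norm (w u))\<^sup>2 = 1 + ratio u" using norm_w_sq[OF u] by (simp add: ratio_def)
    have k: "0 < 1 / f u * norm (w u)" using norm_w_ge[OF u] f_pos[OF u] by (intro mult_pos_pos) (simp, linarith)
    have "(1 / f u * norm (w u))\<^sup>2 = (1 + ratio u) / (f u)\<^sup>2"
      unfolding power_mult_distrib n2 by (simp add: power_divide)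
    also have "\<dots> = (1 + 1 / ratio u) / L\<^sup>2"
      using f_pos[OF u] L_pos by (simp add: ratio_def field_simps)
    finally have "ln ((1 / f u * norm (w u))\<^sup>2) = ln ((1 + 1 / ratio u) / L\<^sup>2)" by simp
    moreover have "0 < 1 + 1 / ratio u" using p by (simp add: add_pos_pos)
    ultimately have "2 * ln (1 / f u * norm (w u)) = ln (1 + 1 / ratio u) - 2 * ln L"
      using k L_pos by (simp only: ln_realpow) (simp add: ln_div ln_realpow)
    then have lnk: "ln (1 / f u * norm (w u)) = (1/2) * ln (1 + 1 / ratio u) - ln L" by linarith
    show "(norm (w u))\<^sup>2 * ln (1 / f u * norm (w u)) = (1/2) * ((1 + ratio u) * ln (1 + 1 / ratio u)) - (1 + ratio u) * ln L"
      unfolding n2 lnk by (simp add: algebra_simps)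
  qed
  also have "\<dots> = (1/2) * ratio_entropy - (CARD('n) + 1) * ln L"
    unfolding ratio_entropy_def using r ratio_entropy_integrable by (simp add: integral_ratio total_mass)
  finally show ?thesis by simp
qed

text \<open>Since the support is compact, a functional that is positive on the lifted support is bounded away
from zero there.\<close>

lemma pos_cone_iff: "y \<in> ct.pos_cone \<longleftrightarrow> (\<forall>u\<in>supp. 0 < y \<bullet> w u)"
proof
  assume "y \<in> ct.pos_cone"
  then obtain \<delta> where \<delta>: "0 < \<delta>" "AE u in \<nu>. \<delta> \<le> y \<bullet> w u" unfolding ct.pos_cone_def by blast
  show "\<forall>u\<in>supp. 0 < y \<bullet> w u"
  proof
    fix u assume u: "u \<in> supp"
    have "\<delta> \<le> y \<bullet> w u"
      by (rule AE_continuous_le_imp_supp[OF \<delta>(2) _ _ u]) (intro continuous_intros)+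
    then show "0 < y \<bullet> w u" using \<delta>(1) by linarith
  qed
next
  assume pos: "\<forall>u\<in>supp. 0 < y \<bullet> w u"
  have "continuous_on supp (\<lambda>u. y \<bullet> w u)"
    by (rule continuous_on_subset[OF _ supp_subset]) (intro continuous_intros)
  from continuous_attains_inf[OF compact_supp supp_nonempty this]
  obtain v where v: "v \<in> supp" "\<forall>u\<in>supp. y \<bullet> w v \<le> y \<bullet> w u" by blast
  have "AE u in \<nu>. y \<bullet> w v \<le> y \<bullet> w u" using AE_supp by eventually_elim (use v in auto)
  then show "y \<in> ct.pos_cone" unfolding ct.pos_cone_def using pos v(1) by blast
qed

text \<open>Integrating the positive function \<open>y \<bullet> w u\<close> against \<open>f u\<close> cancels the horizontal part by the
centering condition and leaves \<open>t * L\<close>.\<close>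

lemma pos_cone_height:
  assumes "lift_vec x t \<in> ct.pos_cone"
  shows "0 < t"
proof -
  obtain \<delta> where \<delta>: "0 < \<delta>" "AE u in \<nu>. \<delta> \<le> lift_vec x t \<bullet> w u"
    using assms unfolding ct.pos_cone_def by blast
  obtain lo hi where lo: "0 < lo" "\<And>u. u \<in> sphere 0 1 \<Longrightarrow> lo \<le> f u \<and> f u \<le> hi" by (rule f_bounds) blast
  have i: "integrable \<nu> (\<lambda>u. f u * (x \<bullet> u))" by (intro integrable_continuous continuous_intros f_cont)
  have "0 < lo * \<delta> * CARD('n)" using lo(1) \<delta>(1) by simp
  also have "\<dots> = (LINT u|\<nu>. lo * \<delta>)" by (simp add: total_mass)
  also have "\<dots> \<le> (LINT u|\<nu>. (t / L) * (f u)\<^sup>2 - f u * (x \<bullet> u))"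
  proof (rule integral_mono_AE)
    show "AE u in \<nu>. lo * \<delta> \<le> (t / L) * (f u)\<^sup>2 - f u * (x \<bullet> u)"
      using \<delta>(2) AE_space
    proof eventually_elim
      case (elim u)
      then have "lo * \<delta> \<le> f u * (lift_vec x t \<bullet> w u)"
        using lo(1) lo(2)[of u] \<delta>(1) by (intro mult_mono) (auto simp: space_\<nu>)
      then show ?case by (simp add: inner_w right_diff_distrib power2_eq_square mult_ac)
    qed
  qed (use i f_sq_integrable in auto)
  also have "\<dots> = (t / L) * L\<^sup>2" using i f_sq_integrable by (simp add: centered_inner L_sq)
  finally show ?thesis using L_pos by (simp add: power2_eq_square zero_less_mult_iff)
qed

lemma pos_cone_lift: "lift_vec x t \<in> ct.pos_cone \<longleftrightarrow> 0 < t \<and> (L / t) *\<^sub>R x \<in> W_open"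
proof (cases "0 < t")
  case True
  have "0 < lift_vec x t \<bullet> w u \<longleftrightarrow> ((L / t) *\<^sub>R x) \<bullet> u < f u" for u
    using True L_pos by (simp add: inner_w field_simps)
  then show ?thesis using True by (simp add: pos_cone_iff W_open_def)
qed (use pos_cone_height in auto)

lemma W_open_borel [measurable]: "W_open \<in> sets borel"
proof -
  have "W_open = (\<lambda>z. lift_vec z L) -` ct.pos_cone"
    using L_pos by (auto simp: pos_cone_lift)
  moreover have "open ((\<lambda>z. lift_vec z L) -` ct.pos_cone)"
    by (intro open_vimage ct.open_cone continuous_intros)
  ultimately show ?thesis by simp
qed

lemma inner_drift: "lift_vec x t \<bullet> ct.drift = t * ((CARD('n) + 1) / L) - x \<bullet> polar_mean"
proof -
  have c: "continuous_on (sphere 0 1) (\<lambda>u. (1 / f u * (norm (w u))\<^sup>2) *\<^sub>R w u)"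
    by (intro continuous_intros)
  have i: "integrable \<nu> (\<lambda>u. (1 / f u) * (x \<bullet> u))" "integrable \<nu> (\<lambda>u. f u * (x \<bullet> u))"
    by (intro integrable_continuous continuous_intros f_cont)+
  have "lift_vec x t \<bullet> ct.drift = (LINT u|\<nu>. lift_vec x t \<bullet> ((1 / f u * (norm (w u))\<^sup>2) *\<^sub>R w u))"
    unfolding ct.drift_def by (rule integral_inner_right[symmetric]) (rule integrable_continuous[OF c])
  also have "\<dots> = (LINT u|\<nu>. t / L + (t / L ^ 3) * (f u)\<^sup>2 - (1 / f u) * (x \<bullet> u) - (1 / L\<^sup>2) * (f u * (x \<bullet> u)))"
  proof (intro Bochner_Integration.integral_cong refl)
    fix u assume "u \<in> space \<nu>"
    then have u: "u \<in> sphere 0 1" by (simp add: space_\<nu>)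
    show "lift_vec x t \<bullet> ((1 / f u * (norm (w u))\<^sup>2) *\<^sub>R w u)
       = t / L + (t / L ^ 3) * (f u)\<^sup>2 - (1 / f u) * (x \<bullet> u) - (1 / L\<^sup>2) * (f u * (x \<bullet> u))"
      unfolding norm_w_sq[OF u] inner_scaleR_right inner_w using f_pos[OF u] L_pos
      by (simp add: field_simps power2_eq_square power3_eq_cube)
  qed
  also have "\<dots> = (t / L) * CARD('n) + (t / L ^ 3) * L\<^sup>2 - x \<bullet> polar_mean"
    using i f_sq_integrable polar_mean_inner[of x] by (simp add: centered_inner L_sq total_mass)
  finally show ?thesis using L_pos by (simp add: field_simps power2_eq_square power3_eq_cube)
qed

text \<open>Integrate the cone slice by slice. The slice at height \<open>t\<close> is a dilate of \<open>W_open\<close> with factor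
\<open>t / L\<close>, and the dilation produces the power of \<open>t\<close>.\<close>

lemma laplace_eq:
  "(\<integral>\<^sup>+y. ennreal (indicator ct.pos_cone y * exp (- (y \<bullet> ct.drift))) \<partial>lborel)
   = (\<integral>\<^sup>+t. ennreal ((1 / L) ^ CARD('n)) * ennreal (indicator {0<..} t * (t ^ CARD('n) * exp (- (t * ((CARD('n) + 1) / L))))) * exp_moment (t / L) \<partial>lborel)"
proof -
  have [measurable]: "ct.pos_cone \<in> sets borel" using ct.open_cone by simp
  have [measurable]: "(\<lambda>x. lift_vec x t) \<in> borel_measurable borel" for t :: real by measurable
  have "(\<integral>\<^sup>+y. ennreal (indicator ct.pos_cone y * exp (- (y \<bullet> ct.drift))) \<partial>lborel)
     = (\<integral>\<^sup>+t. (\<integral>\<^sup>+x. ennreal (indicator ct.pos_cone (lift_vec x t) * exp (- (lift_vec x t \<bullet> ct.drift))) \<partial>lborel) \<partial>lborel)"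
    by (rule nn_integral_lift) measurable
  also have "\<dots> = (\<integral>\<^sup>+t. ennreal ((1 / L) ^ CARD('n)) * ennreal (indicator {0<..} t * (t ^ CARD('n) * exp (- (t * ((CARD('n) + 1) / L))))) * exp_moment (t / L) \<partial>lborel)"
  proof (intro nn_integral_cong)
    fix t :: real
    let ?g = "\<lambda>x. ennreal (indicator ct.pos_cone (lift_vec x t) * exp (- (lift_vec x t \<bullet> ct.drift)))"
    show "(\<integral>\<^sup>+x. ?g x \<partial>lborel) = ennreal ((1 / L) ^ CARD('n)) * ennreal (indicator {0<..} t * (t ^ CARD('n) * exp (- (t * ((CARD('n) + 1) / L))))) * exp_moment (t / L)"
    proof (cases "0 < t")
      case True
      have g: "?g ((t / L) *\<^sub>R x) = ennreal (exp (- (t * ((CARD('n) + 1) / L)))) * ennreal (indicator W_open x * exp ((t / L) * (x \<bullet> polar_mean)))" for x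
      proof -
        have "lift_vec ((t / L) *\<^sub>R x) t \<in> ct.pos_cone \<longleftrightarrow> x \<in> W_open"
          using True L_pos by (simp add: pos_cone_lift)
        moreover have "exp (- (lift_vec ((t / L) *\<^sub>R x) t \<bullet> ct.drift))
            = exp (- (t * ((CARD('n) + 1) / L))) * exp ((t / L) * (x \<bullet> polar_mean))"
          unfolding inner_drift exp_add[symmetric] by simp
        ultimately show ?thesis by (simp add: indicator_def ennreal_mult')
      qed
      have "(\<lambda>y. ennreal (indicator ct.pos_cone y * exp (- (y \<bullet> ct.drift)))) \<in> borel_measurable borel"
        by measurable
      then have gm: "?g \<in> borel_measurable borel" by (rule measurable_compose[rotated]) measurable
      have "(\<integral>\<^sup>+x. ?g x \<partial>lborel) = ennreal ((t / L) ^ DIM(real^'n)) * (\<integral>\<^sup>+x. ?g ((t / L) *\<^sub>R x) \<partial>lborel)"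
        using True L_pos by (intro nn_integral_lborel_scale gm divide_pos_pos)
      also have "(\<integral>\<^sup>+x. ?g ((t / L) *\<^sub>R x) \<partial>lborel) = ennreal (exp (- (t * ((CARD('n) + 1) / L)))) * exp_moment (t / L)"
        unfolding g exp_moment_def by (rule nn_integral_cmult) measurable
      also have "ennreal ((t / L) ^ DIM(real^'n)) * (ennreal (exp (- (t * ((CARD('n) + 1) / L)))) * exp_moment (t / L))
          = ennreal ((1 / L) ^ CARD('n)) * ennreal (indicator {0<..} t * (t ^ CARD('n) * exp (- (t * ((CARD('n) + 1) / L))))) * exp_moment (t / L)"
        using True L_pos by (simp add: mult.assoc[symmetric] ennreal_mult'[symmetric] power_divide)
      finally show ?thesis .
    next
      case False
      then have "?g x = 0" for x by (simp add: pos_cone_lift)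
      then show ?thesis using False by simp
    qed
  qed
  finally show ?thesis .
qed

text \<open>The value that the Laplace integral would have if \<open>polar_mean\<close> were zero.\<close>

definition flat_laplace :: real where
  "flat_laplace = measure lebesgue W * (1 / L) ^ CARD('n) * (fact CARD('n) / ((CARD('n) + 1) / L) ^ Suc CARD('n))"

lemma ennreal_flat_laplace: "ennreal flat_laplace
   = (\<integral>\<^sup>+t. ennreal ((1 / L) ^ CARD('n)) * ennreal (indicator {0<..} t * (t ^ CARD('n) * exp (- (t * ((CARD('n) + 1) / L))))) * ennreal (measure lebesgue W) \<partial>lborel)"
proof -
  have b: "0 < (CARD('n) + 1) / L" using L_pos by simp
  have "(\<integral>\<^sup>+t. ennreal ((1 / L) ^ CARD('n)) * ennreal (indicator {0<..} t * (t ^ CARD('n) * exp (- (t * ((CARD('n) + 1) / L))))) * ennreal (measure lebesgue W) \<partial>lborel)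
    = ennreal ((1 / L) ^ CARD('n)) * ennreal (fact CARD('n) / ((CARD('n) + 1) / L) ^ Suc CARD('n)) * ennreal (measure lebesgue W)"
    by (subst nn_integral_multc, measurable, subst nn_integral_cmult, measurable, subst nn_integral_power_exp[OF b], rule refl)
  also have "\<dots> = ennreal flat_laplace"
    using L_pos by (simp add: flat_laplace_def ennreal_mult'[symmetric] mult_ac)
  finally show ?thesis by simp
qed

lemma laplace_ge_flat:
  assumes "wulff_disp \<nu> f = 0"
  shows "ennreal flat_laplace \<le> (\<integral>\<^sup>+y. ennreal (indicator ct.pos_cone y * exp (- (y \<bullet> ct.drift))) \<partial>lborel)"
  unfolding ennreal_flat_laplace laplace_eq
  by (intro nn_integral_mono mult_left_mono exp_moment_ge assms) simp

lemma laplace_eq_flat: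
  assumes "polar_mean = 0"
  shows "ennreal flat_laplace = (\<integral>\<^sup>+y. ennreal (indicator ct.pos_cone y * exp (- (y \<bullet> ct.drift))) \<partial>lborel)"
  unfolding ennreal_flat_laplace laplace_eq exp_moment_flat[OF assms] ..

definition volume_bound :: real where
  "volume_bound = (real CARD('n) + 1) powr ((real CARD('n) + 1) / 2) / fact CARD('n) * L ^ CARD('n)"

text \<open>The last factor is \<open>exp (- log_bound)\<close> with the least possible value of \<open>ratio_entropy\<close>, so the
volume inequality says that \<open>flat_laplace\<close> is at most this factor.\<close>

lemma flat_laplace_bound:
  "flat_laplace = measure lebesgue W / volume_bound * exp (- ((CARD('n) + 1) * ln (1 + CARD('n)) / 2 - (CARD('n) + 1) * ln L))"
proof -
  let ?n = "CARD('n)"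
  let ?q = "(real ?n + 1) powr ((real ?n + 1) / 2)"
  have q: "?q * ?q = (real ?n + 1) ^ Suc ?n"
  proof -
    have "(real ?n + 1) / 2 + (real ?n + 1) / 2 = real (Suc ?n)" by simp
    then have "?q * ?q = (real ?n + 1) powr real (Suc ?n)" by (simp only: powr_add[symmetric])
    also have "\<dots> = (real ?n + 1) ^ Suc ?n" by (rule powr_realpow) simp
    finally show ?thesis .
  qed
  have "exp (- ((?n + 1) * ln (1 + ?n) / 2 - (?n + 1) * ln L)) = exp ((?n + 1) * ln L) / exp ((real ?n + 1) / 2 * ln (1 + ?n))"
    by (simp add: exp_diff[symmetric])
  also have "exp ((?n + 1) * ln L) = L ^ Suc ?n" using L_pos
    by (metis Suc_eq_plus1 exp_ln exp_of_nat_mult)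
  also have "exp ((real ?n + 1) / 2 * ln (1 + ?n)) = ?q" by (simp add: powr_def add.commute)
  finally have e: "exp (- ((?n + 1) * ln (1 + ?n) / 2 - (?n + 1) * ln L)) = L ^ Suc ?n / ?q" .
  have qp: "?q > 0" by simp
  have "flat_laplace = measure lebesgue W * fact ?n * L / (?q * ?q)"
    unfolding q flat_laplace_def using L_pos by (simp add: field_simps)
  also have "\<dots> = measure lebesgue W / volume_bound * (L ^ Suc ?n / ?q)"
    unfolding volume_bound_def using L_pos qp by (simp add: field_simps)
  finally show ?thesis by (simp only: e)
qed

lemma volume_bound_pos: "0 < volume_bound"
  using L_pos by (simp add: volume_bound_def)

text \<open>The chain is \<open>flat_laplace\<close>, the Laplace integral, \<open>exp (- log_bound)\<close>, and its largest possible
value. If the volume attains its bound then all links are equalities.\<close>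

theorem volume_le:
  assumes "wulff_disp \<nu> f = 0"
  shows "measure lebesgue W \<le> volume_bound"
    and "measure lebesgue W = volume_bound \<Longrightarrow>
       ratio_entropy = (CARD('n) + 1) * ln (1 + CARD('n)) \<and>
       ennreal (exp (- ct.log_bound)) \<le> (\<integral>\<^sup>+y. ennreal (indicator ct.pos_cone y * exp (- (y \<bullet> ct.drift))) \<partial>lborel)"
proof -
  let ?e0 = "(CARD('n) + 1) * ln (1 + CARD('n))"
  have "ennreal flat_laplace \<le> ennreal (exp (- ct.log_bound))"
    using laplace_ge_flat[OF assms] ct.laplace_cone_le by (rule order_trans)
  then have m: "flat_laplace \<le> exp (- ct.log_bound)" by simp
  have lb: "?e0 / 2 - (CARD('n) + 1) * ln L \<le> ct.log_bound"
    using ratio_entropy_ge unfolding log_bound_eq by simp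
  then have le: "exp (- ct.log_bound) \<le> exp (- (?e0 / 2 - (CARD('n) + 1) * ln L))" by simp
  have "measure lebesgue W / volume_bound * exp (- (?e0 / 2 - (CARD('n) + 1) * ln L)) \<le> 1 * exp (- (?e0 / 2 - (CARD('n) + 1) * ln L))"
    using order_trans[OF m le] unfolding flat_laplace_bound by simp
  then have "measure lebesgue W / volume_bound \<le> 1" by (simp only: mult_le_cancel_right_pos exp_gt_zero)
  then show "measure lebesgue W \<le> volume_bound" using volume_bound_pos by simp
  assume "measure lebesgue W = volume_bound"
  then have "flat_laplace = exp (- (?e0 / 2 - (CARD('n) + 1) * ln L))" using volume_bound_pos unfolding flat_laplace_bound by simp
  then have eq: "exp (- ct.log_bound) = flat_laplace" "ct.log_bound = ?e0 / 2 - (CARD('n) + 1) * ln L" using m le lb by auto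
  from eq(2) have "ratio_entropy = ?e0" unfolding log_bound_eq by simp
  moreover have "ennreal (exp (- ct.log_bound)) \<le> (\<integral>\<^sup>+y. ennreal (indicator ct.pos_cone y * exp (- (y \<bullet> ct.drift))) \<partial>lborel)"
    unfolding eq(1) by (rule laplace_ge_flat[OF assms])
  ultimately show "ratio_entropy = ?e0 \<and> ennreal (exp (- ct.log_bound)) \<le> (\<integral>\<^sup>+y. ennreal (indicator ct.pos_cone y * exp (- (y \<bullet> ct.drift))) \<partial>lborel)" ..
qed

end

section \<open>The equality case\<close>

lemma AE_not_in_open_imp_empty:
  fixes U :: "'a::euclidean_space set"
  assumes "open U" "AE y in lborel. y \<notin> U"
  shows "U = {}"
proof (rule ccontr)
  assume "U \<noteq> {}"
  have "AE y in lebesgue. y \<notin> U" using assms(2) by (simp only: AE_completion_iff)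
  moreover have "U \<in> sets lebesgue" using assms(1) by (simp add: borel_open sets_completionI_sets)
  ultimately have "U \<in> null_sets lebesgue" by (simp only: AE_iff_null_sets)
  then have "negligible U" by (simp only: negligible_iff_null_sets)
  then show False using open_not_negligible[OF assms(1) \<open>U \<noteq> {}\<close>] by simp
qed

text \<open>Pairing an affine dependence with one of the points gives \<open>(1 + 1 / n)\<close> times the coefficient of that
point, because the coefficients add up to zero; so the points are affinely independent.\<close>

lemma equiangular_regular_simplex:
  fixes S :: "(real^'n) set"
  assumes S: "finite S" "card S = Suc CARD('n)" "S \<subseteq> sphere 0 1"
    and ip: "\<And>u v. u \<in> S \<Longrightarrow> v \<in> S \<Longrightarrow> u \<noteq> v \<Longrightarrow> u \<bullet> v = - 1 / CARD('n)"
  shows "regular_simplex (convex hull S)" "inscribed_in_sphere (convex hull S)"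
proof -
  have one: "u \<bullet> u = 1" if "u \<in> S" for u using S(3) that by (auto simp: norm_eq_1)
  have indep: "\<not> affine_dependent S"
  proof
    assume "affine_dependent S"
    then obtain U v where U: "sum U S = 0" "v \<in> S" "U v \<noteq> 0" "(\<Sum>u\<in>S. U u *\<^sub>R u) = 0"
      unfolding affine_dependent_explicit_finite[OF S(1)] by blast
    have "0 = (\<Sum>u\<in>S. U u *\<^sub>R u) \<bullet> v" using U(4) by simp
    also have "\<dots> = (\<Sum>u\<in>S. U u * (u \<bullet> v))" by (simp add: inner_sum_left)
    also have "\<dots> = U v * (v \<bullet> v) + (\<Sum>u\<in>S - {v}. U u * (u \<bullet> v))" using S(1) U(2) by (rule sum.remove)
    also have "(\<Sum>u\<in>S - {v}. U u * (u \<bullet> v)) = (\<Sum>u\<in>S - {v}. U u * (- 1 / CARD('n)))"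
      using ip U(2) by (intro sum.cong refl) auto
    also have "\<dots> = (sum U S - U v) * (- 1 / CARD('n))"
      using S(1) U(2) by (simp only: sum_distrib_right[symmetric] sum_diff1 if_True)
    finally have "U v * (1 + 1 / CARD('n)) = 0" using one[OF U(2)] U(1) by (simp add: algebra_simps)
    moreover have "1 + 1 / real CARD('n) > 0" by (simp add: add_pos_nonneg)
    ultimately show False using U(3) by simp
  qed
  have vert: "vertices (convex hull S) = S"
    using extreme_point_of_convex_hull_affine_independent[OF indep] by (auto simp: vertices_def)
  show "inscribed_in_sphere (convex hull S)" using S(3) by (simp add: inscribed_in_sphere_def vert)
  have "dist u v = sqrt (2 + 2 / CARD('n))" if "u \<in> S" "v \<in> S" "u \<noteq> v" for u v
  proof -
    have "(dist u v)\<^sup>2 = u \<bullet> u - 2 * (u \<bullet> v) + v \<bullet> v"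
      unfolding dist_norm power2_norm_eq_inner by (simp add: inner_diff inner_commute)
    also have "\<dots> = 2 + 2 / CARD('n)" using one that ip by simp
    finally have "sqrt ((dist u v)\<^sup>2) = sqrt (2 + 2 / CARD('n))" by simp
    then show ?thesis by simp
  qed
  then have "pairwise (\<lambda>x y. dist x y = sqrt (2 + 2 / CARD('n))) S" by (simp add: pairwise_def)
  moreover have "int CARD('n) simplex convex hull S"
    unfolding simplex_def using indep S(2) by (intro exI[of _ S]) simp
  ultimately show "regular_simplex (convex hull S)" unfolding regular_simplex_def vert by blast
qed

context wulff_transport
begin

lemma pos_cone_nonempty: "ct.pos_cone \<noteq> {}"
proof -
  have "lift_vec 0 1 \<in> ct.pos_cone" using f_pos supp_subset by (auto simp: pos_cone_lift W_open_def)
  then show ?thesis by blast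
qed

lemma level_pos: "y \<in> ct.pos_cone \<Longrightarrow> u \<in> supp \<Longrightarrow> 0 < ct.level y u"
  using pos_cone_iff f_pos[of u] supp_subset by (auto simp: ct.level_def)

text \<open>Continuity removes both exceptional sets, first the one in \<open>u\<close> by passing to the support, then the
one in \<open>y\<close> because the cone is open.\<close>

lemma supp_transport_linear:
  assumes ae: "AE y in lborel. y \<in> ct.pos_cone \<longrightarrow> (AE u in \<nu>. T (ct.level y u) * norm (w u) = ct.transport_map y \<bullet> w u)"
    and u: "u \<in> supp" and y: "y \<in> ct.pos_cone"
  shows "T (ct.level y u) * norm (w u) = ct.transport_map y \<bullet> w u"
proof -
  have Tc: "continuous_on {0<..} T" by (rule ct.T_continuous) simp
  have w': "continuous_on supp w" by (rule continuous_on_subset[OF w_cont supp_subset])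
  have ae': "AE y in lborel. y \<in> ct.pos_cone \<longrightarrow> T (ct.level y u) * norm (w u) = ct.transport_map y \<bullet> w u"
    using ae
  proof eventually_elim
    case (elim y)
    show ?case
    proof
      assume y: "y \<in> ct.pos_cone"
      have "continuous_on (sphere 0 1) (ct.level y)"
        unfolding ct.level_def[abs_def] by (intro continuous_intros)
      then have "continuous_on supp (ct.level y)" by (rule continuous_on_subset) (rule supp_subset)
      then have "continuous_on supp (\<lambda>u. T (ct.level y u))"
        by (rule continuous_on_compose2[OF Tc]) (use level_pos[OF y] in auto)
      then show "T (ct.level y u) * norm (w u) = ct.transport_map y \<bullet> w u"
        using elim y w' by (intro AE_continuous_on_supp_eq[OF _ _ _ u] continuous_intros) auto
    qed
  qed
  let ?h = "\<lambda>y. T (ct.level y u) * norm (w u) - ct.transport_map y \<bullet> w u"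
  have "continuous_on ct.pos_cone ?h"
  proof (intro continuous_intros)
    show "continuous_on ct.pos_cone ct.transport_map"
      using ct.transport_map_has_derivative by (meson continuous_at_imp_continuous_on has_derivative_continuous)
    have "continuous_on ct.pos_cone (\<lambda>y. ct.level y u)"
      unfolding ct.level_def by (intro continuous_intros)
    then show "continuous_on ct.pos_cone (\<lambda>y. T (ct.level y u))"
      by (rule continuous_on_compose2[OF Tc]) (use level_pos[OF _ u] in auto)
  qed
  then have "open (ct.pos_cone \<inter> ?h -` (- {0}))"
    by (rule continuous_open_preimage[OF _ ct.open_cone]) auto
  moreover have "AE y in lborel. y \<notin> ct.pos_cone \<inter> ?h -` (- {0})"
    using ae' by eventually_elim auto
  ultimately have "ct.pos_cone \<inter> ?h -` (- {0}) = {}" by (rule AE_not_in_open_imp_empty)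
  then show ?thesis using y by auto
qed

text \<open>The lifted support is an orthogonal system by rigidity and spans by isotropy, so it has \<open>n + 1\<close>
elements. As \<open>f\<close> has the constant value \<open>L / sqrt n\<close> on the support, orthogonality of the lifts means
\<open>u \<bullet> v = - 1 / n\<close> for distinct \<open>u\<close> and \<open>v\<close> there.\<close>

theorem equality_imp_simplex:
  assumes disp: "wulff_disp \<nu> f = 0" and eq: "measure lebesgue W = volume_bound"
  shows "regular_simplex (convex hull supp) \<and> inscribed_in_sphere (convex hull supp) \<and> f constant_on supp"
proof -
  note vol = volume_le(2)[OF disp eq]
  define c where "c = L / sqrt CARD('n)"
  have fc: "f u = c" if "u \<in> supp" for u using ratio_entropy_eq_imp[OF conjunct1[OF vol] that] by (simp add: c_def)
  have c0: "0 < c" using L_pos by (simp add: c_def)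
  note lin = supp_transport_linear[OF ct.laplace_cone_eq_imp[OF conjunct2[OF vol]]]
  have orth: "w u1 \<bullet> w u2 = 0" if u: "u1 \<in> supp" "u2 \<in> supp" "u1 \<noteq> u2" for u1 u2
  proof (rule ct.rigid_orthogonal)
    show "0 < ct.level y u1 \<and> T (ct.level y u1) * norm (w u1) = ct.transport_map y \<bullet> w u1" if "y \<in> ct.pos_cone" for y
      using level_pos[OF that u(1)] lin[OF u(1) that] by blast
    show "0 < ct.level y u2 \<and> T (ct.level y u2) * norm (w u2) = ct.transport_map y \<bullet> w u2" if "y \<in> ct.pos_cone" for y
      using level_pos[OF that u(2)] lin[OF u(2) that] by blast
    show "u1 \<in> space \<nu>" "u2 \<in> space \<nu>" using u supp_subset by (auto simp: space_\<nu>)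
    show "ct.pos_cone \<noteq> {}" by (rule pos_cone_nonempty)
    show "w u2 \<noteq> t *\<^sub>R w u1" for t
    proof
      assume "w u2 = t *\<^sub>R w u1"
      then have "- u2 = - (t *\<^sub>R u1)" "f u2 / L = t * (f u1 / L)"
        unfolding w_def scaleR_lift_vec lift_vec_eq_iff by auto
      moreover from this(2) have "t = 1" using fc u c0 L_pos by (simp add: field_simps)
      ultimately show False using u(3) by simp
    qed
  qed
  have w0: "w u \<noteq> 0" if "u \<in> supp" for u
    using norm_w_ge[of u] that supp_subset by auto
  have inj: "inj_on w supp"
    by (rule inj_onI) (simp add: w_def lift_vec_eq_iff)
  have "pairwise orthogonal (w ` supp)"
    using orth by (auto simp: pairwise_def orthogonal_def)
  then have ind: "independent (w ` supp)"
    using w0 by (intro pairwise_orthogonal_independent) auto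
  have "span (w ` supp) = UNIV"
  proof (rule ccontr)
    assume "span (w ` supp) \<noteq> UNIV"
    then obtain a where a: "a \<noteq> 0" "\<forall>x\<in>span (w ` supp). a \<bullet> x = 0" using span_not_UNIV_orthogonal by blast
    have "AE u in \<nu>. (a \<bullet> w u) * (a \<bullet> w u) = 0"
      using AE_supp by eventually_elim (use a(2) in \<open>auto intro: span_base\<close>)
    then have "(LINT u|\<nu>. (a \<bullet> w u) * (a \<bullet> w u)) = 0" by (rule integral_eq_zero_AE)
    then show False using a(1) by (simp add: isotropy_w)
  qed
  then have "card (w ` supp) = Suc CARD('n)"
    using dim_eq_card_independent[OF ind] dim_span[of "w ` supp"] by (simp add: CARD_lift)
  then have card: "card supp = Suc CARD('n)" using card_image[OF inj] by simp
  then have fin: "finite supp" by (metis card.infinite nat.distinct(1))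
  have ip: "u \<bullet> v = - 1 / CARD('n)" if "u \<in> supp" "v \<in> supp" "u \<noteq> v" for u v
  proof -
    have "(c / L) * (c / L) = 1 / CARD('n)" using L_pos by (simp add: c_def)
    then show ?thesis using orth[OF that] fc that by (simp add: w_def inner_lift_vec)
  qed
  show ?thesis
    using equiangular_regular_simplex[OF fin card supp_subset ip] fc by (auto simp: constant_on_def)
qed

text \<open>The support consists of the vertices, because points of the sphere are extreme in any subset of the
ball. For \<open>n + 1\<close> vectors in dimension \<open>n + 1\<close>, isotropy of the weighted lifts states that a
square matrix \<open>Q\<close> satisfies \<open>transpose Q ** Q = mat 1\<close>; then also \<open>Q ** transpose Q = mat 1\<close>, so the
weighted lifts are orthonormal. The cone is the orthant spanned by them and its Laplace integral
is explicit. It coincides with \<open>flat_laplace\<close>, since centering with constant \<open>f\<close> gives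
\<open>polar_mean = 0\<close>.\<close>

theorem simplex_imp_equality:
  assumes simp: "regular_simplex (convex hull supp)" and const: "f constant_on supp"
  shows "measure lebesgue W = volume_bound"
proof -
  let ?n = "CARD('n)"
  obtain C where C: "\<not> affine_dependent C" "card C = Suc ?n" "convex hull supp = convex hull C"
    using simp unfolding regular_simplex_def simplex_def by auto
  have finC: "finite C" using C(1) by (rule aff_independent_finite)
  have supp_C: "supp = C"
  proof
    show "C \<subseteq> supp"
    proof
      fix x assume "x \<in> C"
      then have "x extreme_point_of (convex hull supp)"
        using extreme_point_of_convex_hull_affine_independent[OF C(1)] C(3) by simp
      then show "x \<in> supp" by (rule extreme_point_of_convex_hull)
    qed
    show "supp \<subseteq> C"
    proof
      fix x assume x: "x \<in> supp"
      have sub: "convex hull supp \<subseteq> cball 0 1" using supp_subset by (intro hull_minimal) auto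
      have nx: "norm x = 1" using x supp_subset by auto
      have "x extreme_point_of (convex hull supp)"
        unfolding extreme_point_of_def
      proof (intro conjI ballI notI)
        show "x \<in> convex hull supp" using x by (rule hull_inc)
        fix a b assume ab: "a \<in> convex hull supp" "b \<in> convex hull supp" "x \<in> open_segment a b"
        have "norm a \<le> 1" "norm b \<le> 1" using ab sub by auto
        then show False using dist_decreases_open_segment[OF ab(3), of 0] nx by auto
      qed
      then show "x \<in> C"
        using extreme_point_of_convex_hull_affine_independent[OF C(1)] C(3) by simp
    qed
  qed
  then have fin: "finite supp" and card: "card supp = Suc ?n" using C finC by auto
  obtain c where fc: "\<And>u. u \<in> supp \<Longrightarrow> f u = c" using const unfolding constant_on_def by blast
  have AEf: "AE u in \<nu>. f u = c" using AE_supp by eventually_elim (rule fc)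
  have c0: "0 < c" using supp_nonempty fc f_pos supp_subset by (metis ex_in_conv subsetD)
  have "L\<^sup>2 = (LINT u|\<nu>. c\<^sup>2)"
    unfolding L_sq using AEf by (intro integral_cong_AE borel_measurable_integrable f_sq_integrable) (auto elim: eventually_mono)
  then have L2: "L\<^sup>2 = c\<^sup>2 * ?n" by (simp add: total_mass)
  have "x \<bullet> polar_mean = 0" for x
  proof -
    have "x \<bullet> polar_mean = (LINT u|\<nu>. (1 / f u) * (x \<bullet> u))" by (rule polar_mean_inner[symmetric])
    also have "\<dots> = (LINT u|\<nu>. (1 / c\<^sup>2) * (f u * (x \<bullet> u)))"
    proof (rule integral_cong_AE)
      show "AE u in \<nu>. (1 / f u) * (x \<bullet> u) = (1 / c\<^sup>2) * (f u * (x \<bullet> u))"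
        using AEf by eventually_elim (use c0 in \<open>simp add: power2_eq_square\<close>)
    qed (intro measurable_continuous continuous_intros f_cont)+
    also have "\<dots> = 0" by (simp add: centered_inner)
    finally show ?thesis .
  qed
  then have pm: "polar_mean = 0" by (metis inner_eq_zero_iff)
  define m where "m u = measure \<nu> {u}" for u
  \<comment> \<open>\<open>\<nu>\<close> is concentrated on finitely many points\<close>
  have int: "(LINT u|\<nu>. g u) = (\<Sum>u\<in>supp. m u * g u)" if g: "continuous_on (sphere 0 1) g" for g :: "real^'n \<Rightarrow> real"
  proof -
    have sing: "{v} \<in> sets \<nu>" if "v \<in> supp" for v
      using that supp_subset unfolding sets_\<nu> sets_restrict_space by (intro image_eqI[of _ _ "{v}"]) auto
    have "(LINT u|\<nu>. g u) = (LINT u|\<nu>. (\<Sum>v\<in>supp. indicator {v} u * g v))"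
    proof (rule integral_cong_AE)
      show "AE u in \<nu>. g u = (\<Sum>v\<in>supp. indicator {v} u * g v)"
        using AE_supp
      proof eventually_elim
        case (elim u)
        have "(\<Sum>v\<in>supp. indicator {v} u * g v) = (\<Sum>v\<in>supp. if u = v then g v else 0)"
          by (intro sum.cong refl) (auto simp: indicator_def)
        then show ?case using elim fin by (simp add: sum.delta)
      qed
      show "g \<in> borel_measurable \<nu>" by (rule measurable_continuous[OF g])
      show "(\<lambda>u. \<Sum>v\<in>supp. indicator {v} u * g v) \<in> borel_measurable \<nu>"
        using sing by (intro borel_measurable_sum borel_measurable_times borel_measurable_indicator) auto
    qed
    also have "\<dots> = (\<Sum>v\<in>supp. LINT u|\<nu>. indicator {v} u * g v)"
      using sing by (intro Bochner_Integration.integral_sum) (auto simp: less_top[symmetric])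
    also have "\<dots> = (\<Sum>v\<in>supp. m v * g v)"
    proof (intro sum.cong refl)
      fix v assume "v \<in> supp"
      then have "{v} \<inter> space \<nu> = {v}" using supp_subset by (auto simp: space_\<nu>)
      then show "(LINT u|\<nu>. indicator {v} u * g v) = m v * g v" by (simp add: m_def)
    qed
    finally show ?thesis .
  qed
  obtain e where e: "bij_betw e (UNIV :: 'n lift set) supp"
    using finite_same_card_bij[of "UNIV :: 'n lift set", OF finite fin] card CARD_lift[where 'a='n] by auto
  have eS: "e i \<in> supp" for i using e by (auto simp: bij_betw_def)
  define E where "E i = sqrt (m (e i)) *\<^sub>R w (e i)" for i
  have sqm: "sqrt (m u) * sqrt (m u) = m u" for u by (simp add: m_def)
  define Q :: "((real, 'n lift) vec, 'n lift) vec" where "Q = (\<chi> i j. E i $ j)"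
  have "transpose Q ** Q = mat 1"
  proof -
    have "(transpose Q ** Q) $ a $ b' = (axis a 1 :: (real, 'n lift) vec) \<bullet> axis b' 1" for a b'
    proof -
      have "(transpose Q ** Q) $ a $ b' = (\<Sum>i\<in>UNIV. m (e i) * ((axis a 1 \<bullet> w (e i)) * (axis b' 1 \<bullet> w (e i))))"
      proof -
        have "E i $ a * E i $ b' = m (e i) * (w (e i) $ a * w (e i) $ b')" for i
        proof -
          have "E i $ a * E i $ b' = (sqrt (m (e i)) * sqrt (m (e i))) * (w (e i) $ a * w (e i) $ b')"
            by (simp only: E_def vector_scaleR_component real_scaleR_def mult_ac)
          then show ?thesis by (simp only: sqm)
        qed
        then show ?thesis
          by (simp add: Q_def matrix_matrix_mult_def transpose_def inner_axis')
      qed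
      also have "\<dots> = (\<Sum>u\<in>supp. m u * ((axis a 1 \<bullet> w u) * (axis b' 1 \<bullet> w u)))"
        by (rule sum.reindex_bij_betw[OF e])
      also have "\<dots> = (LINT u|\<nu>. (axis a 1 \<bullet> w u) * (axis b' 1 \<bullet> w u))"
        by (rule int[symmetric]) (intro continuous_intros)
      finally show ?thesis by (simp add: isotropy_w)
    qed
    then show ?thesis by (simp add: vec_eq_iff mat_def inner_axis_axis)
  qed
  then have QQ: "Q ** transpose Q = mat 1" by (simp add: matrix_left_right_inverse)
  have orth: "E i \<bullet> E j = (if i = j then 1 else 0)" for i j
  proof -
    have "(Q ** transpose Q) $ i $ j = E i \<bullet> E j"
      by (simp add: Q_def matrix_matrix_mult_def transpose_def inner_vec_def)
    then show ?thesis unfolding QQ by (simp add: mat_def)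
  qed
  have ratio: "ratio u = 1 / ?n" if "u \<in> supp" for u
    using fc[OF that] L2 c0 by (simp add: ratio_def)
  have nw: "(norm (w u))\<^sup>2 = 1 + 1 / ?n" if "u \<in> supp" for u
    using norm_w_sq[of u] ratio[OF that] that supp_subset by (auto simp: ratio_def)
  have mE: "m (e i) * (1 + 1 / ?n) = 1" for i
  proof -
    have "1 = m (e i) * (w (e i) \<bullet> w (e i))"
      using orth[of i i] sqm[of "e i"] by (simp add: E_def mult.assoc[symmetric])
    then show ?thesis using nw[OF eS[of i]] by (simp add: dot_square_norm)
  qed
  \<comment> \<open>all vertices carry the mass \<open>n / (n + 1)\<close>\<close>
  define m0 where "m0 = 1 / (1 + 1 / real ?n)"
  have n1: "1 + 1 / real ?n > 0" by (simp add: add_pos_nonneg)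
  have m0: "m0 > 0" using n1 by (simp add: m0_def)
  have me: "m (e i) = m0" for i using mE[of i] n1 by (simp add: m0_def field_simps)
  \<comment> \<open>the rate of the exponential along each axis of the orthant\<close>
  define l where "l = 1 / (c * sqrt m0)"
  have l: "0 < l" using c0 m0 by (simp add: l_def)
  have yE: "y \<bullet> E i = sqrt m0 * (y \<bullet> w (e i))" for y i by (simp add: E_def me)
  have cone: "ct.pos_cone = {y. \<forall>i. 0 < y \<bullet> E i}"
  proof -
    have "(\<forall>u\<in>supp. 0 < y \<bullet> w u) \<longleftrightarrow> (\<forall>i. 0 < y \<bullet> w (e i))" for y
      unfolding bij_betw_imp_surj_on[OF e, symmetric] by blast
    then show ?thesis using m0 by (auto simp: pos_cone_iff yE zero_less_mult_iff)
  qed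
  have drift: "y \<bullet> ct.drift = (\<Sum>i\<in>UNIV. l * (y \<bullet> E i))" for y
  proof -
    have cont: "continuous_on (sphere 0 1) (\<lambda>u. (1 / f u * (norm (w u))\<^sup>2) *\<^sub>R w u)"
      by (intro continuous_intros)
    have "y \<bullet> ct.drift = (LINT u|\<nu>. y \<bullet> ((1 / f u * (norm (w u))\<^sup>2) *\<^sub>R w u))"
      unfolding ct.drift_def by (rule integral_inner_right[symmetric]) (rule integrable_continuous[OF cont])
    also have "\<dots> = (\<Sum>u\<in>supp. m u * (y \<bullet> ((1 / f u * (norm (w u))\<^sup>2) *\<^sub>R w u)))"
      by (rule int) (intro continuous_on_inner continuous_on_const cont)
    also have "\<dots> = (\<Sum>i\<in>UNIV. m (e i) * (y \<bullet> ((1 / f (e i) * (norm (w (e i)))\<^sup>2) *\<^sub>R w (e i))))"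
      by (rule sum.reindex_bij_betw[OF e, symmetric])
    also have "\<dots> = (\<Sum>i\<in>UNIV. l * (y \<bullet> E i))"
    proof (intro sum.cong refl)
      fix i
      have "m (e i) * (y \<bullet> ((1 / f (e i) * (norm (w (e i)))\<^sup>2) *\<^sub>R w (e i))) = (m (e i) * (1 + 1 / ?n)) * (y \<bullet> w (e i)) / c"
        unfolding nw[OF eS] fc[OF eS] by simp
      also have "\<dots> = (y \<bullet> w (e i)) / c" unfolding mE by simp
      also have "\<dots> = l * (y \<bullet> E i)" using m0 by (simp add: l_def yE)
      finally show "m (e i) * (y \<bullet> ((1 / f (e i) * (norm (w (e i)))\<^sup>2) *\<^sub>R w (e i))) = l * (y \<bullet> E i)" .
    qed
    finally show ?thesis .
  qed
  have "ennreal flat_laplace = ennreal ((1 / l) ^ CARD('n lift))"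
    unfolding laplace_eq_flat[OF pm] cone drift by (rule nn_integral_orthant[OF orth l])
  moreover have "0 \<le> flat_laplace" using L_pos by (simp add: flat_laplace_def)
  ultimately have flat_laplace: "flat_laplace = (1 / l) ^ Suc ?n" using l by (simp add: CARD_lift)
  have "1 / l = L / sqrt (1 + ?n)"
  proof -
    have "(1 / l)\<^sup>2 = (L / sqrt (1 + ?n))\<^sup>2"
      using m0 L2 by (simp add: l_def power_mult_distrib power_divide m0_def field_simps)
    then show ?thesis using l L_pos by (simp add: power2_eq_iff_nonneg)
  qed
  also have "(L / sqrt (1 + ?n)) ^ Suc ?n = exp (- ((?n + 1) * ln (1 + ?n) / 2 - (?n + 1) * ln L))"
  proof -
    have p: "0 < L / sqrt (1 + ?n)" using L_pos by simp
    have "ln (L / sqrt (1 + ?n)) = ln L - ln (1 + ?n) / 2" using L_pos by (simp add: ln_div ln_sqrt)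
    then have "(L / sqrt (1 + ?n)) ^ Suc ?n = exp (Suc ?n * (ln L - ln (1 + ?n) / 2))"
      unfolding exp_of_nat_mult using p by (metis exp_ln)
    then show ?thesis by (simp add: algebra_simps)
  qed
  finally have "flat_laplace = 1 * exp (- ((?n + 1) * ln (1 + ?n) / 2 - (?n + 1) * ln L))" using flat_laplace by simp
  then have "measure lebesgue W / volume_bound = 1" unfolding flat_laplace_bound by (simp only: mult_cancel_right exp_not_eq_zero) simp
  then show ?thesis using volume_bound_pos by simp
qed

end

theorem theorem1:
  fixes f :: "real^'n \<Rightarrow> real" and \<nu> :: "(real^'n) measure"
  assumes "CARD('n) \<ge> 2"
    and "continuous_on (sphere 0 1) f"
    and "\<And>u. u \<in> sphere 0 1 \<Longrightarrow> f u > 0"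
    and "sphere_borel_measure \<nu>"
    and "isotropic \<nu>"
    and "centered_wrt f \<nu>"
    and "wulff_disp \<nu> f = 0"
  shows "measure lebesgue (wulff_shape \<nu> f)
           \<le> (real CARD('n) + 1) powr ((real CARD('n) + 1) / 2) / fact CARD('n)
              * L2_norm_wrt \<nu> f ^ CARD('n)
       \<and> (measure lebesgue (wulff_shape \<nu> f)
           = (real CARD('n) + 1) powr ((real CARD('n) + 1) / 2) / fact CARD('n)
              * L2_norm_wrt \<nu> f ^ CARD('n)
          \<longleftrightarrow>
          regular_simplex (convex hull measure_support \<nu>)
          \<and> inscribed_in_sphere (convex hull measure_support \<nu>)
          \<and> f constant_on measure_support \<nu>)"
proof -
  interpret wulff_data f \<nu> by unfold_locales (use assms in auto)
  obtain B T b where "cone_transport \<nu> w B (\<lambda>u. 1 / f u) T b" by (rule exists_cone_transport)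
  then interpret wulff_transport f \<nu> B T b by (intro wulff_transport.intro wulff_data_axioms)
  have "volume_bound = (real CARD('n) + 1) powr ((real CARD('n) + 1) / 2) / fact CARD('n)
              * L2_norm_wrt \<nu> f ^ CARD('n)"
    by (simp add: volume_bound_def L_def)
  then show ?thesis
    using volume_le(1)[OF assms(7)] equality_imp_simplex[OF assms(7)] simplex_imp_equality by metis
qed

end
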